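(* Let $d\ge 1$ and let $\{f_n\}_{n\in\mathbb{N}}$ be a sequence in $\mathrm{BV}(\mathbb{R}^d)$ which converges weakly in the Banach space $\mathrm{BV}(\mathbb{R}^d)$ to a function $f\in\mathrm{BV}(\mathbb{R}^d)$. Then \[ \lim_{n\to\infty}\big\|D^j(f-f_n)\big\| = 0, \] i.e. the jump parts of the gradients converge in total variation norm.
   Context: $\mathrm{BV}(\mathbb{R}^d)$ is the space of $u\in L^1(\mathbb{R}^d)$ whose distributional gradient $Du$ is an $\mathbb{R}^d$-valued finite Radon measure, with norm $\|u\|_{\mathrm{BV}}=\|u\|_{L^1}+\|Du\|$, where $\|\mu\|$ denotes the total variation of a measure $\mu$. A point $x$ is an approximate jump point of $u$ if there are $a\neq b$ and a unit vector $\nu$ with $\lim_{\rho\to0^+}\frac{1}{|B^+_\rho(x,\nu)|}\int_{B^+_\rho(x,\nu)}|u-a|=0$ and $\lim_{\rho\to0^+}\frac{1}{|B^-_\rho(x,\nu)|}\int_{B^-_\rho(x,\nu)}|u-b|=0$, where $B^\pm_\rho(x,\nu)=\{y\in B_\rho(x):\pm(y-x)\cdot\nu>0\}$; one writes $u^+(x)=a$, $u^-(x)=b$, $\nu_u(x)=\nu$. The set of such points is the jump set $J_u$. The jump part of the gradient is $D^ju=(D^su)|_{J_u}=(u^+-u^-)\otimes\nu_u\,\mathcal{H}^{d-1}|_{J_u}$, where $D^su$ is the singular part of $Du$ with respect to Lebesgue measure and $\mathcal{H}^{d-1}$ is the $(d-1)$-dimensional Hausdorff measure. *)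

theory Defs
  imports "HOL-Analysis.Analysis"
begin

definition Cc1_field :: "(real^'d \<Rightarrow> real^'d) \<Rightarrow> bool" where
  "Cc1_field \<phi> \<longleftrightarrow>
     (\<forall>x. \<phi> differentiable (at x)) \<and>
     (\<forall>v. continuous_on UNIV (\<lambda>x. frechet_derivative \<phi> (at x) v)) \<and>
     compact (closure {x. \<phi> x \<noteq> 0})"

definition divergence :: "(real^'d \<Rightarrow> real^'d) \<Rightarrow> real^'d \<Rightarrow> real" where
  "divergence \<phi> x = (\<Sum>i\<in>UNIV. frechet_derivative \<phi> (at x) (axis i 1) $ i)"

text \<open>The distributional gradient Du is an R^d-valued finite Radon measure; we
  represent it through its polar decomposition Du = sigma |Du|:
  mu = |Du| is a finite Borel measure and sigma a Borel unit vector field, with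
  int u div(phi) dx = - int phi . sigma d mu for all C^1_c fields phi.\<close>

definition grad_measure ::
  "(real^'d \<Rightarrow> real) \<Rightarrow> (real^'d) measure \<Rightarrow> (real^'d \<Rightarrow> real^'d) \<Rightarrow> bool" where
  "grad_measure u \<mu> \<sigma> \<longleftrightarrow>
     sets \<mu> = sets borel \<and> finite_measure \<mu> \<and>
     \<sigma> \<in> borel_measurable borel \<and> (\<forall>x. norm (\<sigma> x) = 1) \<and>
     (\<forall>\<phi>. Cc1_field \<phi> \<longrightarrow>
        integrable \<mu> (\<lambda>x. \<phi> x \<bullet> \<sigma> x) \<and>
        (\<integral>x. u x * divergence \<phi> x \<partial>lebesgue) = - (\<integral>x. \<phi> x \<bullet> \<sigma> x \<partial>\<mu>))"

definition BV :: "(real^'d \<Rightarrow> real) set" where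
  "BV = {u. integrable lebesgue u \<and> (\<exists>\<mu> \<sigma>. grad_measure u \<mu> \<sigma>)}"

definition bv_norm :: "(real^'d \<Rightarrow> real) \<Rightarrow> real" where
  "bv_norm u = (THE t. \<exists>\<mu> \<sigma>. grad_measure u \<mu> \<sigma> \<and>
                   t = (\<integral>x. \<bar>u x\<bar> \<partial>lebesgue) + measure \<mu> UNIV)"

definition bv_weak_conv :: "(nat \<Rightarrow> real^'d \<Rightarrow> real) \<Rightarrow> (real^'d \<Rightarrow> real) \<Rightarrow> bool" where
  "bv_weak_conv F f \<longleftrightarrow>
     (\<forall>L :: (real^'d \<Rightarrow> real) \<Rightarrow> real.
        (\<forall>u\<in>BV. \<forall>v\<in>BV. \<forall>a b. L (\<lambda>x. a * u x + b * v x) = a * L u + b * L v) \<and>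
        (\<exists>C. \<forall>u\<in>BV. \<bar>L u\<bar> \<le> C * bv_norm u)
        \<longrightarrow> (\<lambda>n. L (F n)) \<longlonglongrightarrow> L f)"

definition half_ball :: "real^'d \<Rightarrow> real^'d \<Rightarrow> real \<Rightarrow> (real^'d) set" where
  "half_ball x \<nu> \<rho> = {y \<in> ball x \<rho>. (y - x) \<bullet> \<nu> > 0}"

definition jump_set :: "(real^'d \<Rightarrow> real) \<Rightarrow> (real^'d) set" where
  "jump_set u = {x. \<exists>a b \<nu>. a \<noteq> b \<and> norm \<nu> = 1 \<and>
      ((\<lambda>\<rho>. (\<integral>y\<in>half_ball x \<nu> \<rho>. \<bar>u y - a\<bar> \<partial>lebesgue) / measure lebesgue (half_ball x \<nu> \<rho>))
         \<longlongrightarrow> 0) (at_right 0) \<and>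
      ((\<lambda>\<rho>. (\<integral>y\<in>half_ball x (-\<nu>) \<rho>. \<bar>u y - b\<bar> \<partial>lebesgue) / measure lebesgue (half_ball x (-\<nu>) \<rho>))
         \<longlongrightarrow> 0) (at_right 0)}"

text \<open>S carries the singular part of mu = |Du| w.r.t. Lebesgue measure:
  S is Lebesgue-null and mu restricted to the complement of S is absolutely continuous.
  Then |D^s u| = mu restricted to S.\<close>

definition singular_carrier :: "(real^'d) measure \<Rightarrow> (real^'d) set \<Rightarrow> bool" where
  "singular_carrier \<mu> S \<longleftrightarrow> S \<in> sets borel \<and> emeasure lborel S = 0 \<and>
     (\<forall>A\<in>sets borel. emeasure lborel A = 0 \<longrightarrow> emeasure \<mu> (A - S) = 0)"

text \<open>||D^j u|| = total variation of (D^s u) restricted to J_u = |D^s u|(J_u).\<close>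

definition jump_variation :: "(real^'d \<Rightarrow> real) \<Rightarrow> ennreal" where
  "jump_variation u = (THE t. \<exists>\<mu> \<sigma> S. grad_measure u \<mu> \<sigma> \<and> singular_carrier \<mu> S \<and>
                          t = emeasure \<mu> (jump_set u \<inter> S))"

end

theory Submission
  imports Defs
begin

text \<open>
  Let \<open>g n = f - F n\<close>, with gradient \<open>D (g n) = \<sigma> n \<mu> n\<close>, tend weakly to 0.  Testing with the functionals
  \<open>u \<mapsto> \<integral> \<Psi> dDu\<close> for bounded Borel fields \<open>\<Psi>\<close>, a gliding hump argument shows that the measures \<open>\<mu> n\<close> are bounded and
  uniformly absolutely continuous with respect to one finite measure \<open>\<nu>\<close>; boundedness and weak convergence give \<open>g n \<rightarrow> 0\<close>
  in \<open>L\<^sup>1\<close> on bounded sets.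

  At a jump point the mass of \<open>\<mu> n\<close> in balls of radius \<open>r\<close> is at least of order \<open>r\<^bsup>d-1\<^esup>\<close>. Hence the union of all jump sets is,
  up to small \<open>\<nu>\<close>-measure, a compact set \<open>E\<close> whose \<open>r\<close>-neighbourhoods have volume \<open>O(r)\<close>, so that almost every line in a
  coordinate direction \<open>e\<close> meets \<open>E\<close> in finitely many points. The component \<open>D\<^sub>e (g n)\<close> does not charge the exceptional lines,
  and off them \<open>E\<close> is exhausted by compact sets \<open>K\<close> whose points on each line in direction \<open>e\<close> are at distance more than \<open>h\<close>.
  For such \<open>K\<close> the trace inequality
  \<open>|D\<^sub>e u|(K) \<le> (2/h) \<integral> |u| + |D\<^sub>e u|((K + [-h, h] e) - K)\<close>
  holds; its right hand side for \<open>u = g n\<close> is small uniformly in \<open>n\<close>, because \<open>(K + [-h, h] e) - K\<close> shrinks to the empty set.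
\<close>

section \<open>Test functions and functionals on bounded Borel functions\<close>

text \<open>The order of the choices shapes the proof. The factor \<open>2/h\<close> of the trace
  inequality grows as \<open>h\<close> shrinks, so \<open>E\<close>, \<open>K\<close> and
  \<open>h\<close> have to be fixed before \<open>n\<close> tends to infinity, and whatever is
  discarded on the way must be small for all \<open>n\<close> at once. This is why all jump sets are
  treated together and why one measure \<nu> controls every \<open>\<mu> n\<close>. The uniformity
  comes from weak convergence in the Banach space: it may be tested with arbitrary bounded Borel
  fields, even with fields glued together from the \<open>\<sigma> n\<close>, whereas weak-star
  convergence sees continuous fields only.

  Single directions appear because a Lebesgue null union of lines parallel to \<open>e\<close> is
  null for the derivative along \<open>e\<close>, not necessarily for the others; |Du| is recovered
  at the end from the coordinate directions.

  Integration by parts is given for C^1 test functions but used with signs and with indicators of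
  balls and of swept compact sets. Both sides of such identities are continuous along bounded
  pointwise limits, so a monotone class argument carries them over to all bounded Borel
  functions.\<close>

definition Cc1 :: "('a::euclidean_space \<Rightarrow> real) \<Rightarrow> bool" where
  "Cc1 f \<longleftrightarrow> (\<exists>D. (\<forall>x. (f has_derivative D x) (at x)) \<and> (\<forall>v. continuous_on UNIV (\<lambda>x. D x v)))
     \<and> (\<exists>R. \<forall>x. R < norm x \<longrightarrow> f x = 0)"

lemma Cc1_continuous: "Cc1 f \<Longrightarrow> continuous_on S f"
  unfolding Cc1_def
  by (meson continuous_at_imp_continuous_on has_derivative_continuous)

lemma Cc1_borel: "Cc1 f \<Longrightarrow> f \<in> borel_measurable borel"
  by (simp add: Cc1_continuous borel_measurable_continuous_onI)

lemma Cc1_bounded: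
  assumes "Cc1 f" shows "\<exists>B. \<forall>x. \<bar>f x\<bar> \<le> B"
proof -
  obtain R where R: "\<And>x. R < norm x \<Longrightarrow> f x = 0" using assms by (auto simp: Cc1_def)
  have "compact (f ` cball 0 R)"
    by (intro compact_continuous_image Cc1_continuous[OF assms] compact_cball)
  then obtain B where B: "\<And>y. y \<in> f ` cball 0 R \<Longrightarrow> \<bar>y\<bar> \<le> B"
    by (metis bounded_iff compact_imp_bounded real_norm_def)
  have "\<bar>f x\<bar> \<le> max B 0" for x
    using B[of "f x"] R[of x] by (cases "R < norm x") (auto intro: max.coboundedI1)
  then show ?thesis by blast
qed

lemma Cc1_mult:
  fixes f g :: "'a::euclidean_space \<Rightarrow> real"
  assumes "Cc1 f" "Cc1 g" shows "Cc1 (\<lambda>x. f x * g x)"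
proof -
  obtain D where D: "\<And>x. (f has_derivative D x) (at x)" "\<And>v. continuous_on UNIV (\<lambda>x. D x v)"
    using assms(1) by (auto simp: Cc1_def)
  obtain E where E: "\<And>x. (g has_derivative E x) (at x)" "\<And>v. continuous_on UNIV (\<lambda>x. E x v)"
    using assms(2) by (auto simp: Cc1_def)
  obtain R where R: "\<And>x. R < norm x \<Longrightarrow> f x = 0" using assms by (auto simp: Cc1_def)
  show ?thesis unfolding Cc1_def
  proof (intro conjI exI allI impI)
    fix x show "((\<lambda>x. f x * g x) has_derivative (\<lambda>v. f x * E x v + D x v * g x)) (at x)"
      by (intro has_derivative_mult D E)
  next
    fix v show "continuous_on UNIV (\<lambda>x. f x * E x v + D x v * g x)"
      by (intro continuous_intros D E Cc1_continuous assms)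
  next
    fix x :: 'a assume "R < norm x" then show "f x * g x = 0" using R by simp
  qed
qed

lemma Cc1_translate:
  fixes f :: "'a::euclidean_space \<Rightarrow> real"
  assumes "Cc1 f" shows "Cc1 (\<lambda>x. f (x + w))"
proof -
  obtain D where D: "\<And>x. (f has_derivative D x) (at x)" "\<And>v. continuous_on UNIV (\<lambda>x. D x v)"
    using assms(1) by (auto simp: Cc1_def)
  obtain R where R: "\<And>x. R < norm x \<Longrightarrow> f x = 0" using assms by (auto simp: Cc1_def)
  show ?thesis unfolding Cc1_def
  proof (intro conjI exI allI impI)
    fix x show "((\<lambda>x. f (x + w)) has_derivative D (x + w)) (at x)"
      by (rule has_derivative_compose[of "\<lambda>x. x + w" "\<lambda>x. x" x UNIV f "D (x + w)"])
        (auto intro!: derivative_eq_intros D)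
  next
    fix v show "continuous_on UNIV (\<lambda>x. D (x + w) v)"
      by (rule continuous_on_compose2[OF D(2)[of v]]) (auto intro!: continuous_intros)
  next
    fix x :: 'a assume "R + norm w < norm x"
    then have "R < norm (x + w)" by (smt (verit) norm_diff_ineq)
    then show "f (x + w) = 0" using R by simp
  qed
qed

text \<open>The open set \<open>S\<close> is there because the outer function needed next,
  \<open>k * t / (1 + k * t)\<close>, is smooth only away from its pole.\<close>

lemma Cc1_compose:
  fixes f :: "'a::euclidean_space \<Rightarrow> real" and h h' :: "real \<Rightarrow> real"
  assumes "Cc1 f" "\<And>x. f x \<in> S" "open S" "\<And>t. t \<in> S \<Longrightarrow> (h has_real_derivative h' t) (at t)"
    "continuous_on S h'" "h 0 = 0"
  shows "Cc1 (\<lambda>x. h (f x))"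
proof -
  obtain D where D: "\<And>x. (f has_derivative D x) (at x)" "\<And>v. continuous_on UNIV (\<lambda>x. D x v)"
    using assms(1) by (auto simp: Cc1_def)
  obtain R where R: "\<And>x. R < norm x \<Longrightarrow> f x = 0" using assms by (auto simp: Cc1_def)
  show ?thesis unfolding Cc1_def
  proof (intro conjI exI allI impI)
    fix x 
    have "(h has_derivative (*) (h' (f x))) (at (f x))" using assms(4)[OF assms(2)] has_field_derivative_def by metis
    from has_derivative_compose[OF D(1) this] 
    show "((\<lambda>x. h (f x)) has_derivative (\<lambda>v. h' (f x) * D x v)) (at x)" .
  next
    fix v show "continuous_on UNIV (\<lambda>x. h' (f x) * D x v)"
      by (intro continuous_intros D continuous_on_compose2[OF assms(5)] Cc1_continuous assms(1)) (use assms in auto)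
  next
    fix x :: 'a assume "R < norm x" then show "h (f x) = 0" using R assms by simp
  qed
qed

text \<open>As \<open>k\<close> grows these functions increase to the indicator of the set where
  \<open>f\<close> is positive. In this way indicators of open sets become bounded limits of test
  functions.\<close>

lemma Cc1_saturate:
  assumes "Cc1 f" "\<And>x. 0 \<le> f x" "0 \<le> k"
  shows "Cc1 (\<lambda>x. k * f x / (1 + k * f x))"
proof (rule Cc1_compose[where h = "\<lambda>t. k * t / (1 + k * t)" and S = "{t. 0 < 1 + k * t}" and
      h' = "\<lambda>t. k / (1 + k * t)^2"])
  fix t assume t: "t \<in> {t. 0 < 1 + k * t}"
  show "((\<lambda>t. k * t / (1 + k * t)) has_real_derivative k / (1 + k * t)^2) (at t)"
    using t by (auto intro!: derivative_eq_intros simp: field_simps power2_eq_square)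
next
  show "open {t. 0 < 1 + k * t}" by (intro open_Collect_less continuous_intros)
  show "continuous_on {t. 0 < 1 + k * t} (\<lambda>t. k / (1 + k * t)^2)"
    by (intro continuous_intros) auto
  fix x show "f x \<in> {t. 0 < 1 + k * t}" using assms
    by (smt (verit) mem_Collect_eq mult_nonneg_nonneg)
qed (use assms in auto)

lemma has_real_derivative_max0_square:
  "((\<lambda>t::real. (max 0 t)^2) has_real_derivative 2 * max 0 t) (at t)"
proof -
  consider "t < 0" | "t > 0" | "t = 0" by linarith
  then show ?thesis
  proof cases
    case 1
    have "((\<lambda>t::real. 0) has_real_derivative 0) (at t)" by simp
    then have "((\<lambda>t::real. (max 0 t)^2) has_real_derivative 0) (at t)"
      by (rule has_field_derivative_transform_within_open[where S = "{..<0}"]) (use 1 in auto)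
    then show ?thesis using 1 by simp
  next
    case 2
    have "((\<lambda>t::real. t^2) has_real_derivative 2 * t) (at t)" by (auto intro!: derivative_eq_intros)
    then have "((\<lambda>t::real. (max 0 t)^2) has_real_derivative 2 * t) (at t)"
      by (rule has_field_derivative_transform_within_open[where S = "{0<..}"]) (use 2 in auto)
    then show ?thesis using 2 by simp
  next
    case 3
    have "((\<lambda>y. (max 0 y)\<^sup>2 / y) \<longlongrightarrow> 0) (at (0::real))"
    proof (rule tendsto_0_le)
      show "((\<lambda>y::real. y) \<longlongrightarrow> 0) (at 0)" by simp
      show "\<forall>\<^sub>F x in at (0::real). norm ((max 0 x)\<^sup>2 / x) \<le> norm x * 1"
        by (rule always_eventually) (auto simp: max_def power2_eq_square)
    qed
    then show ?thesis using 3 by (simp add: has_field_derivative_iff)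
  qed
qed

text \<open>Squaring the positive part removes its corner on the sphere, so this is a C^1 function
  that is positive exactly on the ball.\<close>

lemma Cc1_ball: "Cc1 (\<lambda>x::'a::euclidean_space. (max 0 (r^2 - norm (x - c)^2))^2)"
  unfolding Cc1_def
proof (intro conjI exI allI impI)
  fix x :: 'a
  have 1: "((\<lambda>x. r^2 - (x - c) \<bullet> (x - c)) has_derivative (\<lambda>v. - 2 * ((x - c) \<bullet> v))) (at x)"
    by (auto intro!: derivative_eq_intros simp: inner_commute)
  have 2: "((\<lambda>t::real. (max 0 t)^2) has_derivative (*) (2 * max 0 t)) (at t)" for t
    using has_real_derivative_max0_square has_field_derivative_def by metis
  show "((\<lambda>x. (max 0 (r^2 - norm (x - c)^2))^2) has_derivative
      (\<lambda>v. 2 * max 0 (r^2 - (x - c) \<bullet> (x - c)) * (- 2 * ((x - c) \<bullet> v)))) (at x)"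
    using has_derivative_compose[OF 1 2] by (simp add: power2_norm_eq_inner)
next
  fix v :: 'a
  show "continuous_on UNIV (\<lambda>x. 2 * max 0 (r^2 - (x - c) \<bullet> (x - c)) * (- 2 * ((x - c) \<bullet> v)))"
    by (intro continuous_intros)
next
  fix x :: 'a assume "\<bar>r\<bar> + norm c < norm x"
  then have "\<bar>r\<bar> \<le> norm (x - c)" by (smt (verit) norm_triangle_ineq2)
  then have "r\<^sup>2 \<le> norm (x - c)^2" by (metis abs_norm_cancel abs_le_square_iff)
  then show "(max 0 (r^2 - norm (x - c)^2))^2 = 0" by simp
qed

section \<open>Bounded Borel functions\<close>

definition bounded_borel :: "('a::topological_space \<Rightarrow> 'b::real_normed_vector) \<Rightarrow> bool" where
  "bounded_borel \<phi> \<longleftrightarrow> \<phi> \<in> borel_measurable borel \<and> (\<exists>B. \<forall>x. norm (\<phi> x) \<le> B)"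

lemma bounded_borelI: "\<phi> \<in> borel_measurable borel \<Longrightarrow> (\<And>x. norm (\<phi> x) \<le> B) \<Longrightarrow> bounded_borel \<phi>"
  by (auto simp: bounded_borel_def)

lemma bounded_borel_bound:
  assumes "bounded_borel \<phi>" shows "\<exists>B\<ge>0. \<forall>x. norm (\<phi> x) \<le> B"
proof -
  obtain B where B: "\<And>x. norm (\<phi> x) \<le> B" using assms by (auto simp: bounded_borel_def)
  have "0 \<le> B" using B[of undefined] norm_ge_zero order_trans by blast
  with B show ?thesis by blast
qed

lemma bounded_borel_measurable: "bounded_borel \<phi> \<Longrightarrow> \<phi> \<in> borel_measurable borel"
  by (simp add: bounded_borel_def)

lemma bounded_borel_Cc1: "Cc1 f \<Longrightarrow> bounded_borel f"
  using Cc1_bounded[of f] Cc1_borel[of f] by (auto simp: bounded_borel_def)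

lemma bounded_borel_add:
  fixes \<phi> \<psi> :: "'a::topological_space \<Rightarrow> 'b::euclidean_space"
  assumes "bounded_borel \<phi>" "bounded_borel \<psi>" shows "bounded_borel (\<lambda>x. \<phi> x + \<psi> x)"
proof -
  obtain B where B: "\<phi> \<in> borel_measurable borel" "0 \<le> B" "\<And>x. norm (\<phi> x) \<le> B"
    using bounded_borel_bound[OF assms(1)] bounded_borel_measurable[OF assms(1)] by blast
  obtain C where C: "\<psi> \<in> borel_measurable borel" "0 \<le> C" "\<And>x. norm (\<psi> x) \<le> C"
    using bounded_borel_bound[OF assms(2)] bounded_borel_measurable[OF assms(2)] by blast
  show ?thesis
    by (rule bounded_borelI[of _ "B + C"]) (use B C in \<open>auto intro: norm_triangle_le add_mono\<close>)
qed

lemma bounded_borel_scaleR: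
  fixes \<phi> :: "'a::topological_space \<Rightarrow> real" and \<psi> :: "'a::topological_space \<Rightarrow> 'b::euclidean_space"
  assumes "bounded_borel \<phi>" "bounded_borel \<psi>" shows "bounded_borel (\<lambda>x. \<phi> x *\<^sub>R \<psi> x)"
proof -
  obtain B where B: "\<phi> \<in> borel_measurable borel" "0 \<le> B" "\<And>x. norm (\<phi> x) \<le> B"
    using bounded_borel_bound[OF assms(1)] bounded_borel_measurable[OF assms(1)] by blast
  obtain C where C: "\<psi> \<in> borel_measurable borel" "0 \<le> C" "\<And>x. norm (\<psi> x) \<le> C"
    using bounded_borel_bound[OF assms(2)] bounded_borel_measurable[OF assms(2)] by blast
  show ?thesis
    by (rule bounded_borelI[of _ "B * C"]) (use B C in \<open>auto intro!: mult_mono\<close>)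
qed

lemma bounded_borel_mult:
  fixes \<phi> :: "'a::topological_space \<Rightarrow> real" 
  assumes "bounded_borel \<phi>" "bounded_borel \<psi>" shows "bounded_borel (\<lambda>x. \<phi> x * \<psi> x)"
  using bounded_borel_scaleR[OF assms] by simp

lemma bounded_borel_const: "bounded_borel (\<lambda>x. c)"
  by (rule bounded_borelI[of _ "norm c"]) auto

lemma bounded_borel_indicator: "A \<in> sets borel \<Longrightarrow> bounded_borel (indicator A :: 'a::topological_space \<Rightarrow> real)"
  by (rule bounded_borelI[of _ 1]) (auto simp: indicator_def)

text \<open>Integration against a finite signed measure, reduced to the two properties that are
  used: linearity, and continuity along pointwise limits with a common bound. Such functionals can
  be subtracted freely, so vector measures are compared without signed measures.\<close>

definition sigma_functional :: "(('a::topological_space \<Rightarrow> real) \<Rightarrow> real) \<Rightarrow> bool" where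
  "sigma_functional T \<longleftrightarrow>
     (\<forall>\<phi> \<psi>. bounded_borel \<phi> \<longrightarrow> bounded_borel \<psi> \<longrightarrow> T (\<lambda>x. \<phi> x + \<psi> x) = T \<phi> + T \<psi>) \<and>
     (\<forall>c \<phi>. bounded_borel \<phi> \<longrightarrow> T (\<lambda>x. c * \<phi> x) = c * T \<phi>) \<and>
     (\<forall>\<Phi> \<phi> B. (\<forall>k. \<Phi> k \<in> borel_measurable borel) \<longrightarrow> (\<forall>k x. \<bar>\<Phi> k x\<bar> \<le> B) \<longrightarrow>
        (\<forall>x. (\<lambda>k. \<Phi> k x) \<longlonglongrightarrow> \<phi> x) \<longrightarrow> (\<lambda>k. T (\<Phi> k)) \<longlonglongrightarrow> T \<phi>)"

lemma sigma_functional_add: "sigma_functional T \<Longrightarrow> bounded_borel \<phi> \<Longrightarrow> bounded_borel \<psi> \<Longrightarrow>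
    T (\<lambda>x. \<phi> x + \<psi> x) = T \<phi> + T \<psi>"
  by (simp add: sigma_functional_def)

lemma sigma_functional_scale: "sigma_functional T \<Longrightarrow> bounded_borel \<phi> \<Longrightarrow> T (\<lambda>x. c * \<phi> x) = c * T \<phi>"
  by (simp add: sigma_functional_def)

lemma sigma_functional_lim: "sigma_functional T \<Longrightarrow> (\<And>k. \<Phi> k \<in> borel_measurable borel) \<Longrightarrow>
   (\<And>k x. \<bar>\<Phi> k x\<bar> \<le> B) \<Longrightarrow> (\<And>x. (\<lambda>k. \<Phi> k x) \<longlonglongrightarrow> \<phi> x) \<Longrightarrow> (\<lambda>k. T (\<Phi> k)) \<longlonglongrightarrow> T \<phi>"
  unfolding sigma_functional_def by blast

text \<open>The point map \<open>p\<close> covers translated arguments, and arguments that depend on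
  a second integration variable.\<close>

lemma sigma_functional_integral:
  fixes p :: "'z \<Rightarrow> 'a::topological_space" and w :: "'z \<Rightarrow> real"
  assumes p: "p \<in> M \<rightarrow>\<^sub>M borel" and w: "integrable M w"
  shows "sigma_functional (\<lambda>\<phi>. \<integral>z. \<phi> (p z) * w z \<partial>M :: real)"
proof -
  have int: "integrable M (\<lambda>z. \<phi> (p z) * w z)" if b: "bounded_borel \<phi>" for \<phi>
  proof -
    obtain B where B: "\<phi> \<in> borel_measurable borel" "0 \<le> B" "\<And>x. norm (\<phi> x) \<le> B"
      using bounded_borel_bound[OF b] bounded_borel_measurable[OF b] by blast
    show ?thesis
      by (rule Bochner_Integration.integrable_bound[where f = "\<lambda>z. B * w z"])
        (use B p w in \<open>auto simp: abs_mult intro!: mult_right_mono\<close>)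
  qed
  show ?thesis unfolding sigma_functional_def
  proof (intro conjI allI impI)
    fix \<phi> \<psi> :: "'a \<Rightarrow> real" assume "bounded_borel \<phi>" "bounded_borel \<psi>"
    then show "(\<integral>z. (\<phi> (p z) + \<psi> (p z)) * w z \<partial>M) = (\<integral>z. \<phi> (p z) * w z \<partial>M) + (\<integral>z. \<psi> (p z) * w z \<partial>M)"
      using int by (simp add: distrib_right)
  next
    fix \<Phi> :: "nat \<Rightarrow> 'a \<Rightarrow> real" and \<phi> B assume m: "\<forall>k. \<Phi> k \<in> borel_measurable borel" and B: "\<forall>k x. \<bar>\<Phi> k x :: real\<bar> \<le> B"
      and l: "\<forall>x. (\<lambda>k. \<Phi> k x) \<longlonglongrightarrow> \<phi> x"
    have m': "\<phi> \<in> borel_measurable borel"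
      by (rule borel_measurable_LIMSEQ_metric[where f = \<Phi>]) (use m l in auto)
    have mp: "(\<lambda>z. \<Phi> k (p z)) \<in> borel_measurable M" "(\<lambda>z. \<phi> (p z)) \<in> borel_measurable M" for k
      using m m' p by (auto intro: measurable_compose[OF p])
    show "(\<lambda>k. \<integral>z. \<Phi> k (p z) * w z \<partial>M) \<longlonglongrightarrow> (\<integral>z. \<phi> (p z) * w z \<partial>M)"
    proof (rule integral_dominated_convergence[where w = "\<lambda>z. B * \<bar>w z\<bar>"])
      show "AE x in M. (\<lambda>i. \<Phi> i (p x) * w x) \<longlonglongrightarrow> \<phi> (p x) * w x"
        using l by (auto intro!: tendsto_intros)
    qed (use mp B w in \<open>auto simp: abs_mult intro!: mult_right_mono\<close>)
  qed (simp add: mult.assoc)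
qed

lemma sigma_functional_diff:
  assumes "sigma_functional S" "sigma_functional T" shows "sigma_functional (\<lambda>\<phi>. S \<phi> - T \<phi>)"
  unfolding sigma_functional_def
  by (auto simp: sigma_functional_add[OF assms(1)] sigma_functional_add[OF assms(2)] algebra_simps
      sigma_functional_scale[OF assms(1)] sigma_functional_scale[OF assms(2)]
      intro!: tendsto_diff sigma_functional_lim[OF assms(1)] sigma_functional_lim[OF assms(2)])

lemma sigma_functional_plus:
  assumes "sigma_functional S" "sigma_functional T" shows "sigma_functional (\<lambda>\<phi>. S \<phi> + T \<phi>)"
  unfolding sigma_functional_def
  by (auto simp: sigma_functional_add[OF assms(1)] sigma_functional_add[OF assms(2)] algebra_simps
      sigma_functional_scale[OF assms(1)] sigma_functional_scale[OF assms(2)]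
      intro!: tendsto_add sigma_functional_lim[OF assms(1)] sigma_functional_lim[OF assms(2)])

lemma sigma_functional_cmult:
  assumes "sigma_functional T" shows "sigma_functional (\<lambda>\<phi>. c * T \<phi>)"
  unfolding sigma_functional_def
  by (auto simp: sigma_functional_add[OF assms] sigma_functional_scale[OF assms] algebra_simps
      intro!: tendsto_mult sigma_functional_lim[OF assms])

lemma ball_eq_Cc1:
  fixes c :: "'a::euclidean_space"
  assumes "0 < r" shows "ball c r = {x. 0 < (max 0 (r^2 - norm (x - c)^2))^2}"
proof -
  have "norm (c - x) < r \<longleftrightarrow> 0 < max 0 (r\<^sup>2 - (norm (x - c))\<^sup>2)" for x
    using assms by (auto simp: norm_minus_commute less_max_iff_disj 
        power_strict_mono intro: power2_less_imp_less)
  then show ?thesis by (auto simp: dist_norm)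
qed

text \<open>Balls are positivity sets of test functions, and by Lindelof every open set is a
  countable union of balls.\<close>

lemma sets_borel_eq_Cc1:
  "sets (borel :: 'a::euclidean_space measure) = sigma_sets UNIV {{x. 0 < f x} | f. Cc1 f \<and> (\<forall>x. 0 \<le> f x)}"
  (is "_ = sigma_sets UNIV ?G")
proof
  have "open U \<Longrightarrow> U \<in> sigma_sets UNIV ?G" for U
  proof -
    assume U: "open U"
    define B where "B = {ball x r | x r. ball x r \<subseteq> U \<and> 0 < r}"
    have UB: "\<Union>B = U"
      using U by (auto simp: B_def open_contains_ball) (metis centre_in_ball)
    obtain B' where B': "B' \<subseteq> B" "countable B'" "\<Union>B' = \<Union>B"
      by (rule Lindelof[of B]) (auto simp: B_def)
    have ball: "ball c r \<in> ?G" if "0 < r" for c :: 'a and r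
    proof -
      note ball_eq_Cc1[OF that, of c]
      moreover have "\<forall>x. 0 \<le> (max 0 (r^2 - norm (x - c)^2))^2" by simp
      ultimately show ?thesis using Cc1_ball[of r c] by (intro CollectI exI conjI) assumption+
    qed
    have "\<Union>B' \<in> sigma_sets UNIV ?G"
      by (intro sigma_sets_UNION B'(2)) (use B'(1) ball in \<open>auto simp: B_def intro!: sigma_sets.Basic\<close>)
    then show "U \<in> sigma_sets UNIV ?G" using UB B' by simp
  qed
  then have "sigma_sets UNIV {S. open S} \<subseteq> sigma_sets UNIV ?G"
    by (intro sigma_sets_mono) auto
  then show "sets (borel :: 'a measure) \<subseteq> sigma_sets UNIV ?G"
    by (simp add: borel_def)
  have "{x. 0 < f x} \<in> sets borel" if "Cc1 f" for f :: "'a \<Rightarrow> real"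
    using borel_measurable_less[OF borel_measurable_const Cc1_borel[OF that]] by simp
  then have "?G \<subseteq> sets borel" by auto
  then show "sigma_sets UNIV ?G \<subseteq> sets borel"
    using sets.sigma_sets_subset[of ?G borel] by simp
qed

text \<open>Uniqueness of a finite signed measure with prescribed integrals of test functions. The
  positivity sets of nonnegative test functions are stable under intersection (multiply the
  functions), their indicators are limits of saturated test functions, and they generate the Borel
  sets; Dynkin's lemma reaches all Borel sets and simple functions all bounded Borel
  functions.\<close>

theorem sigma_functional_eq_0:
  fixes T :: "('a::euclidean_space \<Rightarrow> real) \<Rightarrow> real"
  assumes T: "sigma_functional T" and 0: "\<And>\<phi>. Cc1 \<phi> \<Longrightarrow> T \<phi> = 0" and \<phi>: "bounded_borel \<phi>"
  shows "T \<phi> = 0"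
proof -
  let ?G = "{{x::'a. 0 < f x} | f. Cc1 f \<and> (\<forall>x. 0 \<le> f x)}"
  have G0: "T (indicator A) = 0" if A: "A \<in> ?G" for A
  proof -
    obtain f where f: "A = {x. 0 < f x}" "Cc1 f" "\<And>x. 0 \<le> f x" using A by auto
    have "(\<lambda>k. T (\<lambda>x. real k * f x / (1 + real k * f x))) \<longlonglongrightarrow> T (indicator A)"
    proof (rule sigma_functional_lim[OF T, where B = 1])
      fix k show "(\<lambda>x. real k * f x / (1 + real k * f x)) \<in> borel_measurable borel"
        by (intro Cc1_borel Cc1_saturate f) auto
      fix x show "\<bar>real k * f x / (1 + real k * f x)\<bar> \<le> 1" using f(3)[of x]
        by (simp add: divide_le_eq_1) (smt (verit) mult_nonneg_nonneg of_nat_0_le_iff)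
    next
      fix x
      show "(\<lambda>k. real k * f x / (1 + real k * f x)) \<longlonglongrightarrow> indicator A x"
      proof (cases "f x = 0")
        case False
        then have fx: "0 < f x" using f(3)[of x] by simp
        have "(\<lambda>k. f x / (1 / real k + f x)) \<longlonglongrightarrow> f x / (0 + f x)"
          by (intro tendsto_intros lim_1_over_n) (use fx in auto)
        moreover have "eventually (\<lambda>k. f x / (1 / real k + f x) = real k * f x / (1 + real k * f x)) sequentially"
          using eventually_gt_at_top[of 0] by eventually_elim (use fx in \<open>auto simp: field_simps\<close>)
        ultimately show ?thesis using fx f(1) by (auto simp: tendsto_cong)
      qed (use f in auto)
    qed
    moreover have "T (\<lambda>x. real k * f x / (1 + real k * f x)) = 0" for k
      by (intro 0 Cc1_saturate f) auto
    ultimately show ?thesis by (simp add: LIMSEQ_const_iff)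
  qed
  \<comment> \<open>The whole space is not the positivity set of a compactly supported function, yet
    the complement step below needs its value; it is reached through growing balls.\<close>
  have "(\<lambda>k. T (indicator (ball 0 (real (Suc k))))) \<longlonglongrightarrow> T (indicator UNIV)"
  proof (rule sigma_functional_lim[OF T, where B = 1])
    fix x :: 'a
    have "eventually (\<lambda>k. indicator UNIV x = (indicator (ball 0 (real (Suc k))) x :: real)) sequentially"
      using eventually_gt_at_top[of "nat \<lceil>norm x\<rceil>"]
      by eventually_elim (auto simp: indicator_def, linarith)
    then show "(\<lambda>k. indicator (ball 0 (real (Suc k))) x :: real) \<longlonglongrightarrow> indicator UNIV x"
      by (rule tendsto_eventually[OF eventually_mono]) simp
  qed (auto intro!: borel_measurable_indicator simp: indicator_le_1)
  moreover have "T (indicator (ball 0 (real (Suc k)))) = 0" for k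
  proof (rule G0)
    have "\<forall>x::'a. 0 \<le> (max 0 ((real (Suc k))^2 - norm (x - 0)^2))^2" by simp
    then show "ball 0 (real (Suc k)) \<in> ?G"
      using Cc1_ball[of "real (Suc k)" "0::'a"] ball_eq_Cc1[of "real (Suc k)" "0::'a", OF of_nat_0_less_iff[THEN iffD2, OF zero_less_Suc]]
      by (intro CollectI exI conjI) assumption+
  qed
  ultimately have U0: "T (indicator UNIV) = 0" by (simp add: LIMSEQ_const_iff)
  have stable: "Int_stable ?G"
  proof (rule Int_stableI)
    fix a b assume "a \<in> ?G" "b \<in> ?G"
    then obtain f g where "a = {x. 0 < f x}" "Cc1 f" "\<And>x. 0 \<le> f x" "b = {x. 0 < g x}" "Cc1 g" "\<And>x. 0 \<le> g x"
      by blast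
    then have "a \<inter> b = {x. 0 < f x * g x}" "Cc1 (\<lambda>x. f x * g x)" "\<forall>x. 0 \<le> f x * g x"
      by (auto simp: zero_less_mult_iff Cc1_mult order.strict_iff_order)
    then show "a \<inter> b \<in> ?G" by (intro CollectI exI conjI) assumption+
  qed
  have set0: "T (indicator A) = 0" if "A \<in> sets borel" for A
    using stable subset_Pow_Union[of ?G, THEN order_trans, OF Pow_mono, OF subset_UNIV] that[unfolded sets_borel_eq_Cc1]
  proof (induction rule: sigma_sets_induct_disjoint)
    case (basic A) then show ?case by (rule G0)
  next
    case empty
    have "T (\<lambda>x. 0 * indicator UNIV x) = 0 * T (indicator UNIV)"
      by (intro sigma_functional_scale[OF T] bounded_borel_indicator) auto
    then show ?case by (simp add: indicator_def[abs_def])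
  next
    case (compl A)
    then have A: "A \<in> sets borel" by (simp add: sets_borel_eq_Cc1)
    have "T (\<lambda>x. indicator UNIV x + (-1) * indicator A x) = T (indicator UNIV) + T (\<lambda>x. (-1) * indicator A x)"
      using A by (intro sigma_functional_add[OF T] bounded_borel_mult bounded_borel_const bounded_borel_indicator) auto
    also have "T (\<lambda>x. (-1) * indicator A x) = (-1) * T (indicator A)"
      using A by (intro sigma_functional_scale[OF T] bounded_borel_indicator)
    finally have "T (\<lambda>x. indicator UNIV x + (-1) * indicator A x) = T (indicator UNIV) + (-1) * T (indicator A)" .
    moreover have "(\<lambda>x. indicator UNIV x + (-1) * indicator A x) = (indicator (UNIV - A) :: _ \<Rightarrow> real)"
      by (auto simp: indicator_def)
    ultimately show ?case using compl U0 by simp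
  next
    case (union A)
    then have A: "A i \<in> sets borel" for i by (auto simp: sets_borel_eq_Cc1)
    have fin: "T (indicator (\<Union>i<n. A i)) = 0" for n :: nat
    proof (induction n)
      case 0
      have "T (\<lambda>x. 0 * indicator UNIV x) = 0 * T (indicator UNIV)"
        by (intro sigma_functional_scale[OF T] bounded_borel_indicator) auto
      then show ?case by (simp add: indicator_def[abs_def])
    next
      case (Suc n)
      have "A n \<inter> (\<Union>i<n. A i) = {}"
        using union(1) by (auto simp: disjoint_family_on_def) (metis disjoint_iff less_irrefl)
      then have "(indicator (\<Union>i<Suc n. A i) :: _ \<Rightarrow> real) = (\<lambda>x. indicator (\<Union>i<n. A i) x + indicator (A n) x)"
        by (auto simp: indicator_def fun_eq_iff less_Suc_eq)
      then show ?case using Suc union(3)[of n] A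
        by (simp add: sigma_functional_add[OF T] bounded_borel_indicator)
    qed
    have "(\<lambda>k. T (indicator (\<Union>i<k. A i))) \<longlonglongrightarrow> T (indicator (\<Union>i. A i))"
      by (rule sigma_functional_lim[OF T, where B = 1]) (use A in \<open>auto simp: LIMSEQ_indicator_UN indicator_le_1\<close>)
    then show ?case using fin by (simp add: LIMSEQ_const_iff)
  qed
  obtain B where B: "\<phi> \<in> borel_measurable borel" "0 \<le> B" "\<And>x. norm (\<phi> x) \<le> B"
    using bounded_borel_bound[OF \<phi>] bounded_borel_measurable[OF \<phi>] by blast
  obtain s where s: "\<And>i. simple_function borel (s i)" "\<And>x. (\<lambda>i. s i x) \<longlonglongrightarrow> \<phi> x" "\<And>i x. norm (s i x) \<le> 2 * norm (\<phi> x)"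
    using borel_measurable_implies_sequence_metric[OF B(1), where z = 0] by auto
  have sm: "s i \<in> borel_measurable borel" for i using s(1) by (simp add: borel_measurable_simple_function)
  have sb: "\<bar>s i x\<bar> \<le> 2 * B" for i x using s(3)[of i x] B(3)[of x] by simp
  have "(\<lambda>k. T (s k)) \<longlonglongrightarrow> T \<phi>"
    by (rule sigma_functional_lim[OF T sm sb s(2)])
  moreover have "T (s k) = 0" for k
  proof -
    have fr: "finite (range (s k))" using s(1)[of k] by (simp add: simple_function_def)
    have "T (\<lambda>x. \<Sum>y\<in>Y. y * indicator (s k -` {y}) x) = 0 \<and> bounded_borel (\<lambda>x. \<Sum>y\<in>Y. y * indicator (s k -` {y}) x)" 
      if "finite Y" for Y
      using that
    proof induction
      case empty
      have "T (\<lambda>x. 0 * indicator UNIV x) = 0 * T (indicator UNIV)"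
        by (intro sigma_functional_scale[OF T] bounded_borel_indicator) auto
      then show ?case by (simp add: bounded_borel_const)
    next
      case (insert y Y)
      have "s k -` {y} \<in> sets borel" using sm[of k] by (auto simp: measurable_sets_borel)
      then have 1: "bounded_borel (\<lambda>x. y * indicator (s k -` {y}) x)" "T (\<lambda>x. y * indicator (s k -` {y}) x) = 0"
        using set0[of "s k -` {y}"] sigma_functional_scale[OF T bounded_borel_indicator, of "s k -` {y}" y]
        by (auto intro!: bounded_borel_mult bounded_borel_const bounded_borel_indicator)
      have 2: "bounded_borel (\<lambda>x. \<Sum>y\<in>Y. y * indicator (s k -` {y}) x)"
        "T (\<lambda>x. \<Sum>y\<in>Y. y * indicator (s k -` {y}) x) = 0" using insert by blast+
      show ?case
        unfolding sum.insert[OF insert(1,2)] sigma_functional_add[OF T 1(1) 2(1)] 1(2) 2(2)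
        by (intro conjI bounded_borel_add 1 2) simp
    qed
    from this[OF fr] have "T (\<lambda>x. \<Sum>y\<in>range (s k). y * indicator (s k -` {y}) x) = 0" ..
    moreover have "(\<lambda>x. \<Sum>y\<in>range (s k). y * indicator (s k -` {y}) x) = s k"
    proof
      fix x
      have "(\<Sum>y\<in>range (s k). y * indicator (s k -` {y}) x) = (\<Sum>y\<in>range (s k). if y = s k x then y else 0)"
        by (intro sum.cong) (auto simp: indicator_def)
      then show "(\<Sum>y\<in>range (s k). y * indicator (s k -` {y}) x) = s k x" using fr by simp
    qed
    ultimately show ?thesis by simp
  qed
  ultimately show ?thesis by (simp add: LIMSEQ_const_iff)
qed

section \<open>The gradient as a vector measure\<close>

lemma bounded_borel_compact_support:
  fixes f :: "'a::euclidean_space \<Rightarrow> 'b::real_normed_vector"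
  assumes "continuous_on UNIV f" "\<And>x. R < norm x \<Longrightarrow> f x = 0"
  shows "bounded_borel f"
proof -
  have "compact (f ` cball 0 R)"
    by (intro compact_continuous_image compact_cball continuous_on_subset[OF assms(1)]) auto
  then obtain B where B: "\<And>y. y \<in> f ` cball 0 R \<Longrightarrow> norm y \<le> B"
    by (metis bounded_iff compact_imp_bounded)
  have "norm (f x) \<le> max B 0" for x
    using B[of "f x"] assms(2)[of x] by (cases "R < norm x") (auto intro: max.coboundedI1)
  then show ?thesis
    by (intro bounded_borelI borel_measurable_continuous_onI assms)
qed

lemma has_derivative_zero_outside:
  assumes "(f has_derivative D) (at x)" "\<And>y. R < norm y \<Longrightarrow> f y = 0" "R < norm x"
  shows "D = (\<lambda>v. 0)"
proof -
  have "((\<lambda>y. 0) has_derivative D) (at x)"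
  proof (rule has_derivative_transform_within_open[OF assms(1)])
    show "open {y. R < norm y}" by (intro open_Collect_less continuous_intros)
  qed (use assms in auto)
  then show ?thesis by (metis has_derivative_const has_derivative_unique)
qed

lemma Cc1_has_derivative:
  "Cc1 f \<Longrightarrow> (f has_derivative frechet_derivative f (at x)) (at x)"
  unfolding Cc1_def using frechet_derivative_at by metis

lemma Cc1_continuous_derivative:
  "Cc1 f \<Longrightarrow> continuous_on UNIV (\<lambda>x. frechet_derivative f (at x) v)"
proof -
  assume "Cc1 f"
  then obtain D where D: "\<And>x. (f has_derivative D x) (at x)" "\<And>v. continuous_on UNIV (\<lambda>x. D x v)"
    by (auto simp: Cc1_def)
  show ?thesis using D(2)[of v] by (simp add: frechet_derivative_at[OF D(1), symmetric])
qed

lemma bounded_borel_Cc1_derivative: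
  assumes "Cc1 f" shows "bounded_borel (\<lambda>x. frechet_derivative f (at x) v)"
proof -
  obtain R where "\<And>x. R < norm x \<Longrightarrow> f x = 0" using assms by (auto simp: Cc1_def)
  then show ?thesis
    by (intro bounded_borel_compact_support[where R = R] Cc1_continuous_derivative assms)
      (metis has_derivative_zero_outside Cc1_has_derivative[OF assms])
qed

lemma frechet_derivative_translate:
  assumes "Cc1 f"
  shows "frechet_derivative (\<lambda>x. f (x + w)) (at x) = frechet_derivative f (at (x + w))"
proof -
  have "((\<lambda>x. f (x + w)) has_derivative frechet_derivative f (at (x + w))) (at x)"
    by (rule has_derivative_compose[of "\<lambda>x. x + w" "\<lambda>x. x" x UNIV f])
      (auto intro!: derivative_eq_intros Cc1_has_derivative assms)
  then show ?thesis by (simp add: frechet_derivative_at[symmetric])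
qed

text \<open>A scalar test function times a constant vector is a test field whose divergence is a
  directional derivative. This turns the definition of the gradient into integration by parts along
  one direction.\<close>

lemma
  fixes f :: "real^'d \<Rightarrow> real"
  assumes f: "Cc1 f"
  shows Cc1_field_scaleR: "Cc1_field (\<lambda>x. f x *\<^sub>R c)"
    and divergence_scaleR: "divergence (\<lambda>x. f x *\<^sub>R c) x = frechet_derivative f (at x) c"
proof -
  note D = Cc1_has_derivative[OF f]
  have E: "((\<lambda>x. f x *\<^sub>R c) has_derivative (\<lambda>v. frechet_derivative f (at x) v *\<^sub>R c)) (at x)" for x
    by (intro has_derivative_scaleR_left D)
  note F = frechet_derivative_at[OF E, symmetric]
  obtain R where R: "\<And>x. R < norm x \<Longrightarrow> f x = 0" using assms by (auto simp: Cc1_def)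
  have "{x. f x *\<^sub>R c \<noteq> 0} \<subseteq> cball 0 R"
    using R by (force simp: not_less[symmetric])
  then have "bounded {x. f x *\<^sub>R c \<noteq> 0}"
    by (metis bounded_cball bounded_subset)
  then have "compact (closure {x. f x *\<^sub>R c \<noteq> 0})" by simp
  moreover have "continuous_on UNIV (\<lambda>x. frechet_derivative (\<lambda>x. f x *\<^sub>R c) (at x) v)" for v
    unfolding F by (intro continuous_intros Cc1_continuous_derivative f)
  ultimately show "Cc1_field (\<lambda>x. f x *\<^sub>R c)"
    unfolding Cc1_field_def using E differentiable_def by blast
  interpret linear "frechet_derivative f (at x)"
    using D has_derivative_linear by blast
  have "divergence (\<lambda>x. f x *\<^sub>R c) x = (\<Sum>i\<in>UNIV. c $ i *\<^sub>R frechet_derivative f (at x) (axis i 1))"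
    unfolding divergence_def F by (simp add: mult.commute)
  also have "\<dots> = frechet_derivative f (at x) (\<Sum>i\<in>UNIV. c $ i *\<^sub>R axis i 1)"
    by (simp only: sum scaleR)
  also have "(\<Sum>i\<in>UNIV. c $ i *\<^sub>R axis i 1) = c"
    using basis_expansion[of c] by (simp add: scalar_mult_eq_scaleR)
  finally show "divergence (\<lambda>x. f x *\<^sub>R c) x = frechet_derivative f (at x) c" .
qed

lemma
  fixes \<phi> :: "real^'d \<Rightarrow> real^'d"
  assumes "Cc1_field \<phi>"
  shows bounded_borel_Cc1_field: "bounded_borel \<phi>"
    and bounded_borel_divergence: "bounded_borel (divergence \<phi>)"
proof -
  have D: "(\<phi> has_derivative frechet_derivative \<phi> (at x)) (at x)" for x :: "real^'d"
    using assms by (simp add: Cc1_field_def frechet_derivative_works)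
  have "bounded {x. \<phi> x \<noteq> 0}"
    using assms bounded_subset[OF compact_imp_bounded closure_subset] by (simp add: Cc1_field_def)
  then obtain R where R: "\<And>x. R < norm x \<Longrightarrow> \<phi> x = 0"
    by (auto simp: bounded_iff not_le[symmetric])
  show "bounded_borel \<phi>"
    by (rule bounded_borel_compact_support[OF _ R])
      (meson D continuous_at_imp_continuous_on has_derivative_continuous)
  show "bounded_borel (divergence \<phi>)"
  proof (rule bounded_borel_compact_support)
    show "continuous_on UNIV (divergence \<phi>)"
      unfolding divergence_def using assms by (auto simp: Cc1_field_def intro!: continuous_intros)
    fix x :: "real^'d" assume "R < norm x"
    then have "frechet_derivative \<phi> (at x) = (\<lambda>v. 0)"
      using has_derivative_zero_outside[OF D, of R x] R by blast
    then show "divergence \<phi> x = 0" by (simp add: divergence_def)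
  qed
qed

lemma integrable_mult_bounded_borel:
  fixes \<psi> :: "'a::euclidean_space \<Rightarrow> real"
  assumes "integrable lebesgue u" "bounded_borel \<psi>"
  shows "integrable lebesgue (\<lambda>x. u x * \<psi> x)"
proof -
  obtain B where B: "0 \<le> B" "\<And>x. norm (\<psi> x) \<le> B"
    using bounded_borel_bound[OF assms(2)] by blast
  have "\<psi> \<in> borel_measurable lebesgue"
    using bounded_borel_measurable[OF assms(2)] by (simp add: measurable_completion)
  have "norm (u x * \<psi> x) \<le> norm (B * u x)" for x
    using mult_right_mono[OF B(2)[of x], of "\<bar>u x\<bar>"] B(1) by (simp add: abs_mult mult.commute)
  note bound = this
  show ?thesis
  proof (rule Bochner_Integration.integrable_bound[where f = "\<lambda>x. B * u x"])
    show "integrable lebesgue (\<lambda>x. B * u x)" by (intro integrable_mult_right assms(1))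
    show "(\<lambda>x. u x * \<psi> x) \<in> borel_measurable lebesgue"
      by (intro borel_measurable_times borel_measurable_integrable[OF assms(1)]) fact
  qed (use bound in auto)
qed

lemma integrable_bounded_borel_fm:
  fixes \<psi> :: "'a::topological_space \<Rightarrow> 'b::{banach,second_countable_topology}"
  assumes "finite_measure M" "sets M = sets borel" "bounded_borel \<psi>"
  shows "integrable M \<psi>"
proof -
  interpret finite_measure M by fact
  obtain B where B: "\<And>x. norm (\<psi> x) \<le> B"
    using bounded_borel_bound[OF assms(3)] by blast
  have "\<psi> \<in> borel_measurable M"
    using bounded_borel_measurable[OF assms(3)] measurable_cong_sets[OF assms(2) refl] by blast
  then show ?thesis by (intro integrable_const_bound[where B = B]) (use B in auto)
qed

lemma bounded_borel_inner:
  fixes \<phi> \<psi> :: "'a::topological_space \<Rightarrow> 'b::euclidean_space"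
  assumes "bounded_borel \<phi>" "bounded_borel \<psi>" shows "bounded_borel (\<lambda>x. \<phi> x \<bullet> \<psi> x)"
proof -
  obtain B where B: "\<phi> \<in> borel_measurable borel" "0 \<le> B" "\<And>x. norm (\<phi> x) \<le> B"
    using bounded_borel_bound[OF assms(1)] bounded_borel_measurable[OF assms(1)] by blast
  obtain C where C: "\<psi> \<in> borel_measurable borel" "0 \<le> C" "\<And>x. norm (\<psi> x) \<le> C"
    using bounded_borel_bound[OF assms(2)] bounded_borel_measurable[OF assms(2)] by blast
  show ?thesis
  proof (rule bounded_borelI)
    show "norm (\<phi> x \<bullet> \<psi> x) \<le> B * C" for x
      using Cauchy_Schwarz_ineq2[of "\<phi> x" "\<psi> x"] mult_mono[OF B(3)[of x] C(3)[of x]] B by simp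
  qed (use B C in measurable)
qed

text \<open>The part of \<open>grad_measure\<close> that does not mention \<open>u\<close>: the pair
  stands for the vector measure with density \<sigma> with respect to \<mu>. Since |\<sigma>| = 1
  everywhere, \<mu> is its total variation.\<close>

definition polar :: "('a::euclidean_space) measure \<Rightarrow> ('a \<Rightarrow> 'a) \<Rightarrow> bool" where
  "polar \<mu> \<sigma> \<longleftrightarrow> sets \<mu> = sets borel \<and> finite_measure \<mu> \<and>
     \<sigma> \<in> borel_measurable borel \<and> (\<forall>x. norm (\<sigma> x) = 1)"

lemma grad_measure_polar: "grad_measure u \<mu> \<sigma> \<Longrightarrow> polar \<mu> \<sigma>"
  by (simp add: grad_measure_def polar_def)

lemma polarD:
  assumes "polar \<mu> \<sigma>"
  shows polar_sets: "sets \<mu> = sets borel" and polar_finite: "finite_measure \<mu>"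
    and polar_bounded_borel: "bounded_borel \<sigma>" and polar_norm: "norm (\<sigma> x) = 1"
    and polar_space: "space \<mu> = UNIV"
  using assms sets_eq_imp_space_eq[of \<mu> borel] by (auto simp: polar_def bounded_borel_def)

lemma polar_integrable:
  assumes "polar \<mu> \<sigma>" "bounded_borel \<Psi>"
  shows "integrable \<mu> (\<lambda>x. \<Psi> x \<bullet> \<sigma> x)"
  by (intro integrable_bounded_borel_fm bounded_borel_inner polarD[OF assms(1)] assms)

lemma grad_measure_Cc1:
  fixes u :: "real^'d \<Rightarrow> real"
  assumes "grad_measure u \<mu> \<sigma>" "Cc1 \<eta>"
  shows "(\<integral>x. u x * frechet_derivative \<eta> (at x) c \<partial>lebesgue) = - (\<integral>x. \<eta> x * (c \<bullet> \<sigma> x) \<partial>\<mu>)"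
  using assms(1) Cc1_field_scaleR[OF assms(2), of c] divergence_scaleR[OF assms(2), of c]
  by (auto simp: grad_measure_def)

lemma sigma_functional_polar:
  assumes "polar \<mu> \<sigma>" shows "sigma_functional (\<lambda>\<phi>. \<integral>x. \<phi> x * (c \<bullet> \<sigma> x) \<partial>\<mu>)"
proof (rule sigma_functional_integral)
  show "(\<lambda>x. x) \<in> \<mu> \<rightarrow>\<^sub>M borel" by (rule measurable_ident_sets[OF polar_sets[OF assms]])
  show "integrable \<mu> (\<lambda>x. c \<bullet> \<sigma> x)" by (intro polar_integrable[OF assms] bounded_borel_const)
qed

lemma polar_integral_components:
  fixes \<Psi> :: "'a::euclidean_space \<Rightarrow> 'a"
  assumes "polar \<mu> \<sigma>" "bounded_borel \<Psi>"
  shows "(\<integral>x. \<Psi> x \<bullet> \<sigma> x \<partial>\<mu>) = (\<Sum>i\<in>Basis. \<integral>x. (\<Psi> x \<bullet> i) * (i \<bullet> \<sigma> x) \<partial>\<mu>)"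
proof -
  have "(\<integral>x. \<Psi> x \<bullet> \<sigma> x \<partial>\<mu>) = (\<integral>x. (\<Sum>i\<in>Basis. (\<Psi> x \<bullet> i) * (i \<bullet> \<sigma> x)) \<partial>\<mu>)"
    by (intro Bochner_Integration.integral_cong) (auto simp: euclidean_inner[of "\<Psi> _"] inner_commute)
  also have "\<dots> = (\<Sum>i\<in>Basis. \<integral>x. (\<Psi> x \<bullet> i) * (i \<bullet> \<sigma> x) \<partial>\<mu>)"
    by (intro Bochner_Integration.integral_sum integrable_bounded_borel_fm bounded_borel_mult bounded_borel_inner
        bounded_borel_const polarD[OF assms(1)] assms)
  finally show ?thesis .
qed

text \<open>Polar decompositions do not add, but the action on fields does. For test functions this
  is linearity of the left side of the integration by parts; \<open>sigma_functional_eq_0\<close>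
  extends it to bounded Borel fields, one component at a time.\<close>

lemma grad_measure_linear:
  fixes u v :: "real^'d \<Rightarrow> real"
  assumes u: "grad_measure u \<mu> \<sigma>" "integrable lebesgue u"
    and v: "grad_measure v \<nu> \<tau>" "integrable lebesgue v"
    and w: "grad_measure (\<lambda>x. a * u x + b * v x) \<kappa> \<rho>" and \<Psi>: "bounded_borel \<Psi>"
  shows "(\<integral>x. \<Psi> x \<bullet> \<rho> x \<partial>\<kappa>) = a * (\<integral>x. \<Psi> x \<bullet> \<sigma> x \<partial>\<mu>) + b * (\<integral>x. \<Psi> x \<bullet> \<tau> x \<partial>\<nu>)"
proof -
  note p = grad_measure_polar[OF u(1)] grad_measure_polar[OF v(1)] grad_measure_polar[OF w]
  define T where "T c \<phi> = (\<integral>x. \<phi> x * (c \<bullet> \<rho> x) \<partial>\<kappa>) - 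
    (a * (\<integral>x. \<phi> x * (c \<bullet> \<sigma> x) \<partial>\<mu>) + b * (\<integral>x. \<phi> x * (c \<bullet> \<tau> x) \<partial>\<nu>))" for c and \<phi> :: "real^'d \<Rightarrow> real"
  have "T c \<phi> = 0" if "bounded_borel \<phi>" for c \<phi>
  proof (rule sigma_functional_eq_0[OF _ _ that])
    show "sigma_functional (T c)" unfolding T_def
      by (intro sigma_functional_diff sigma_functional_plus sigma_functional_cmult sigma_functional_polar p)
    fix \<phi> :: "real^'d \<Rightarrow> real" assume \<phi>: "Cc1 \<phi>"
    let ?D = "\<lambda>x. frechet_derivative \<phi> (at x) c"
    have "(\<integral>x. (a * u x + b * v x) * ?D x \<partial>lebesgue) = (\<integral>x. a * (u x * ?D x) + b * (v x * ?D x) \<partial>lebesgue)"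
      by (simp add: algebra_simps)
    also have "\<dots> = a * (\<integral>x. u x * ?D x \<partial>lebesgue) + b * (\<integral>x. v x * ?D x \<partial>lebesgue)"
      using integrable_mult_bounded_borel[OF u(2) bounded_borel_Cc1_derivative[OF \<phi>]]
        integrable_mult_bounded_borel[OF v(2) bounded_borel_Cc1_derivative[OF \<phi>]] by simp
    finally show "T c \<phi> = 0"
      unfolding T_def grad_measure_Cc1[OF u(1) \<phi>] grad_measure_Cc1[OF v(1) \<phi>] grad_measure_Cc1[OF w \<phi>] by simp
  qed
  then have eq: "(\<integral>x. \<phi> x * (c \<bullet> \<rho> x) \<partial>\<kappa>) = a * (\<integral>x. \<phi> x * (c \<bullet> \<sigma> x) \<partial>\<mu>) + b * (\<integral>x. \<phi> x * (c \<bullet> \<tau> x) \<partial>\<nu>)"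
    if "bounded_borel \<phi>" for c \<phi> using that by (simp add: T_def)
  have "bounded_borel (\<lambda>x. \<Psi> x \<bullet> i)" for i by (intro bounded_borel_inner \<Psi> bounded_borel_const)
  then show ?thesis
    unfolding polar_integral_components[OF p(1) \<Psi>] polar_integral_components[OF p(2) \<Psi>] polar_integral_components[OF p(3) \<Psi>]
    by (simp add: eq sum.distrib sum_distrib_left)
qed

text \<open>The supremum defining the total variation is attained at \<sigma> itself, because
  \<open>\<sigma> x \<bullet> \<sigma> x = 1\<close>.\<close>

lemma polar_measure_eq:
  assumes p: "polar \<mu> \<sigma>" and A: "A \<in> sets borel"
  shows "measure \<mu> A = (\<integral>x. (indicator A x *\<^sub>R \<sigma> x) \<bullet> \<sigma> x \<partial>\<mu>)"
proof -
  interpret finite_measure \<mu> using polarD[OF p] by simp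
  have "(indicator A x *\<^sub>R \<sigma> x) \<bullet> \<sigma> x = indicator A x" for x
    using polar_norm[OF p, of x] by (simp add: norm_eq_sqrt_inner)
  then have "(\<integral>x. (indicator A x *\<^sub>R \<sigma> x) \<bullet> \<sigma> x \<partial>\<mu>) = (\<integral>x. indicator A x \<partial>\<mu>)" by (simp only:)
  then show ?thesis using A polarD[OF p] by simp
qed

lemma polar_integral_le:
  assumes p: "polar \<mu> \<sigma>" and "bounded_borel \<Psi>" and A: "A \<in> sets borel"
    and "\<And>x. norm (\<Psi> x) \<le> B * indicator A x"
  shows "\<bar>\<integral>x. \<Psi> x \<bullet> \<sigma> x \<partial>\<mu>\<bar> \<le> B * measure \<mu> A"
proof -
  interpret finite_measure \<mu> using polarD[OF p] by simp
  have "\<bar>\<integral>x. \<Psi> x \<bullet> \<sigma> x \<partial>\<mu>\<bar> \<le> (\<integral>x. \<bar>\<Psi> x \<bullet> \<sigma> x\<bar> \<partial>\<mu>)" by (rule integral_abs_bound)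
  also have "\<dots> \<le> (\<integral>x. B * indicator A x \<partial>\<mu>)"
  proof (rule integral_mono)
    show "integrable \<mu> (\<lambda>x. \<bar>\<Psi> x \<bullet> \<sigma> x\<bar>)" using polar_integrable[OF assms(1,2)] by simp
    show "integrable \<mu> (\<lambda>x. B * indicator A x)" 
      by (intro integrable_mult_right integrable_bounded_borel_fm[OF polar_finite[OF p] polar_sets[OF p]] bounded_borel_indicator A)
    fix x show "\<bar>\<Psi> x \<bullet> \<sigma> x\<bar> \<le> B * indicator A x"
      using Cauchy_Schwarz_ineq2[of "\<Psi> x" "\<sigma> x"] assms(4)[of x] polar_norm[OF p, of x] by simp
  qed
  also have "\<dots> = B * measure \<mu> A" using A polarD[OF p] by simp
  finally show ?thesis .
qed

text \<open>The maximal field for one measure is an admissible field for the other, so each measure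
  is bounded by the other on every Borel set.\<close>

lemma polar_unique:
  assumes p: "polar \<mu> \<sigma>" and q: "polar \<nu> \<tau>"
    and eq: "\<And>\<Psi>. bounded_borel \<Psi> \<Longrightarrow> (\<integral>x. \<Psi> x \<bullet> \<sigma> x \<partial>\<mu>) = (\<integral>x. \<Psi> x \<bullet> \<tau> x \<partial>\<nu>)"
  shows "\<mu> = \<nu>"
proof -
  interpret M: finite_measure \<mu> using polarD[OF p] by simp
  interpret N: finite_measure \<nu> using polarD[OF q] by simp
  have le: "measure \<mu> A \<le> measure \<nu> A" if A: "A \<in> sets borel" and p: "polar \<mu> \<sigma>" and q: "polar \<nu> \<tau>"
    and eq: "\<And>\<Psi>. bounded_borel \<Psi> \<Longrightarrow> (\<integral>x. \<Psi> x \<bullet> \<sigma> x \<partial>\<mu>) = (\<integral>x. \<Psi> x \<bullet> \<tau> x \<partial>\<nu>)"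
    for A \<mu> \<sigma> \<nu> and \<tau> :: "'a \<Rightarrow> 'a"
  proof -
    have b: "bounded_borel (\<lambda>x. indicator A x *\<^sub>R \<sigma> x)"
      by (intro bounded_borel_scaleR bounded_borel_indicator A polarD[OF p])
    have "measure \<mu> A = (\<integral>x. (indicator A x *\<^sub>R \<sigma> x) \<bullet> \<tau> x \<partial>\<nu>)"
      unfolding polar_measure_eq[OF p A] by (rule eq[OF b])
    also have "\<dots> \<le> 1 * measure \<nu> A"
      using polar_integral_le[OF q b A, of 1] polar_norm[OF p] by (auto simp: abs_le_iff)
    finally show ?thesis by simp
  qed
  show ?thesis
  proof (rule measure_eqI)
    show "sets \<mu> = sets \<nu>" using polarD[OF p] polarD[OF q] by simp
    fix A assume "A \<in> sets \<mu>"
    then have A: "A \<in> sets borel" using polarD[OF p] by simp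
    have "measure \<mu> A = measure \<nu> A"
      using le[OF A p q eq] le[OF A q p eq[symmetric]] by simp
    then show "emeasure \<mu> A = emeasure \<nu> A"
      by (simp add: M.emeasure_eq_measure N.emeasure_eq_measure)
  qed
qed

text \<open>This makes the definite descriptions of the norm, of the jump variation and of
  \<open>field_functional\<close> meaningful. The field \<sigma> is determined only \<mu>-almost
  everywhere, hence the second claim compares integrals and not fields.\<close>

lemma grad_measure_unique:
  fixes u :: "real^'d \<Rightarrow> real"
  assumes "grad_measure u \<mu> \<sigma>" "grad_measure u \<nu> \<tau>" "integrable lebesgue u"
  shows "\<mu> = \<nu>"
    and "bounded_borel \<Psi> \<Longrightarrow> (\<integral>x. \<Psi> x \<bullet> \<sigma> x \<partial>\<mu>) = (\<integral>x. \<Psi> x \<bullet> \<tau> x \<partial>\<nu>)"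
proof -
  have eq: "(\<integral>x. \<Psi> x \<bullet> \<sigma> x \<partial>\<mu>) = (\<integral>x. \<Psi> x \<bullet> \<tau> x \<partial>\<nu>)" if "bounded_borel \<Psi>" for \<Psi>
    \<comment> \<open>Here \<open>u\<close> is read as \<open>1 * u + 0 * u\<close>.\<close>
    using grad_measure_linear[OF assms(2,3) assms(2,3), of 1 0 \<mu> \<sigma> \<Psi>] assms(1) that by simp
  then show "bounded_borel \<Psi> \<Longrightarrow> (\<integral>x. \<Psi> x \<bullet> \<sigma> x \<partial>\<mu>) = (\<integral>x. \<Psi> x \<bullet> \<tau> x \<partial>\<nu>)" .
  show "\<mu> = \<nu>"
    by (rule polar_unique[OF grad_measure_polar[OF assms(1)] grad_measure_polar[OF assms(2)] eq])
qed

lemma bv_norm_eq: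
  fixes u :: "real^'d \<Rightarrow> real"
  assumes "grad_measure u \<mu> \<sigma>" "integrable lebesgue u"
  shows "bv_norm u = (\<integral>x. \<bar>u x\<bar> \<partial>lebesgue) + measure \<mu> UNIV"
  unfolding bv_norm_def
proof (rule the_equality)
  show "\<exists>\<mu>' \<sigma>. grad_measure u \<mu>' \<sigma> \<and>
       (\<integral>x. \<bar>u x\<bar> \<partial>lebesgue) + measure \<mu> UNIV = (\<integral>x. \<bar>u x\<bar> \<partial>lebesgue) + measure \<mu>' UNIV"
    using assms by blast
qed (use grad_measure_unique(1)[OF _ assms] in blast)

text \<open>Serves as the common dominating measure, once of two gradients and once, with geometric
  weights, of a whole sequence.\<close>

definition sum_measure :: "(nat \<Rightarrow> 'a::topological_space measure) \<Rightarrow> 'a measure" where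
  "sum_measure \<mu> = measure_of UNIV (sets borel) (\<lambda>A. \<Sum>n. emeasure (\<mu> n) A)"

lemma sets_sum_measure [simp]: "sets (sum_measure \<mu>) = sets borel"
  unfolding sum_measure_def using sets.sigma_sets_eq[of borel] by simp

lemma emeasure_sum_measure:
  assumes s: "\<And>n. sets (\<mu> n) = sets borel" and A: "A \<in> sets borel"
  shows "emeasure (sum_measure \<mu>) A = (\<Sum>n. emeasure (\<mu> n) A)"
proof (rule emeasure_measure_of[OF sum_measure_def])
  show "countably_additive (sets (sum_measure \<mu>)) (\<lambda>A. \<Sum>n. emeasure (\<mu> n) A)"
  proof (rule countably_additiveI)
    fix A :: "nat \<Rightarrow> _" assume A: "range A \<subseteq> sets (sum_measure \<mu>)" "disjoint_family A"
    \<comment> \<open>The sums are exchanged by monotone convergence for the counting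
      measure.\<close>
    have "(\<Sum>i. \<Sum>n. emeasure (\<mu> n) (A i)) = (\<Sum>n. \<Sum>i. emeasure (\<mu> n) (A i))"
      using nn_integral_suminf[of "\<lambda>n i. emeasure (\<mu> n) (A i)" "count_space UNIV"]
      by (simp add: nn_integral_count_space_nat)
    also have "\<dots> = (\<Sum>n. emeasure (\<mu> n) (\<Union>i. A i))"
      by (intro suminf_cong suminf_emeasure) (use A s in auto)
    finally show "(\<Sum>i. \<Sum>n. emeasure (\<mu> n) (A i)) = (\<Sum>n. emeasure (\<mu> n) (\<Union>i. A i))" .
  qed
qed (use A in \<open>auto simp: positive_def\<close>)

section \<open>Linear structure and weak convergence\<close>

lemma polar_of_field:
  fixes w :: "'a::euclidean_space \<Rightarrow> 'a"
  assumes m: "finite_measure m" "sets m = sets borel" and w: "integrable m w"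
  shows "\<exists>\<kappa> \<rho>. polar \<kappa> \<rho> \<and> (\<forall>\<Psi>. bounded_borel \<Psi> \<longrightarrow> (\<integral>x. \<Psi> x \<bullet> \<rho> x \<partial>\<kappa>) = (\<integral>x. \<Psi> x \<bullet> w x \<partial>m))"
proof -
  \<comment> \<open>\<open>polar\<close> demands a unit vector at every point. Where
    \<open>w\<close> vanishes any one will do, since \<kappa> has no mass there.\<close>
  obtain e :: 'a where e: "norm e = 1" using vector_choose_size zero_le_one by metis
  define \<kappa> where "\<kappa> = density m (\<lambda>x. ennreal (norm (w x)))"
  define \<rho> where "\<rho> x = (if w x = 0 then e else w x /\<^sub>R norm (w x))" for x
  have wm: "w \<in> borel_measurable m" using w by simp
  then have wb: "w \<in> borel_measurable borel" using measurable_cong_sets[OF m(2) refl] by blast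
  have \<rho>b: "\<rho> \<in> borel_measurable borel" unfolding \<rho>_def using wb by measurable
  have \<rho>1: "norm (\<rho> x) = 1" for x by (simp add: \<rho>_def e)
  have sp: "space m = UNIV" using sets_eq_imp_space_eq[OF m(2)] by simp
  have "emeasure \<kappa> (space \<kappa>) = (\<integral>\<^sup>+x. ennreal (norm (w x)) \<partial>m)"
    unfolding \<kappa>_def using wm by (simp add: emeasure_density cong: nn_integral_cong)
  also have "\<dots> < \<infinity>" using w by (simp add: integrable_iff_bounded)
  finally have "finite_measure \<kappa>" by (intro finite_measureI) auto
  then have "polar \<kappa> \<rho>" unfolding polar_def using \<rho>b \<rho>1 m by (simp add: \<kappa>_def)
  moreover have "(\<integral>x. \<Psi> x \<bullet> \<rho> x \<partial>\<kappa>) = (\<integral>x. \<Psi> x \<bullet> w x \<partial>m)" if \<Psi>: "bounded_borel \<Psi>" for \<Psi>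
  proof -
    have "(\<lambda>x. \<Psi> x \<bullet> \<rho> x) \<in> borel_measurable borel"
      by (intro borel_measurable_inner bounded_borel_measurable[OF \<Psi>] \<rho>b)
    then have "(\<lambda>x. \<Psi> x \<bullet> \<rho> x) \<in> borel_measurable m"
      using measurable_cong_sets[OF m(2) refl] by blast
    then have "(\<integral>x. \<Psi> x \<bullet> \<rho> x \<partial>\<kappa>) = (\<integral>x. norm (w x) *\<^sub>R (\<Psi> x \<bullet> \<rho> x) \<partial>m)"
      unfolding \<kappa>_def using wm by (intro integral_density) auto
    also have "\<dots> = (\<integral>x. \<Psi> x \<bullet> w x \<partial>m)"
      by (intro Bochner_Integration.integral_cong) (auto simp: \<rho>_def)
    finally show ?thesis .
  qed
  ultimately show ?thesis by blast
qed

lemma real_density_exists: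
  assumes m: "finite_measure m" and \<mu>: "finite_measure \<mu>" and "absolutely_continuous m \<mu>" "sets \<mu> = sets m"
  shows "\<exists>D. D \<in> borel_measurable m \<and> (\<forall>x. 0 \<le> D x) \<and> integrable m D \<and> \<mu> = density m (\<lambda>x. ennreal (D x))"
proof -
  interpret m: finite_measure m by fact
  interpret \<mu>: finite_measure \<mu> by fact
  obtain D where D: "D \<in> borel_measurable m" "AE x in m. RN_deriv m \<mu> x = ennreal (D x)" "\<And>x. 0 \<le> D x"
    using m.real_RN_deriv[OF \<mu> assms(3,4)] by metis
  have "\<mu> = density m (RN_deriv m \<mu>)" using m.density_RN_deriv[OF assms(3,4)] by simp
  also have "\<dots> = density m (\<lambda>x. ennreal (D x))"
    by (rule density_cong) (use D in auto)
  finally have eq: "\<mu> = density m (\<lambda>x. ennreal (D x))" .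
  have "emeasure \<mu> (space m) = (\<integral>\<^sup>+x. ennreal (D x) * indicator (space m) x \<partial>m)"
    by (subst eq, rule emeasure_density) (use D in auto)
  also have "\<dots> = (\<integral>\<^sup>+x. ennreal (D x) \<partial>m)" by (intro nn_integral_cong) auto
  finally have "integrable m D" using D \<mu>.emeasure_finite[of "space m"]
    by (intro integrableI_nonneg) (auto simp: top.not_eq_extremum)
  with eq D show ?thesis by blast
qed

text \<open>Both measures have Radon-Nikodym densities with respect to their sum. The vector
  densities are combined pointwise and the result is put back into polar form; this is what makes
  \<open>BV\<close> a vector space.\<close>

lemma polar_lincomb:
  assumes p: "polar \<mu> \<sigma>" and q: "polar \<nu> \<tau>"
  shows "\<exists>\<kappa> \<rho>. polar \<kappa> \<rho> \<and> (\<forall>\<Psi>. bounded_borel \<Psi> \<longrightarrow>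
    (\<integral>x. \<Psi> x \<bullet> \<rho> x \<partial>\<kappa>) = a * (\<integral>x. \<Psi> x \<bullet> \<sigma> x \<partial>\<mu>) + b * (\<integral>x. \<Psi> x \<bullet> \<tau> x \<partial>\<nu>))"
proof -
  \<comment> \<open>Padding with null measures turns \<open>sum_measure\<close> into the sum of two
    measures.\<close>
  define M where "M n = (if n = 0 then \<mu> else if n = 1 then \<nu> else null_measure borel)" for n :: nat
  define m where "m = sum_measure M"
  have sM: "sets (M n) = sets borel" for n using polarD[OF p] polarD[OF q] by (auto simp: M_def)
  have em: "emeasure m A = emeasure \<mu> A + emeasure \<nu> A" if "A \<in> sets borel" for A
  proof -
    have "(\<Sum>n. emeasure (M n) A) = (\<Sum>n\<in>{0,1}. emeasure (M n) A)"
      by (rule suminf_finite) (auto simp: M_def)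
    then show ?thesis unfolding m_def emeasure_sum_measure[OF sM that] by (simp add: M_def)
  qed
  have sm: "sets m = sets borel" by (simp add: m_def)
  interpret \<mu>: finite_measure \<mu> using polarD[OF p] by simp
  interpret \<nu>: finite_measure \<nu> using polarD[OF q] by simp
  have fm: "finite_measure m"
    by (rule finite_measureI) (simp add: em sets_eq_imp_space_eq[OF sm])
  have ac: "absolutely_continuous m \<mu>" "absolutely_continuous m \<nu>"
    using em sm polarD[OF p] polarD[OF q] by (auto simp: absolutely_continuous_def null_sets_def)
  obtain f where f: "f \<in> borel_measurable m" "\<And>x. 0 \<le> f x" "integrable m f" "\<mu> = density m (\<lambda>x. ennreal (f x))"
    using real_density_exists[OF fm _ ac(1)] polarD[OF p] sm by auto
  obtain g where g: "g \<in> borel_measurable m" "\<And>x. 0 \<le> g x" "integrable m g" "\<nu> = density m (\<lambda>x. ennreal (g x))"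
    using real_density_exists[OF fm _ ac(2)] polarD[OF q] sm by auto
  have int: "integrable m (\<lambda>x. h x *\<^sub>R \<tau> x)" if "integrable m h" "polar \<nu> \<tau>" for h \<nu> and \<tau> :: "'a \<Rightarrow> 'a"
  proof (rule Bochner_Integration.integrable_bound[OF that(1)])
    have "\<tau> \<in> borel_measurable m" using that(2) measurable_cong_sets[OF sm refl] by (auto simp: polar_def)
    then show "(\<lambda>x. h x *\<^sub>R \<tau> x) \<in> borel_measurable m" using that(1) by simp
  qed (use polar_norm[OF that(2)] in auto)
  define w where "w x = a *\<^sub>R (f x *\<^sub>R \<sigma> x) + b *\<^sub>R (g x *\<^sub>R \<tau> x)" for x
  have w: "integrable m w" unfolding w_def
    by (intro Bochner_Integration.integrable_add integrable_scaleR_right int[OF f(3) p] int[OF g(3) q])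
  obtain \<kappa> \<rho> where \<kappa>: "polar \<kappa> \<rho>" "\<And>\<Psi>. bounded_borel \<Psi> \<Longrightarrow> (\<integral>x. \<Psi> x \<bullet> \<rho> x \<partial>\<kappa>) = (\<integral>x. \<Psi> x \<bullet> w x \<partial>m)"
    using polar_of_field[OF fm sm w] by blast
  have "(\<integral>x. \<Psi> x \<bullet> w x \<partial>m) = a * (\<integral>x. \<Psi> x \<bullet> \<sigma> x \<partial>\<mu>) + b * (\<integral>x. \<Psi> x \<bullet> \<tau> x \<partial>\<nu>)"
    if \<Psi>: "bounded_borel \<Psi>" for \<Psi>
  proof -
    have 1: "integrable m (\<lambda>x. h x *\<^sub>R (\<Psi> x \<bullet> \<tau> x))" "(\<integral>x. \<Psi> x \<bullet> \<tau> x \<partial>\<nu>) = (\<integral>x. h x *\<^sub>R (\<Psi> x \<bullet> \<tau> x) \<partial>m)"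
      if h: "h \<in> borel_measurable m" "\<And>x. 0 \<le> h x" "\<nu> = density m (\<lambda>x. ennreal (h x))" and pp: "polar \<nu> \<tau>" for h \<nu> \<tau>
    proof -
      have "bounded_borel (\<lambda>x. \<Psi> x \<bullet> \<tau> x)" by (intro bounded_borel_inner \<Psi> polar_bounded_borel[OF pp])
      then have me: "(\<lambda>x. \<Psi> x \<bullet> \<tau> x) \<in> borel_measurable m"
        using bounded_borel_measurable measurable_cong_sets[OF sm refl] by blast
      show "integrable m (\<lambda>x. h x *\<^sub>R (\<Psi> x \<bullet> \<tau> x))"
        using polar_integrable[OF pp \<Psi>] h me unfolding h(3) by (subst (asm) integrable_density) auto
      show "(\<integral>x. \<Psi> x \<bullet> \<tau> x \<partial>\<nu>) = (\<integral>x. h x *\<^sub>R (\<Psi> x \<bullet> \<tau> x) \<partial>m)"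
        unfolding h(3) by (rule integral_density) (use me h in auto)
    qed
    note F = 1[OF f(1,2,4) p] and G = 1[OF g(1,2,4) q]
    have "(\<integral>x. \<Psi> x \<bullet> w x \<partial>m) = (\<integral>x. a * (f x *\<^sub>R (\<Psi> x \<bullet> \<sigma> x)) + b * (g x *\<^sub>R (\<Psi> x \<bullet> \<tau> x)) \<partial>m)"
      by (intro Bochner_Integration.integral_cong) (auto simp: w_def inner_add_right)
    also have "\<dots> = a * (\<integral>x. \<Psi> x \<bullet> \<sigma> x \<partial>\<mu>) + b * (\<integral>x. \<Psi> x \<bullet> \<tau> x \<partial>\<nu>)"
      unfolding F(2) G(2) using F(1) G(1)
      by simp
    finally show ?thesis .
  qed
  with \<kappa> show ?thesis by metis
qed

lemma grad_measureI:
  fixes u :: "real^'d \<Rightarrow> real"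
  assumes "polar \<mu> \<sigma>"
    "\<And>\<phi>. Cc1_field \<phi> \<Longrightarrow> (\<integral>x. u x * divergence \<phi> x \<partial>lebesgue) = - (\<integral>x. \<phi> x \<bullet> \<sigma> x \<partial>\<mu>)"
  shows "grad_measure u \<mu> \<sigma>"
  using assms polar_integrable[OF assms(1) bounded_borel_Cc1_field] by (auto simp: grad_measure_def polar_def)

lemma grad_measure_eq:
  "grad_measure u \<mu> \<sigma> \<Longrightarrow> Cc1_field \<phi> \<Longrightarrow> (\<integral>x. u x * divergence \<phi> x \<partial>lebesgue) = - (\<integral>x. \<phi> x \<bullet> \<sigma> x \<partial>\<mu>)"
  by (simp add: grad_measure_def)

lemma BV_lincomb:
  assumes "u \<in> BV" "v \<in> BV" shows "(\<lambda>x. a * u x + b * v x) \<in> BV"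
proof -
  obtain \<mu> \<sigma> where u: "grad_measure u \<mu> \<sigma>" "integrable lebesgue u" using assms(1) by (auto simp: BV_def)
  obtain \<nu> \<tau> where v: "grad_measure v \<nu> \<tau>" "integrable lebesgue v" using assms(2) by (auto simp: BV_def)
  obtain \<kappa> \<rho> where \<kappa>: "polar \<kappa> \<rho>" "\<And>\<Psi>. bounded_borel \<Psi> \<Longrightarrow>
      (\<integral>x. \<Psi> x \<bullet> \<rho> x \<partial>\<kappa>) = a * (\<integral>x. \<Psi> x \<bullet> \<sigma> x \<partial>\<mu>) + b * (\<integral>x. \<Psi> x \<bullet> \<tau> x \<partial>\<nu>)"
    using polar_lincomb[OF grad_measure_polar[OF u(1)] grad_measure_polar[OF v(1)], of a b] by blast
  have "grad_measure (\<lambda>x. a * u x + b * v x) \<kappa> \<rho>"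
  proof (rule grad_measureI[OF \<kappa>(1)])
    fix \<phi> :: "real^'a \<Rightarrow> real^'a" assume \<phi>: "Cc1_field \<phi>"
    note d = bounded_borel_divergence[OF \<phi>]
    have "(\<integral>x. (a * u x + b * v x) * divergence \<phi> x \<partial>lebesgue) =
      (\<integral>x. a * (u x * divergence \<phi> x) + b * (v x * divergence \<phi> x) \<partial>lebesgue)"
      by (simp add: algebra_simps)
    also have "\<dots> = a * (\<integral>x. u x * divergence \<phi> x \<partial>lebesgue) + b * (\<integral>x. v x * divergence \<phi> x \<partial>lebesgue)"
      using integrable_mult_bounded_borel[OF u(2) d] integrable_mult_bounded_borel[OF v(2) d] by simp
    finally show "(\<integral>x. (a * u x + b * v x) * divergence \<phi> x \<partial>lebesgue) = - (\<integral>x. \<phi> x \<bullet> \<rho> x \<partial>\<kappa>)"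
      unfolding grad_measure_eq[OF u(1) \<phi>] grad_measure_eq[OF v(1) \<phi>] \<kappa>(2)[OF bounded_borel_Cc1_field[OF \<phi>]] by simp
  qed
  then show ?thesis using u v unfolding BV_def by auto
qed

text \<open>Weak convergence is tested with functionals defined on all functions, so the integral
  against the gradient is written as a function of \<open>u\<close> alone. Its values off
  \<open>BV\<close> are arbitrary.\<close>

definition field_functional :: "(real^'d \<Rightarrow> real^'d) \<Rightarrow> (real^'d \<Rightarrow> real) \<Rightarrow> real" where
  "field_functional \<Psi> u = (THE l. \<exists>\<mu> \<sigma>. grad_measure u \<mu> \<sigma> \<and> l = (\<integral>x. \<Psi> x \<bullet> \<sigma> x \<partial>\<mu>))"

lemma field_functional_eq:
  assumes "grad_measure u \<mu> \<sigma>" "integrable lebesgue u" "bounded_borel \<Psi>"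
  shows "field_functional \<Psi> u = (\<integral>x. \<Psi> x \<bullet> \<sigma> x \<partial>\<mu>)"
  unfolding field_functional_def
proof (rule the_equality)
  show "\<exists>\<mu>' \<sigma>'. grad_measure u \<mu>' \<sigma>' \<and> (\<integral>x. \<Psi> x \<bullet> \<sigma> x \<partial>\<mu>) = (\<integral>x. \<Psi> x \<bullet> \<sigma>' x \<partial>\<mu>')"
    using assms by blast
qed (use grad_measure_unique(2)[OF _ assms] in blast)

lemma BV_cases:
  assumes "u \<in> BV" obtains \<mu> \<sigma> where "grad_measure u \<mu> \<sigma>" "integrable lebesgue u"
  using assms by (auto simp: BV_def)

lemma bv_weak_conv_diff:
  fixes L :: "(real^'d \<Rightarrow> real) \<Rightarrow> real"
  assumes "bv_weak_conv F f" "\<And>n. F n \<in> BV" "f \<in> BV"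
    and lin: "\<And>u v a b. u \<in> BV \<Longrightarrow> v \<in> BV \<Longrightarrow> L (\<lambda>x. a * u x + b * v x) = a * L u + b * L v"
    and bd: "\<And>u. u \<in> BV \<Longrightarrow> \<bar>L u\<bar> \<le> C * bv_norm u"
  shows "(\<lambda>n. L (\<lambda>x. f x - F n x)) \<longlonglongrightarrow> 0"
proof -
  have "(\<lambda>n. L (F n)) \<longlonglongrightarrow> L f"
    using assms(1) lin bd unfolding bv_weak_conv_def by blast
  then have "(\<lambda>n. L f - L (F n)) \<longlonglongrightarrow> L f - L f" by (intro tendsto_diff tendsto_const)
  moreover have "L (\<lambda>x. f x - F n x) = L f - L (F n)" for n
    using lin[OF assms(3) assms(2)[of n], of 1 "-1"] by simp
  ultimately show ?thesis by simp
qed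

text \<open>Integrating a bounded Borel field against the gradient is bounded by the supremum of the
  field times the total variation, hence is continuous on \<open>BV\<close>. The admission of
  discontinuous fields is the strength of the hypothesis on which both gliding hump arguments
  rest.\<close>

lemma weak_conv_field:
  assumes "bv_weak_conv F f" "\<And>n. F n \<in> BV" "f \<in> BV"
    and g: "\<And>n. grad_measure (\<lambda>x. f x - F n x) (\<mu> n) (\<sigma> n)" and \<Psi>: "bounded_borel \<Psi>"
  shows "(\<lambda>n. \<integral>x. \<Psi> x \<bullet> \<sigma> n x \<partial>\<mu> n) \<longlonglongrightarrow> 0"
proof -
  obtain B where B: "0 \<le> B" "\<And>x. norm (\<Psi> x) \<le> B" using bounded_borel_bound[OF \<Psi>] by blast
  have "(\<lambda>n. field_functional \<Psi> (\<lambda>x. f x - F n x)) \<longlonglongrightarrow> 0"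
  proof (rule bv_weak_conv_diff[OF assms(1-3)])
    fix u v :: "real^'a \<Rightarrow> real" and a b assume uv: "u \<in> BV" "v \<in> BV"
    obtain \<mu> \<sigma> where u: "grad_measure u \<mu> \<sigma>" "integrable lebesgue u" using uv(1) by (rule BV_cases)
    obtain \<nu> \<tau> where v: "grad_measure v \<nu> \<tau>" "integrable lebesgue v" using uv(2) by (rule BV_cases)
    obtain \<kappa> \<rho> where w: "grad_measure (\<lambda>x. a * u x + b * v x) \<kappa> \<rho>" "integrable lebesgue (\<lambda>x. a * u x + b * v x)"
      using BV_lincomb[OF uv] by (rule BV_cases)
    show "field_functional \<Psi> (\<lambda>x. a * u x + b * v x) = a * field_functional \<Psi> u + b * field_functional \<Psi> v"
      using grad_measure_linear[OF u v w(1) \<Psi>]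
      by (simp add: field_functional_eq[OF u \<Psi>] field_functional_eq[OF v \<Psi>] field_functional_eq[OF w \<Psi>])
  next
    fix u :: "real^'a \<Rightarrow> real" assume "u \<in> BV"
    then obtain \<mu> \<sigma> where u: "grad_measure u \<mu> \<sigma>" "integrable lebesgue u" by (rule BV_cases)
    have "\<bar>field_functional \<Psi> u\<bar> \<le> B * measure \<mu> UNIV"
      unfolding field_functional_eq[OF u \<Psi>]
      by (rule polar_integral_le[OF grad_measure_polar[OF u(1)] \<Psi>]) (use B in auto)
    also have "\<dots> \<le> B * bv_norm u"
      unfolding bv_norm_eq[OF u] using B by (intro mult_left_mono) auto
    finally show "\<bar>field_functional \<Psi> u\<bar> \<le> B * bv_norm u" .
  qed
  moreover have "integrable lebesgue (\<lambda>x. f x - F n x)" for n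
    using assms(2)[of n] assms(3) by (auto simp: BV_def)
  ultimately show ?thesis using field_functional_eq[OF g _ \<Psi>] by simp
qed

lemma weak_conv_integral:
  fixes F :: "nat \<Rightarrow> real^'d \<Rightarrow> real"
  assumes "bv_weak_conv F f" "\<And>n. F n \<in> BV" "f \<in> BV" and \<psi>: "bounded_borel \<psi>"
  shows "(\<lambda>n. \<integral>x. (f x - F n x) * \<psi> x \<partial>lebesgue) \<longlonglongrightarrow> 0"
proof -
  obtain B where B: "0 \<le> B" "\<And>x. norm (\<psi> x) \<le> B" using bounded_borel_bound[OF \<psi>] by blast
  show ?thesis
  proof (rule bv_weak_conv_diff[OF assms(1-3)])
    fix u v :: "real^'d \<Rightarrow> real" and a b assume "u \<in> BV" "v \<in> BV"
    then have "integrable lebesgue u" "integrable lebesgue v" by (auto simp: BV_def)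
    note i = this[THEN integrable_mult_bounded_borel, OF \<psi>]
    have "(\<integral>x. (a * u x + b * v x) * \<psi> x \<partial>lebesgue) = (\<integral>x. a * (u x * \<psi> x) + b * (v x * \<psi> x) \<partial>lebesgue)"
      by (simp add: algebra_simps)
    also have "\<dots> = a * (\<integral>x. u x * \<psi> x \<partial>lebesgue) + b * (\<integral>x. v x * \<psi> x \<partial>lebesgue)"
      using i by simp
    finally show "(\<integral>x. (a * u x + b * v x) * \<psi> x \<partial>lebesgue) = \<dots>" .
  next
    fix u :: "real^'d \<Rightarrow> real" assume "u \<in> BV"
    then obtain \<mu> \<sigma> where u: "grad_measure u \<mu> \<sigma>" "integrable lebesgue u" by (rule BV_cases)
    have "\<bar>\<integral>x. u x * \<psi> x \<partial>lebesgue\<bar> \<le> (\<integral>x. \<bar>u x * \<psi> x\<bar> \<partial>lebesgue)" by (rule integral_abs_bound)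
    also have "\<dots> \<le> (\<integral>x. B * \<bar>u x\<bar> \<partial>lebesgue)"
    proof (rule integral_mono)
      show "integrable lebesgue (\<lambda>x. \<bar>u x * \<psi> x\<bar>)" using integrable_mult_bounded_borel[OF u(2) \<psi>] by (rule integrable_abs)
      show "integrable lebesgue (\<lambda>x. B * \<bar>u x\<bar>)" using u(2) by simp
      show "\<bar>u x * \<psi> x\<bar> \<le> B * \<bar>u x\<bar>" for x
        using mult_right_mono[OF B(2)[of x], of "\<bar>u x\<bar>"] by (simp add: abs_mult mult.commute)
    qed
    also have "\<dots> \<le> B * bv_norm u"
      unfolding bv_norm_eq[OF u] using B by (simp add: mult_left_mono)
    finally show "\<bar>\<integral>x. u x * \<psi> x \<partial>lebesgue\<bar> \<le> B * bv_norm u" .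
  qed
qed

section \<open>Translations\<close>

text \<open>Elements of \<open>BV\<close> are only Lebesgue measurable, while products and
  translates are handled with Borel functions over \<open>lborel\<close>.\<close>

lemma lebesgue_integrable_borel_version:
  fixes u :: "'a::euclidean_space \<Rightarrow> real"
  assumes u: "integrable lebesgue u"
  shows "\<exists>g. g \<in> borel_measurable borel \<and> integrable lborel g \<and> (AE x in lborel. u x = g x) \<and>
    (\<forall>\<psi>\<in>borel_measurable borel. (\<integral>x. u x * \<psi> x \<partial>lebesgue) = (\<integral>x. g x * \<psi> x \<partial>lborel :: real))"
proof -
  obtain g where g: "g \<in> borel_measurable lborel" "AE x in lborel. u x = g x"
    using completion_ex_borel_measurable_real borel_measurable_integrable[OF u] by blast
  have ae: "AE x in lebesgue. u x = g x" using g(2) by (rule AE_completion)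
  have gl: "g \<in> borel_measurable lebesgue" using g(1) by (rule measurable_completion)
  have "integrable lebesgue g"
    using integrable_cong_AE[OF borel_measurable_integrable[OF u] gl ae] u by simp
  then have "integrable lborel g" using integrable_completion g(1) by blast
  moreover have "(\<integral>x. u x * \<psi> x \<partial>lebesgue) = (\<integral>x. g x * \<psi> x \<partial>lborel)" if "\<psi> \<in> borel_measurable borel" for \<psi>
  proof -
    have m: "\<psi> \<in> borel_measurable lborel" using that by simp
    then have ml: "\<psi> \<in> borel_measurable lebesgue" by (rule measurable_completion)
    have "(\<integral>x. u x * \<psi> x \<partial>lebesgue) = (\<integral>x. g x * \<psi> x \<partial>lebesgue)"
      by (rule integral_cong_AE) (use ml gl ae borel_measurable_integrable[OF u] in auto)
    also have "\<dots> = (\<integral>x. g x * \<psi> x \<partial>lborel)"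
      by (rule integral_completion) (use m g in auto)
    finally show ?thesis .
  qed
  ultimately show ?thesis using g by (intro exI[of _ g] conjI ballI) auto
qed

section \<open>Product integrals and translates of integrals\<close>

lemma integrable_pair_bound:
  fixes F :: "'a \<times> 'b \<Rightarrow> real"
  assumes M: "sigma_finite_measure M" and N: "sigma_finite_measure N"
    and f: "integrable M f" and h: "integrable N h" and F: "F \<in> borel_measurable (M \<Otimes>\<^sub>M N)"
    and le: "\<And>x y. \<bar>F (x, y)\<bar> \<le> \<bar>f x :: real\<bar> * \<bar>h y :: real\<bar>"
  shows "integrable (M \<Otimes>\<^sub>M N) F"
proof (rule integrableI_bounded[OF F])
  interpret pair_sigma_finite M N using M N by (simp add: pair_sigma_finite_def)
  have [measurable]: "f \<in> borel_measurable M" "h \<in> borel_measurable N" using f h by auto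
  have "(\<integral>\<^sup>+z. ennreal (norm (F z)) \<partial>(M \<Otimes>\<^sub>M N)) \<le> (\<integral>\<^sup>+z. ennreal \<bar>f (fst z)\<bar> * ennreal \<bar>h (snd z)\<bar> \<partial>(M \<Otimes>\<^sub>M N))"
    by (intro nn_integral_mono) (use le in \<open>auto simp: ennreal_mult[symmetric]\<close>)
  also have "\<dots> = (\<integral>\<^sup>+x. \<integral>\<^sup>+y. ennreal \<bar>f x\<bar> * ennreal \<bar>h y\<bar> \<partial>N \<partial>M)"
    by (subst M2.nn_integral_fst[symmetric]) auto
  also have "\<dots> = (\<integral>\<^sup>+x. ennreal \<bar>f x\<bar> * (\<integral>\<^sup>+y. ennreal \<bar>h y\<bar> \<partial>N) \<partial>M)"
    by (intro nn_integral_cong nn_integral_cmult) auto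
  also have "\<dots> = (\<integral>\<^sup>+x. ennreal \<bar>f x\<bar> \<partial>M) * (\<integral>\<^sup>+y. ennreal \<bar>h y\<bar> \<partial>N)"
    by (intro nn_integral_multc) auto
  also have "\<dots> < \<infinity>" using f h by (simp add: integrable_iff_bounded ennreal_mult_less_top)
  finally show "(\<integral>\<^sup>+z. ennreal (norm (F z)) \<partial>(M \<Otimes>\<^sub>M N)) < \<infinity>" .
qed

lemma lborel_integral_shift:
  fixes f :: "'a::euclidean_space \<Rightarrow> real"
  assumes "f \<in> borel_measurable borel"
  shows "(\<integral>x. f (x + v) \<partial>lborel) = (\<integral>x. f x \<partial>lborel)"
proof -
  have "(\<integral>x. f x \<partial>lborel) = (\<integral>x. f x \<partial>distr lborel borel ((+) v))" by (simp add: lborel_distr_plus)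
  also have "\<dots> = (\<integral>x. f (v + x) \<partial>lborel)" by (rule integral_distr) (use assms in auto)
  finally show ?thesis by (simp add: add.commute)
qed

lemma lborel_integrable_shift:
  fixes f :: "'a::euclidean_space \<Rightarrow> real"
  assumes "integrable lborel f"
  shows "integrable lborel (\<lambda>x. f (x + v))"
proof -
  have "integrable (distr lborel borel ((+) v)) f" using assms by (simp add: lborel_distr_plus)
  then have "integrable lborel (\<lambda>x. f (v + x))" by (rule integrable_distr[rotated]) auto
  then show ?thesis by (simp add: add.commute)
qed

text \<open>The mean over the segment from \<open>x\<close> to \<open>x + v\<close>. It is the
  weight with which the gradient is tested when a difference
  \<open>\<phi> (x + v) - \<phi> x\<close> is integrated by parts.\<close>

definition line_avg :: "('a::euclidean_space \<Rightarrow> real) \<Rightarrow> 'a \<Rightarrow> 'a \<Rightarrow> real" where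
  "line_avg \<phi> v x = (\<integral>s. \<phi> (x + s *\<^sub>R v) * indicator {0..1} s \<partial>lborel)"

lemma line_avg_integrable:
  fixes \<phi> :: "'a::euclidean_space \<Rightarrow> real"
  assumes "bounded_borel \<phi>"
  shows "integrable lborel (\<lambda>s::real. \<phi> (x + s *\<^sub>R v) * indicator {0..1} s)"
proof -
  obtain B where B: "\<And>x. \<bar>\<phi> x\<bar> \<le> B" using bounded_borel_bound[OF assms] by auto
  have [measurable]: "\<phi> \<in> borel_measurable borel" using bounded_borel_measurable[OF assms] .
  show ?thesis
  proof (rule Bochner_Integration.integrable_bound)
    show "integrable lborel (\<lambda>s::real. B * indicator {0..1} s)" by simp
    show "AE s in lborel. norm (\<phi> (x + s *\<^sub>R v) * indicator {0..1} s) \<le> norm (B * indicator {0..1} s)"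
      using B abs_ge_self[of B] by (auto simp: indicator_def intro: order_trans)
  qed simp
qed

lemma line_avg_le:
  assumes "bounded_borel \<phi>" and "\<And>s. 0 \<le> s \<Longrightarrow> s \<le> 1 \<Longrightarrow> \<bar>\<phi> (x + s *\<^sub>R v)\<bar> \<le> B"
  shows "\<bar>line_avg \<phi> v x\<bar> \<le> B"
proof -
  have "\<bar>line_avg \<phi> v x\<bar> \<le> (\<integral>s. \<bar>\<phi> (x + s *\<^sub>R v) * indicator {0..1} s\<bar> \<partial>lborel)"
    unfolding line_avg_def by (rule integral_abs_bound)
  also have "\<dots> \<le> (\<integral>s. B * indicator {0..1::real} s \<partial>lborel)"
  proof (rule integral_mono)
    show "integrable lborel (\<lambda>s. \<bar>\<phi> (x + s *\<^sub>R v) * indicator {0..1} s\<bar>)"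
      by (intro integrable_abs line_avg_integrable assms)
  qed (use assms(2) in \<open>auto split: split_indicator\<close>)
  also have "\<dots> = B" by simp
  finally show ?thesis .
qed

lemma line_avg_const:
  assumes "\<And>s. 0 \<le> s \<Longrightarrow> s \<le> 1 \<Longrightarrow> \<phi> (x + s *\<^sub>R v) = c"
  shows "line_avg \<phi> v x = c"
proof -
  have "line_avg \<phi> v x = (\<integral>s. c * indicator {0..1::real} s \<partial>lborel)"
    unfolding line_avg_def by (intro Bochner_Integration.integral_cong) (auto simp: indicator_def assms)
  then show ?thesis by simp
qed

lemma bounded_borel_line_avg:
  assumes "bounded_borel \<phi>" shows "bounded_borel (line_avg \<phi> v)"
proof -
  obtain B where B: "\<And>x. \<bar>\<phi> x\<bar> \<le> B" using bounded_borel_bound[OF assms] by auto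
  have [measurable]: "\<phi> \<in> borel_measurable borel" using bounded_borel_measurable[OF assms] .
  have "line_avg \<phi> v \<in> borel_measurable borel"
    unfolding line_avg_def[abs_def] by (rule lborel.borel_measurable_lebesgue_integral) measurable
  then show ?thesis using line_avg_le[OF assms, of _ v B] B by (intro bounded_borelI) auto
qed

text \<open>All later estimates of the gradient by \<open>u\<close>, or of \<open>u\<close> by the
  gradient, rest on this formula. For a test function the difference is the integral of the
  directional derivative along the segment; integrate by parts for each point of the segment and
  apply Fubini. Both sides are functionals of \<phi> of the type \<open>sigma_functional\<close>, so
  discontinuous \<phi> are reached as well.\<close>

theorem grad_measure_shift:
  fixes u :: "real^'d \<Rightarrow> real"
  assumes u: "grad_measure u \<mu> \<sigma>" "integrable lebesgue u" and \<phi>: "bounded_borel \<phi>"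
  shows "(\<integral>x. u x * (\<phi> (x + v) - \<phi> x) \<partial>lebesgue) = - (\<integral>x. (line_avg \<phi> v x *\<^sub>R v) \<bullet> \<sigma> x \<partial>\<mu>)"
proof -
  note p = grad_measure_polar[OF u(1)]
  interpret \<mu>: finite_measure \<mu> using polarD[OF p] by simp
  obtain g where g: "g \<in> borel_measurable borel" "integrable lborel g"
    "\<And>\<psi>. \<psi> \<in> borel_measurable borel \<Longrightarrow> (\<integral>x. u x * \<psi> x \<partial>lebesgue) = (\<integral>x. g x * \<psi> x \<partial>lborel)"
    using lebesgue_integrable_borel_version[OF u(2)] by auto
  note [measurable] = g(1)
  have \<sigma>m: "\<sigma> \<in> borel_measurable borel" using p by (simp add: polar_def)
  note sm = measurable_cong_sets[OF polar_sets[OF p] refl]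
  have [measurable]: "\<sigma> \<in> borel_measurable \<mu>" using \<sigma>m sm by blast
  have id\<mu>: "(\<lambda>x. x) \<in> \<mu> \<rightarrow>\<^sub>M borel" by (rule measurable_ident_sets[OF polar_sets[OF p]])
  interpret P: pair_sigma_finite \<mu> "lborel :: real measure" ..
  let ?I = "indicator {0..1} :: real \<Rightarrow> real"
  \<comment> \<open>The right side as a single integral over a product, weighted by an integrable
    function and with the shift as point map: the form required by
    \<open>sigma_functional_integral\<close>.\<close>
  define S where "S \<phi> = (\<integral>z. \<phi> (fst z + snd z *\<^sub>R v) * (?I (snd z) * (v \<bullet> \<sigma> (fst z))) \<partial>(\<mu> \<Otimes>\<^sub>M lborel))" for \<phi>
  have shift [measurable]: "(\<lambda>z. fst z + snd z *\<^sub>R v) \<in> \<mu> \<Otimes>\<^sub>M (lborel :: real measure) \<rightarrow>\<^sub>M borel"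
    using measurable_compose[OF measurable_fst id\<mu>] by measurable
  have wint: "integrable (\<mu> \<Otimes>\<^sub>M lborel) (\<lambda>z. ?I (snd z) * (v \<bullet> \<sigma> (fst z)))"
  proof (rule integrable_pair_bound[where f = "\<lambda>x. norm v" and h = ?I])
    show "\<bar>?I (snd (x, y)) * (v \<bullet> \<sigma> (fst (x, y)))\<bar> \<le> \<bar>norm v\<bar> * \<bar>?I y\<bar>" for x y
      using Cauchy_Schwarz_ineq2[of v "\<sigma> x"] polar_norm[OF p, of x] by (auto simp: indicator_def)
  qed (auto simp: \<mu>.sigma_finite_measure_axioms lborel.sigma_finite_measure_axioms)
  have Sint: "integrable (\<mu> \<Otimes>\<^sub>M lborel) (\<lambda>z. \<phi> (fst z + snd z *\<^sub>R v) * (?I (snd z) * (v \<bullet> \<sigma> (fst z))))"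
    if bb: "bounded_borel \<phi>" for \<phi>
  proof -
    obtain B where B: "0 \<le> B" "\<And>x. \<bar>\<phi> x\<bar> \<le> B" using bounded_borel_bound[OF bb] by auto
    have [measurable]: "\<phi> \<in> borel_measurable borel" using bounded_borel_measurable[OF that] .
    show ?thesis
    proof (rule Bochner_Integration.integrable_bound[OF integrable_mult_right[OF wint, of B]])
      show "AE z in \<mu> \<Otimes>\<^sub>M lborel. norm (\<phi> (fst z + snd z *\<^sub>R v) * (?I (snd z) * (v \<bullet> \<sigma> (fst z))))
         \<le> norm (B * (?I (snd z) * (v \<bullet> \<sigma> (fst z))))"
        using B by (auto simp: abs_mult intro!: mult_right_mono)
    qed measurable
  qed
  have Sfst: "S \<phi> = (\<integral>x. (line_avg \<phi> v x *\<^sub>R v) \<bullet> \<sigma> x \<partial>\<mu>)" if "bounded_borel \<phi>" for \<phi>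
  proof -
    have "S \<phi> = (\<integral>x. \<integral>s. \<phi> (x + s *\<^sub>R v) * (?I s * (v \<bullet> \<sigma> x)) \<partial>lborel \<partial>\<mu>)"
      unfolding S_def using P.integral_fst'[OF Sint[OF that]] by simp
    also have "\<dots> = (\<integral>x. \<integral>s. (\<phi> (x + s *\<^sub>R v) * ?I s) * (v \<bullet> \<sigma> x) \<partial>lborel \<partial>\<mu>)"
      by (simp add: mult.assoc)
    also have "\<dots> = (\<integral>x. (line_avg \<phi> v x *\<^sub>R v) \<bullet> \<sigma> x \<partial>\<mu>)"
      unfolding line_avg_def by simp
    finally show ?thesis .
  qed
  define T where "T \<phi> = ((\<integral>x. \<phi> (x + v) * g x \<partial>lborel) - (\<integral>x. \<phi> x * g x \<partial>lborel)) + S \<phi>" for \<phi>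
  have gint: "integrable lborel (\<lambda>x. \<phi> (x + w) * g x)" if bb: "bounded_borel \<phi>" for \<phi> w
  proof -
    obtain B where B: "0 \<le> B" "\<And>x. \<bar>\<phi> x\<bar> \<le> B" using bounded_borel_bound[OF bb] by auto
    have [measurable]: "\<phi> \<in> borel_measurable borel" using bounded_borel_measurable[OF that] .
    show ?thesis
    proof (rule Bochner_Integration.integrable_bound[OF integrable_mult_right[OF g(2), of B]])
      show "AE x in lborel. norm (\<phi> (x + w) * g x) \<le> norm (B * g x)"
        using B by (auto simp: abs_mult intro!: mult_right_mono)
    qed measurable
  qed
  have "T \<phi> = 0"
  proof (rule sigma_functional_eq_0[OF _ _ \<phi>])
    show "sigma_functional T" unfolding T_def[abs_def] S_def
      by (intro sigma_functional_plus sigma_functional_diff sigma_functional_integral wint g shift) auto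
    fix \<phi> :: "real^'d \<Rightarrow> real" assume \<phi>: "Cc1 \<phi>"
    note b\<phi> = bounded_borel_Cc1[OF \<phi>]
    let ?D = "\<lambda>x. frechet_derivative \<phi> (at x) v"
    have bD: "bounded_borel ?D" by (rule bounded_borel_Cc1_derivative[OF \<phi>])
    note [measurable] = bounded_borel_measurable[OF bD] bounded_borel_measurable[OF b\<phi>]
    have ftc: "\<phi> (x + v) - \<phi> x = (\<integral>s. ?D (x + s *\<^sub>R v) * ?I s \<partial>lborel)" for x
    proof -
      have "((\<lambda>s. \<phi> (x + s *\<^sub>R v)) has_real_derivative ?D (x + s *\<^sub>R v)) (at s)" for s
      proof -
        have "((\<lambda>s. x + s *\<^sub>R v) has_derivative (\<lambda>t. t *\<^sub>R v)) (at s)" by (auto intro!: derivative_eq_intros)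
        from has_derivative_compose[OF this Cc1_has_derivative[OF \<phi>]]
        have "((\<lambda>s. \<phi> (x + s *\<^sub>R v)) has_derivative (\<lambda>t. frechet_derivative \<phi> (at (x + s *\<^sub>R v)) (t *\<^sub>R v))) (at s)" .
        moreover have "frechet_derivative \<phi> (at y) (t *\<^sub>R v) = ?D y * t" for y t
          using linear_scale[OF has_derivative_linear[OF Cc1_has_derivative[OF \<phi>]], of y t v] by (simp add: mult.commute)
        ultimately show ?thesis by (simp add: has_field_derivative_def)
      qed
      moreover have "isCont (\<lambda>s. ?D (x + s *\<^sub>R v)) s" for s
      proof -
        have "continuous_on UNIV (\<lambda>s. ?D (x + s *\<^sub>R v))"
          by (rule continuous_on_compose2[OF Cc1_continuous_derivative[OF \<phi>]]) (auto intro!: continuous_intros)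
        then show ?thesis by (simp add: continuous_on_eq_continuous_at)
      qed
      ultimately have "(\<integral>s. ?D (x + s *\<^sub>R v) * ?I s \<partial>lborel) = \<phi> (x + 1 *\<^sub>R v) - \<phi> (x + 0 *\<^sub>R v)"
        by (intro integral_FTC_Icc_real) auto
      then show ?thesis by simp
    qed
    obtain B where B: "0 \<le> B" "\<And>x. \<bar>?D x\<bar> \<le> B" using bounded_borel_bound[OF bD] by auto
    have Gint: "integrable (lborel \<Otimes>\<^sub>M lborel) (\<lambda>(x, s). g x * (?D (x + s *\<^sub>R v) * ?I s))"
    proof (rule integrable_pair_bound[where f = "\<lambda>x. B * g x" and h = ?I])
      show "\<bar>(\<lambda>(x, s). g x * (?D (x + s *\<^sub>R v) * ?I s)) (x, s)\<bar> \<le> \<bar>B * g x\<bar> * \<bar>?I s\<bar>" for x s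
        using mult_left_mono[OF B(2)[of "x + s *\<^sub>R v"], of "\<bar>g x\<bar>"] B(1) 
        by (auto simp: abs_mult indicator_def mult.commute)
    qed (use g in \<open>auto simp: lborel.sigma_finite_measure_axioms\<close>)
    have "(\<integral>x. g x * (\<phi> (x + v) - \<phi> x) \<partial>lborel) = (\<integral>x. \<integral>s. g x * (?D (x + s *\<^sub>R v) * ?I s) \<partial>lborel \<partial>lborel)"
      by (simp add: ftc)
    also have "\<dots> = (\<integral>s. \<integral>x. g x * (?D (x + s *\<^sub>R v) * ?I s) \<partial>lborel \<partial>lborel)"
      using lborel_pair.Fubini_integral[OF Gint] by simp
    also have "\<dots> = (\<integral>s. ?I s * (\<integral>x. g x * ?D (x + s *\<^sub>R v) \<partial>lborel) \<partial>lborel)"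
    proof (intro Bochner_Integration.integral_cong refl)
      fix s
      have "(\<integral>x. g x * (?D (x + s *\<^sub>R v) * ?I s) \<partial>lborel) = (\<integral>x. ?I s * (g x * ?D (x + s *\<^sub>R v)) \<partial>lborel)"
        by (intro Bochner_Integration.integral_cong) auto
      then show "(\<integral>x. g x * (?D (x + s *\<^sub>R v) * ?I s) \<partial>lborel) = ?I s * (\<integral>x. g x * ?D (x + s *\<^sub>R v) \<partial>lborel)"
        by simp
    qed
    \<comment> \<open>For fixed \<open>s\<close> this is integration by parts against the translate
      of \<phi> by \<open>s *\<^sub>R v\<close>.\<close>
    also have "\<dots> = (\<integral>s. ?I s * (- (\<integral>x. \<phi> (x + s *\<^sub>R v) * (v \<bullet> \<sigma> x) \<partial>\<mu>)) \<partial>lborel)"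
    proof (intro Bochner_Integration.integral_cong refl arg_cong2[where f = "(*)"])
      fix s
      have "(\<integral>x. g x * ?D (x + s *\<^sub>R v) \<partial>lborel) = (\<integral>x. u x * ?D (x + s *\<^sub>R v) \<partial>lebesgue)"
        by (rule g(3)[symmetric]) measurable
      also have "\<dots> = - (\<integral>x. \<phi> (x + s *\<^sub>R v) * (v \<bullet> \<sigma> x) \<partial>\<mu>)"
        using grad_measure_Cc1[OF u(1) Cc1_translate[OF \<phi>, of "s *\<^sub>R v"], of v]
        by (simp add: frechet_derivative_translate[OF \<phi>])
      finally show "(\<integral>x. g x * ?D (x + s *\<^sub>R v) \<partial>lborel) = - (\<integral>x. \<phi> (x + s *\<^sub>R v) * (v \<bullet> \<sigma> x) \<partial>\<mu>)" .
    qed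
    also have "\<dots> = - (\<integral>s. ?I s * (\<integral>x. \<phi> (x + s *\<^sub>R v) * (v \<bullet> \<sigma> x) \<partial>\<mu>) \<partial>lborel)"
      by simp
    also have "\<dots> = - (\<integral>s. \<integral>x. \<phi> (x + s *\<^sub>R v) * (?I s * (v \<bullet> \<sigma> x)) \<partial>\<mu> \<partial>lborel)"
      by (simp add: mult.left_commute)
    also have "\<dots> = - S \<phi>"
      unfolding S_def using P.integral_snd[of "\<lambda>x s. \<phi> (x + s *\<^sub>R v) * (?I s * (v \<bullet> \<sigma> x))"] Sint[OF b\<phi>]
      by (simp add: split_beta')
    finally have 1: "(\<integral>x. g x * (\<phi> (x + v) - \<phi> x) \<partial>lborel) = - S \<phi>" .
    have "(\<integral>x. g x * (\<phi> (x + v) - \<phi> x) \<partial>lborel) = (\<integral>x. \<phi> (x + v) * g x - \<phi> x * g x \<partial>lborel)"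
      by (simp add: algebra_simps)
    also have "\<dots> = (\<integral>x. \<phi> (x + v) * g x \<partial>lborel) - (\<integral>x. \<phi> x * g x \<partial>lborel)"
      using gint[OF b\<phi>, of v] gint[OF b\<phi>, of 0] by simp
    finally show "T \<phi> = 0" using 1 by (simp add: T_def)
  qed
  have [measurable]: "\<phi> \<in> borel_measurable borel" using bounded_borel_measurable[OF \<phi>] .
  have "(\<integral>x. u x * (\<phi> (x + v) - \<phi> x) \<partial>lebesgue) = (\<integral>x. g x * (\<phi> (x + v) - \<phi> x) \<partial>lborel)"
    by (intro g(3)) measurable
  also have "\<dots> = (\<integral>x. \<phi> (x + v) * g x - \<phi> x * g x \<partial>lborel)"
    by (simp add: algebra_simps)
  also have "\<dots> = (\<integral>x. \<phi> (x + v) * g x \<partial>lborel) - (\<integral>x. \<phi> x * g x \<partial>lborel)"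
    using gint[OF \<phi>, of v] gint[OF \<phi>, of 0] by simp
  also have "\<dots> = - S \<phi>" using \<open>T \<phi> = 0\<close> by (simp add: T_def)
  finally show ?thesis using Sfst[OF \<phi>] by simp
qed

lemma grad_measure_shift_le:
  fixes u :: "real^'d \<Rightarrow> real"
  assumes u: "grad_measure u \<mu> \<sigma>" "integrable lebesgue u" and \<phi>: "\<phi> \<in> borel_measurable borel" "\<And>x. \<bar>\<phi> x\<bar> \<le> 1"
    and A: "A \<in> sets borel" "\<And>x s. x \<notin> A \<Longrightarrow> 0 \<le> s \<Longrightarrow> s \<le> 1 \<Longrightarrow> \<phi> (x + s *\<^sub>R v) = 0"
  shows "\<bar>\<integral>x. u x * (\<phi> (x + v) - \<phi> x) \<partial>lebesgue\<bar> \<le> norm v * measure \<mu> A"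
proof -
  have b: "bounded_borel \<phi>" using \<phi> by (intro bounded_borelI) auto
  have "\<bar>\<integral>x. (line_avg \<phi> v x *\<^sub>R v) \<bullet> \<sigma> x \<partial>\<mu>\<bar> \<le> norm v * measure \<mu> A"
  proof (rule polar_integral_le[OF grad_measure_polar[OF u(1)] _ A(1)])
    show "bounded_borel (\<lambda>x. line_avg \<phi> v x *\<^sub>R v)"
      by (intro bounded_borel_scaleR bounded_borel_line_avg b bounded_borel_const)
    fix x show "norm (line_avg \<phi> v x *\<^sub>R v) \<le> norm v * indicator A x"
    proof (cases "x \<in> A")
      case True
      have "\<bar>line_avg \<phi> v x\<bar> \<le> 1" by (rule line_avg_le[OF b]) (use \<phi> in auto)
      then show ?thesis using True mult_right_mono[of "\<bar>line_avg \<phi> v x\<bar>" 1 "norm v"] by simp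
    next
      case False
      then have "line_avg \<phi> v x = 0" by (intro line_avg_const A(2))
      then show ?thesis by simp
    qed
  qed
  then show ?thesis by (simp add: grad_measure_shift[OF u b])
qed

section \<open>Jump points\<close>

lemma half_ball_borel [measurable]: "half_ball x \<nu> \<rho> \<in> sets borel"
  unfolding half_ball_def by measurable

lemma set_integral_lebesgue_indicator:
  "(\<integral>y\<in>A. f y \<partial>lebesgue) = (\<integral>y. f y * indicator A y \<partial>lebesgue :: real)"
  by (simp add: set_lebesgue_integral_def mult.commute)

text \<open>Gradient and jump set are both defined through integrals over Lebesgue measure, so a
  change on a null set does not affect them.\<close>

lemma BV_borel_version:
  fixes u :: "real^'d \<Rightarrow> real"
  assumes u: "integrable lebesgue u"
  shows "\<exists>g. g \<in> borel_measurable borel \<and> integrable lborel g \<and>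
    (\<forall>\<mu> \<sigma>. grad_measure u \<mu> \<sigma> \<longrightarrow> grad_measure g \<mu> \<sigma>) \<and> jump_set g = jump_set u \<and>
    (\<forall>\<psi>\<in>borel_measurable borel. (\<integral>x. u x * \<psi> x \<partial>lebesgue) = (\<integral>x. g x * \<psi> x \<partial>lborel))"
proof -
  obtain g where g: "g \<in> borel_measurable borel" "integrable lborel g" "AE x in lborel. u x = g x"
    "\<And>\<psi>. \<psi> \<in> borel_measurable borel \<Longrightarrow> (\<integral>x. u x * \<psi> x \<partial>lebesgue) = (\<integral>x. g x * \<psi> x \<partial>lborel)"
    using lebesgue_integrable_borel_version[OF u] by auto
  have ae: "AE x in lebesgue. u x = g x" using g(3) by (rule AE_completion)
  have gl: "g \<in> borel_measurable lebesgue" using g(1) by (simp add: measurable_completion)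
  have [measurable]: "u \<in> borel_measurable lebesgue" "g \<in> borel_measurable lebesgue"
    using gl borel_measurable_integrable[OF u] by auto
  have eq: "(\<integral>x. u x * \<psi> x \<partial>lebesgue) = (\<integral>x. g x * \<psi> x \<partial>lebesgue)" if "\<psi> \<in> borel_measurable borel" for \<psi>
  proof (rule integral_cong_AE)
    have [measurable]: "\<psi> \<in> borel_measurable lebesgue" using that by (simp add: measurable_completion)
    show "(\<lambda>x. u x * \<psi> x) \<in> borel_measurable lebesgue" "(\<lambda>x. g x * \<psi> x) \<in> borel_measurable lebesgue"
      by measurable
    show "AE x in lebesgue. u x * \<psi> x = g x * \<psi> x" using ae by eventually_elim simp
  qed
  have eq2: "(\<integral>x. \<bar>u x - c\<bar> * indicator A x \<partial>lebesgue) = (\<integral>x. \<bar>g x - c\<bar> * indicator A x \<partial>lebesgue)"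
    if "A \<in> sets borel" for A c
  proof (rule integral_cong_AE)
    have "(indicator A :: _ \<Rightarrow> real) \<in> borel_measurable lborel" using that by simp
    then have [measurable]: "(indicator A :: _ \<Rightarrow> real) \<in> borel_measurable lebesgue" by (rule measurable_completion)
    show "(\<lambda>x. \<bar>u x - c\<bar> * indicator A x) \<in> borel_measurable lebesgue" "(\<lambda>x. \<bar>g x - c\<bar> * indicator A x) \<in> borel_measurable lebesgue"
      by measurable
    show "AE x in lebesgue. \<bar>u x - c\<bar> * indicator A x = \<bar>g x - c\<bar> * indicator A x" using ae by eventually_elim simp
  qed
  have "grad_measure g \<mu> \<sigma>" if "grad_measure u \<mu> \<sigma>" for \<mu> \<sigma>
  proof (rule grad_measureI[OF grad_measure_polar[OF that]])
    fix \<phi> :: "real^'d \<Rightarrow> real^'d" assume \<phi>: "Cc1_field \<phi>"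
    show "(\<integral>x. g x * divergence \<phi> x \<partial>lebesgue) = - (\<integral>x. \<phi> x \<bullet> \<sigma> x \<partial>\<mu>)"
      using grad_measure_eq[OF that \<phi>] eq[OF bounded_borel_measurable[OF bounded_borel_divergence[OF \<phi>]]] by simp
  qed
  moreover have "jump_set g = jump_set u"
    unfolding jump_set_def set_integral_lebesgue_indicator eq2[OF half_ball_borel] ..
  ultimately show ?thesis using g by blast
qed

text \<open>The unnormalised deviation on a half ball. Unlike the mean it is monotone in the radius,
  which later allows passing to dyadic radii.\<close>

definition half_dev :: "(real^'d \<Rightarrow> real) \<Rightarrow> real^'d \<Rightarrow> real^'d \<Rightarrow> real \<Rightarrow> real \<Rightarrow> real" where
  "half_dev g x \<nu> a \<rho> = (\<integral>y. \<bar>g y - a\<bar> * indicator (half_ball x \<nu> \<rho>) y \<partial>lborel)"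

section \<open>Half balls and their volume\<close>

lemma half_ball_subset: "half_ball x \<nu> \<rho> \<subseteq> ball x \<rho>"
  by (auto simp: half_ball_def)

lemma emeasure_half_ball_finite: "emeasure lborel (half_ball x \<nu> \<rho>) < \<infinity>"
proof -
  have "emeasure lborel (half_ball x \<nu> \<rho>) \<le> emeasure lborel (ball x \<rho>)"
    by (rule emeasure_mono[OF half_ball_subset]) simp
  also have "\<dots> < \<infinity>" by (rule emeasure_lborel_ball_finite)
  finally show ?thesis .
qed

lemma half_ball_mono: "\<rho> \<le> \<rho>' \<Longrightarrow> half_ball x \<nu> \<rho> \<subseteq> half_ball x \<nu> \<rho>'"
  by (auto simp: half_ball_def)

text \<open>The inscribed ball has two uses: it bounds the volume of the half ball from below, and
  the inscribed balls of the two opposite halves are translates of each other by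
  \<open>\<rho> *\<^sub>R \<nu>\<close>.\<close>

lemma ball_subset_half_ball:
  fixes x \<nu> :: "real^'d"
  assumes "norm \<nu> = 1" "0 < \<rho>"
  shows "ball (x + (\<rho>/2) *\<^sub>R \<nu>) (\<rho>/4) \<subseteq> half_ball x \<nu> \<rho>"
proof
  fix y assume "y \<in> ball (x + (\<rho>/2) *\<^sub>R \<nu>) (\<rho>/4)"
  then have d: "norm (y - x - (\<rho>/2) *\<^sub>R \<nu>) < \<rho>/4"
    by (simp add: dist_norm norm_minus_commute algebra_simps)
  have "norm (y - x) \<le> norm (y - x - (\<rho>/2) *\<^sub>R \<nu>) + norm ((\<rho>/2) *\<^sub>R \<nu>)"
    by (metis diff_add_cancel norm_triangle_ineq)
  then have 1: "norm (y - x) < \<rho>" using d assms by simp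
  have "\<nu> \<bullet> \<nu> = 1" using assms by (simp add: norm_eq_sqrt_inner)
  then have "(y - x) \<bullet> \<nu> = (y - x - (\<rho>/2) *\<^sub>R \<nu>) \<bullet> \<nu> + \<rho>/2"
    by (simp add: inner_diff_left)
  moreover have "\<bar>(y - x - (\<rho>/2) *\<^sub>R \<nu>) \<bullet> \<nu>\<bar> < \<rho>/4"
    using Cauchy_Schwarz_ineq2[of "y - x - (\<rho>/2) *\<^sub>R \<nu>" \<nu>] d assms by simp
  ultimately have "(y - x) \<bullet> \<nu> > 0" using assms by linarith
  with 1 show "y \<in> half_ball x \<nu> \<rho>" by (simp add: half_ball_def dist_norm norm_minus_commute)
qed

lemma measure_ball_scale:
  fixes x :: "'a::euclidean_space"
  assumes "0 \<le> r" shows "measure lborel (ball x r) = r ^ DIM('a) * unit_ball_vol (real DIM('a))"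
  using content_ball[OF assms, of x] by simp

lemma half_ball_measure:
  fixes x \<nu> :: "real^'d"
  assumes "norm \<nu> = 1" "0 < \<rho>"
  shows "measure lborel (half_ball x \<nu> \<rho>) \<le> \<rho> ^ CARD('d) * unit_ball_vol (real CARD('d))"
    and "(\<rho>/4) ^ CARD('d) * unit_ball_vol (real CARD('d)) \<le> measure lborel (half_ball x \<nu> \<rho>)"
proof -
  have fm: "half_ball x \<nu> \<rho> \<in> fmeasurable lborel"
    by (rule fmeasurableI) (use emeasure_half_ball_finite[of x \<nu> \<rho>] in auto)
  have "measure lborel (half_ball x \<nu> \<rho>) \<le> measure lborel (ball x \<rho>)"
    by (rule measure_mono_fmeasurable[OF half_ball_subset])
      (use emeasure_lborel_ball_finite[of x \<rho>] in \<open>auto intro!: fmeasurableI\<close>)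
  then show "measure lborel (half_ball x \<nu> \<rho>) \<le> \<rho> ^ CARD('d) * unit_ball_vol (real CARD('d))"
    using measure_ball_scale[of \<rho> x] assms by simp
  have "measure lborel (ball (x + (\<rho>/2) *\<^sub>R \<nu>) (\<rho>/4)) \<le> measure lborel (half_ball x \<nu> \<rho>)"
    by (rule measure_mono_fmeasurable[OF ball_subset_half_ball[OF assms]]) (auto simp: fm)
  then show "(\<rho>/4) ^ CARD('d) * unit_ball_vol (real CARD('d)) \<le> measure lborel (half_ball x \<nu> \<rho>)"
    using measure_ball_scale[of "\<rho>/4" "x + (\<rho>/2) *\<^sub>R \<nu>"] assms by simp
qed

lemma half_dev_integrable:
  fixes x \<nu> :: "real^'d" and g :: "real^'d \<Rightarrow> real"
  assumes g: "integrable lborel g"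
  shows "integrable lborel (\<lambda>y. \<bar>g y - c\<bar> * indicator (half_ball x \<nu> r) y)"
proof -
  note hf = emeasure_half_ball_finite[of x \<nu> r]
  have "integrable lborel (\<lambda>y. \<bar>g y * indicator (half_ball x \<nu> r) y - c * indicator (half_ball x \<nu> r) y\<bar>)"
    using integrable_mult_indicator[of "half_ball x \<nu> r" lborel g] g hf
    by (intro integrable_abs Bochner_Integration.integrable_diff integrable_mult_right) (auto simp: mult.commute)
  then show ?thesis by (rule Bochner_Integration.integrable_cong[THEN iffD1, rotated 2]) (auto simp: indicator_def)
qed

lemma half_dev_nonneg: "0 \<le> half_dev g x \<nu> a \<rho>"
  unfolding half_dev_def by (rule integral_nonneg_AE) auto

text \<open>The volume of a half ball lies between two multiples of the \<open>d\<close>-th power of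
  the radius, so either normalisation gives the same limit.\<close>

lemma half_avg_tendsto_iff:
  fixes x \<nu> :: "real^'d"
  assumes g: "g \<in> borel_measurable borel" and \<nu>: "norm \<nu> = 1"
  shows "((\<lambda>\<rho>. (\<integral>y\<in>half_ball x \<nu> \<rho>. \<bar>g y - a\<bar> \<partial>lebesgue) / measure lebesgue (half_ball x \<nu> \<rho>)) \<longlongrightarrow> 0) (at_right 0)
     \<longleftrightarrow> ((\<lambda>\<rho>. half_dev g x \<nu> a \<rho> / \<rho> ^ CARD('d)) \<longlongrightarrow> 0) (at_right 0)"
proof -
  let ?V = "unit_ball_vol (real CARD('d))" and ?d = "CARD('d)"
  let ?m = "\<lambda>\<rho>. measure lborel (half_ball x \<nu> \<rho>)" and ?h = "half_dev g x \<nu> a"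
  have V: "0 < ?V" by simp
  have eq: "(\<integral>y\<in>half_ball x \<nu> \<rho>. \<bar>g y - a\<bar> \<partial>lebesgue) / measure lebesgue (half_ball x \<nu> \<rho>) = ?h \<rho> / ?m \<rho>" for \<rho>
  proof -
    have "(\<lambda>y. \<bar>g y - a\<bar> * indicator (half_ball x \<nu> \<rho>) y) \<in> borel_measurable lborel" using g by simp
    from integral_completion[OF this] show ?thesis
      unfolding set_integral_lebesgue_indicator half_dev_def by (simp add: measure_completion)
  qed
  have pos: "eventually (\<lambda>\<rho>::real. 0 < \<rho>) (at_right 0)" by (simp add: eventually_at_right_less)
  have b1: "eventually (\<lambda>\<rho>. norm (?h \<rho> / \<rho> ^ ?d) \<le> norm (?h \<rho> / ?m \<rho>) * ?V) (at_right 0)"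
    using pos
  proof eventually_elim
    case (elim \<rho>)
    have m: "0 < ?m \<rho>" using half_ball_measure(2)[OF \<nu> elim, of x] V elim
      by (smt (verit) divide_pos_pos mult_pos_pos zero_less_power)
    have "?h \<rho> * ?m \<rho> \<le> ?h \<rho> * (\<rho> ^ ?d * ?V)"
      by (intro mult_left_mono half_ball_measure(1) half_dev_nonneg \<nu> elim)
    then show ?case using m elim half_dev_nonneg[of g x \<nu> a \<rho>] by (simp add: field_simps)
  qed
  have b2: "eventually (\<lambda>\<rho>. norm (?h \<rho> / ?m \<rho>) \<le> norm (?h \<rho> / \<rho> ^ ?d) * (4 ^ ?d / ?V)) (at_right 0)"
    using pos
  proof eventually_elim
    case (elim \<rho>)
    have m: "0 < ?m \<rho>" using half_ball_measure(2)[OF \<nu> elim, of x] V elim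
      by (smt (verit) divide_pos_pos mult_pos_pos zero_less_power)
    have "?h \<rho> * ((\<rho>/4) ^ ?d * ?V) \<le> ?h \<rho> * ?m \<rho>"
      by (intro mult_left_mono half_ball_measure(2) half_dev_nonneg \<nu> elim)
    then show ?case using m elim V half_dev_nonneg[of g x \<nu> a \<rho>] by (simp add: field_simps power_divide)
  qed
  show ?thesis unfolding eq
    using tendsto_0_le[OF _ b1] tendsto_0_le[OF _ b2] by blast
qed

lemma jump_set_iff:
  fixes g :: "real^'d \<Rightarrow> real"
  assumes g: "g \<in> borel_measurable borel"
  shows "x \<in> jump_set g \<longleftrightarrow> (\<exists>a b \<nu>. a \<noteq> b \<and> norm \<nu> = 1 \<and>
    ((\<lambda>\<rho>. (half_dev g x \<nu> a \<rho> + half_dev g x (-\<nu>) b \<rho>) / \<rho> ^ CARD('d)) \<longlongrightarrow> 0) (at_right 0))"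
proof -
  have "((\<lambda>\<rho>. half_dev g x \<nu> a \<rho> / \<rho> ^ CARD('d)) \<longlongrightarrow> 0) (at_right 0) \<and>
      ((\<lambda>\<rho>. half_dev g x (-\<nu>) b \<rho> / \<rho> ^ CARD('d)) \<longlongrightarrow> 0) (at_right 0) \<longleftrightarrow>
    ((\<lambda>\<rho>. (half_dev g x \<nu> a \<rho> + half_dev g x (-\<nu>) b \<rho>) / \<rho> ^ CARD('d)) \<longlongrightarrow> 0) (at_right 0)" 
    (is "?A \<and> ?B \<longleftrightarrow> ?C") for a b \<nu>
  proof
    assume "?A \<and> ?B" then show ?C
      using tendsto_add[of "\<lambda>\<rho>. half_dev g x \<nu> a \<rho> / \<rho> ^ CARD('d)" 0 "at_right 0"
        "\<lambda>\<rho>. half_dev g x (-\<nu>) b \<rho> / \<rho> ^ CARD('d)" 0] by (simp add: add_divide_distrib)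
  next
    assume C: ?C
    have pos: "eventually (\<lambda>\<rho>::real. 0 < \<rho>) (at_right 0)" by (simp add: eventually_at_right_less)
    have ?A
      by (rule tendsto_0_le[OF C, where K = 1]) 
        (use half_dev_nonneg[of g x \<nu> a] half_dev_nonneg[of g x "-\<nu>" b] pos in \<open>auto elim!: eventually_mono intro!: divide_right_mono\<close>)
    moreover have ?B
      by (rule tendsto_0_le[OF C, where K = 1]) 
        (use half_dev_nonneg[of g x \<nu> a] half_dev_nonneg[of g x "-\<nu>" b] pos in \<open>auto elim!: eventually_mono intro!: divide_right_mono\<close>)
    ultimately show "?A \<and> ?B" ..
  qed
  note key = this
  have "(a \<noteq> b \<and> norm \<nu> = 1 \<and>
      ((\<lambda>\<rho>. (\<integral>y\<in>half_ball x \<nu> \<rho>. \<bar>g y - a\<bar> \<partial>lebesgue) / measure lebesgue (half_ball x \<nu> \<rho>)) \<longlongrightarrow> 0) (at_right 0) \<and>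
      ((\<lambda>\<rho>. (\<integral>y\<in>half_ball x (-\<nu>) \<rho>. \<bar>g y - b\<bar> \<partial>lebesgue) / measure lebesgue (half_ball x (-\<nu>) \<rho>)) \<longlongrightarrow> 0) (at_right 0))
    \<longleftrightarrow> (a \<noteq> b \<and> norm \<nu> = 1 \<and>
    ((\<lambda>\<rho>. (half_dev g x \<nu> a \<rho> + half_dev g x (-\<nu>) b \<rho>) / \<rho> ^ CARD('d)) \<longlongrightarrow> 0) (at_right 0))" for a b \<nu>
    using half_avg_tendsto_iff[OF g, of \<nu> x a] half_avg_tendsto_iff[OF g, of "-\<nu>" x b]
    unfolding key[symmetric] norm_minus_cancel by blast
  then show ?thesis
    unfolding jump_set_def mem_Collect_eq by presburger
qed

text \<open>On the inscribed balls \<open>P\<close> and \<open>N\<close> of the two halves,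
  \<open>g\<close> is close in the mean to \<open>a\<close> and to \<open>b\<close>, so its
  integrals over them differ by about |a - b| times their common volume, which is of order r^d.
  Since \<open>P\<close> is \<open>N\<close> moved by \<open>r *\<^sub>R \<nu>\<close>, the shift
  formula bounds this difference by \<open>r\<close> times the mass of the gradient in the
  ball.\<close>

lemma jump_set_density:
  fixes g :: "real^'d \<Rightarrow> real"
  assumes g: "g \<in> borel_measurable borel" "integrable lborel g" and \<mu>: "grad_measure g \<mu> \<sigma>" and x: "x \<in> jump_set g"
  shows "\<exists>c>0. \<exists>r0>0. \<forall>r. 0 < r \<and> r < r0 \<longrightarrow> c * r ^ (CARD('d) - 1) \<le> measure \<mu> (ball x r)"
proof -
  let ?d = "CARD('d)" and ?V = "unit_ball_vol (real CARD('d))"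
  obtain a b \<nu> where ab: "a \<noteq> b" "norm \<nu> = 1"
    "((\<lambda>\<rho>. (half_dev g x \<nu> a \<rho> + half_dev g x (-\<nu>) b \<rho>) / \<rho> ^ ?d) \<longlongrightarrow> 0) (at_right 0)"
    using x jump_set_iff[OF g(1)] by blast
  \<comment> \<open>Chosen so that |a - b| times the volume of the inscribed ball is
    \<open>2 * \<epsilon> * r ^ d\<close>. The two deviations together use up at most one
    half.\<close>
  define \<epsilon> where "\<epsilon> = \<bar>a - b\<bar> * ?V / (2 * 4 ^ ?d)"
  have \<epsilon>: "0 < \<epsilon>" using ab by (simp add: \<epsilon>_def)
  have "eventually (\<lambda>\<rho>. (half_dev g x \<nu> a \<rho> + half_dev g x (-\<nu>) b \<rho>) / \<rho> ^ ?d < \<epsilon>) (at_right 0)"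
    using order_tendstoD(2)[OF ab(3) \<epsilon>] .
  then obtain r0 where r0: "0 < r0" "\<And>\<rho>. 0 < \<rho> \<Longrightarrow> \<rho> < r0 \<Longrightarrow> (half_dev g x \<nu> a \<rho> + half_dev g x (-\<nu>) b \<rho>) / \<rho> ^ ?d < \<epsilon>"
    unfolding eventually_at_right_field by blast
  have gi: "integrable lebesgue g" using integrable_completion[of g lborel] g by simp
  have "\<epsilon> * r ^ (?d - 1) \<le> measure \<mu> (ball x r)" if r: "0 < r" "r < r0" for r
  proof -
    define P where "P = ball (x + (r/2) *\<^sub>R \<nu>) (r/4)"
    define N where "N = ball (x + (r/2) *\<^sub>R (-\<nu>)) (r/4)"
    have P: "P \<subseteq> half_ball x \<nu> r" unfolding P_def by (rule ball_subset_half_ball) (use ab r in auto)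
    have N: "N \<subseteq> half_ball x (-\<nu>) r" unfolding N_def by (rule ball_subset_half_ball) (use ab r in auto)
    have mP: "measure lborel P = (r/4) ^ ?d * ?V" and mN: "measure lborel N = (r/4) ^ ?d * ?V"
      unfolding P_def N_def using measure_ball_scale[of "r/4" "x + (r/2) *\<^sub>R \<nu>"] measure_ball_scale[of "r/4" "x + (r/2) *\<^sub>R (-\<nu>)"] r by auto
    have [measurable]: "P \<in> sets borel" "N \<in> sets borel" by (auto simp: P_def N_def)
    have fin: "emeasure lborel P < \<infinity>" "emeasure lborel N < \<infinity>" unfolding P_def N_def using emeasure_lborel_ball_finite by auto
    have NP: "indicator P (y + r *\<^sub>R \<nu>) = (indicator N y :: real)" for y
    proof -
      have "dist (x + (r/2) *\<^sub>R \<nu>) (y + r *\<^sub>R \<nu>) = dist (x + (r/2) *\<^sub>R (-\<nu>)) y"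
      proof -
        define h where "h = (r/2) *\<^sub>R \<nu>"
        have "r *\<^sub>R \<nu> = h + h" by (simp add: h_def flip: scaleR_add_left)
        then have "x + h - (y + r *\<^sub>R \<nu>) = x + (r/2) *\<^sub>R (-\<nu>) - y" by (simp add: h_def[symmetric])
        then have "x + (r/2) *\<^sub>R \<nu> - (y + r *\<^sub>R \<nu>) = x + (r/2) *\<^sub>R (-\<nu>) - y" by (simp only: h_def)
        then show ?thesis unfolding dist_norm by (simp only:)
      qed
      then show ?thesis by (simp add: P_def N_def indicator_def)
    qed
    have dev: "\<bar>(\<integral>y. g y * indicator S y \<partial>lborel) - c * measure lborel S\<bar> \<le> half_dev g x n c r"
      if S: "S \<subseteq> half_ball x n r" "S \<in> sets borel" "emeasure lborel S < \<infinity>" for S c n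
    proof -
      have i1: "integrable lborel (\<lambda>y. g y * indicator S y)"
        using integrable_mult_indicator[of S lborel g] g S by (simp add: mult.commute)
      note i3 = half_dev_integrable[OF g(2), of c x n r]
      have "(\<integral>y. g y * indicator S y \<partial>lborel) - c * measure lborel S = (\<integral>y. g y * indicator S y - c * indicator S y \<partial>lborel)"
        using i1 S by (subst Bochner_Integration.integral_diff) auto
      also have "\<bar>\<dots>\<bar> \<le> (\<integral>y. \<bar>g y * indicator S y - c * indicator S y\<bar> \<partial>lborel)" by (rule integral_abs_bound)
      also have "\<dots> \<le> half_dev g x n c r"
        unfolding half_dev_def
      proof (rule integral_mono[OF _ i3])
        show "integrable lborel (\<lambda>y. \<bar>g y * indicator S y - c * indicator S y\<bar>)"
          using S by (intro integrable_abs Bochner_Integration.integrable_diff i1 integrable_mult_right integrable_real_indicator) auto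
      qed (use S in \<open>auto split: split_indicator\<close>)
      finally show ?thesis .
    qed
    have "(half_dev g x \<nu> a r + half_dev g x (-\<nu>) b r) / r ^ ?d < \<epsilon>" using r0 r by blast
    then have small: "half_dev g x \<nu> a r + half_dev g x (-\<nu>) b r \<le> \<epsilon> * r ^ ?d" using r by (simp add: field_simps)
    \<comment> \<open>A segment from \<open>y\<close> to \<open>y + r *\<^sub>R \<nu>\<close> can
      meet \<open>P\<close> only if \<open>y\<close> has distance less than r/4 + r/2 from
      \<open>x\<close>; hence only the mass in \<open>ball x r\<close> enters.\<close>
    have "\<bar>\<integral>y. g y * (indicator P (y + r *\<^sub>R \<nu>) - indicator P y) \<partial>lebesgue\<bar> \<le> norm (r *\<^sub>R \<nu>) * measure \<mu> (ball x r)"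
    proof (rule grad_measure_shift_le[OF \<mu> gi])
      fix y s assume y: "y \<notin> ball x r" and s: "0 \<le> s" "s \<le> (1::real)"
      show "indicator P (y + s *\<^sub>R r *\<^sub>R \<nu>) = (0::real)"
      proof (rule ccontr)
        assume "indicator P (y + s *\<^sub>R r *\<^sub>R \<nu>) \<noteq> (0::real)"
        then have "norm (x + (r/2) *\<^sub>R \<nu> - (y + s *\<^sub>R r *\<^sub>R \<nu>)) < r/4"
          by (auto simp: P_def dist_norm indicator_def split: if_splits)
        moreover have "norm (x - y) \<le> norm (x + (r/2) *\<^sub>R \<nu> - (y + s *\<^sub>R r *\<^sub>R \<nu>)) + \<bar>s * r - r/2\<bar>"
        proof -
          have "x - y = (x + (r/2) *\<^sub>R \<nu> - (y + s *\<^sub>R r *\<^sub>R \<nu>)) + (s * r - r/2) *\<^sub>R \<nu>"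
            by (simp add: algebra_simps)
          then have "norm (x - y) \<le> norm (x + (r/2) *\<^sub>R \<nu> - (y + s *\<^sub>R r *\<^sub>R \<nu>)) + norm ((s * r - r/2) *\<^sub>R \<nu>)"
            by (metis norm_triangle_ineq)
          then show ?thesis using ab(2) by (simp only: norm_scaleR mult_1_right)
        qed
        moreover have "\<bar>s * r - r/2\<bar> \<le> r/2"
          using mult_right_mono[OF s(2), of r] mult_nonneg_nonneg[OF s(1), of r] r
          unfolding abs_le_iff by linarith
        ultimately have "norm (x - y) < r" using r by linarith
        with y show False by (simp add: dist_norm)
      qed
    qed (auto simp: indicator_def)
    also have "(\<integral>y. g y * (indicator P (y + r *\<^sub>R \<nu>) - indicator P y) \<partial>lebesgue) =
        (\<integral>y. g y * (indicator P (y + r *\<^sub>R \<nu>) - indicator P y) \<partial>lborel)"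
      by (rule integral_completion) (use g in measurable)
    also have "\<dots> = (\<integral>y. g y * indicator N y - g y * indicator P y \<partial>lborel)"
      by (simp add: NP algebra_simps)
    also have "\<dots> = (\<integral>y. g y * indicator N y \<partial>lborel) - (\<integral>y. g y * indicator P y \<partial>lborel)"
      using integrable_mult_indicator[of P lborel g] integrable_mult_indicator[of N lborel g] g
      by (subst Bochner_Integration.integral_diff) (auto simp: mult.commute)
    finally have "\<bar>(\<integral>y. g y * indicator N y \<partial>lborel) - (\<integral>y. g y * indicator P y \<partial>lborel)\<bar> \<le> r * measure \<mu> (ball x r)"
      using r ab by simp
    moreover have "\<bar>b * measure lborel N - a * measure lborel P\<bar> = 2 * \<epsilon> * r ^ ?d"
    proof -
      have "\<bar>b * measure lborel N - a * measure lborel P\<bar> = \<bar>(b - a) * ((r/4) ^ ?d * ?V)\<bar>"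
        unfolding mP mN by (simp add: algebra_simps)
      also have "\<dots> = \<bar>a - b\<bar> * ((r/4) ^ ?d * ?V)"
        using r by (simp add: abs_mult abs_minus_commute)
      finally show ?thesis unfolding \<epsilon>_def using r by (simp add: power_divide field_simps)
    qed
    ultimately have "\<epsilon> * r ^ ?d \<le> r * measure \<mu> (ball x r)"
      using dev[OF P _ fin(1), of a] dev[OF N _ fin(2), of b] small by (auto simp: abs_le_iff)
    moreover have "r ^ ?d = r * r ^ (?d - 1)"
      by (metis Suc_diff_1 power_Suc zero_less_card_finite)
    ultimately show ?thesis using r by (simp add: mult.left_commute)
  qed
  then show ?thesis using r0(1) \<epsilon> by blast
qed

text \<open>The test function is the sign of the difference itself, with the translation moved onto
  it by a change of variables; the shift formula admits it although it is discontinuous.\<close>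

lemma grad_measure_translation_le:
  fixes g :: "real^'d \<Rightarrow> real"
  assumes g: "g \<in> borel_measurable borel" "integrable lborel g" and \<mu>: "grad_measure g \<mu> \<sigma>"
  shows "(\<integral>x. \<bar>g (x + v) - g x\<bar> \<partial>lborel) \<le> norm v * measure \<mu> UNIV"
proof -
  note [measurable] = g(1)
  define \<phi> where "\<phi> x = sgn (g (x + v) - g x)" for x
  have [measurable]: "\<phi> \<in> borel_measurable borel"
    unfolding \<phi>_def[abs_def] by measurable
  have \<phi>1: "\<bar>\<phi> x\<bar> \<le> 1" for x by (simp add: \<phi>_def sgn_if)
  have gi: "integrable lebesgue g" using integrable_completion[of g lborel] g by simp
  have int: "integrable lborel (\<lambda>x. g (x + a) * \<phi> (x + b))" for a b
  proof (rule Bochner_Integration.integrable_bound[OF lborel_integrable_shift[OF g(2), of a]])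
    show "AE x in lborel. norm (g (x + a) * \<phi> (x + b)) \<le> norm (g (x + a))"
      using mult_left_le[OF \<phi>1] by (auto simp: abs_mult)
  qed measurable
  have "(\<integral>x. \<bar>g (x + v) - g x\<bar> \<partial>lborel) = (\<integral>x. g (x + v) * \<phi> (x + 0) - g (x + 0) * \<phi> (x + 0) \<partial>lborel)"
    by (intro Bochner_Integration.integral_cong) (auto simp: \<phi>_def sgn_if)
  also have "\<dots> = (\<integral>x. g (x + v) * \<phi> (x + 0) \<partial>lborel) - (\<integral>x. g (x + 0) * \<phi> (x + 0) \<partial>lborel)"
    by (rule Bochner_Integration.integral_diff[OF int int])
  also have "(\<integral>x. g (x + v) * \<phi> (x + 0) \<partial>lborel) = (\<integral>x. g (x + 0) * \<phi> (x + (- v)) \<partial>lborel)"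
    using lborel_integral_shift[of "\<lambda>x. g (x + 0) * \<phi> (x + (- v))" v] by simp
  also have "\<dots> - (\<integral>x. g (x + 0) * \<phi> (x + 0) \<partial>lborel) = (\<integral>x. g (x + 0) * \<phi> (x + (-v)) - g (x + 0) * \<phi> (x + 0) \<partial>lborel)"
    by (rule Bochner_Integration.integral_diff[OF int int, symmetric])
  also have "\<dots> = (\<integral>x. g x * (\<phi> (x + (-v)) - \<phi> x) \<partial>lborel)"
    by (simp add: algebra_simps)
  also have "\<dots> = (\<integral>x. g x * (\<phi> (x + (-v)) - \<phi> x) \<partial>lebesgue)"
    by (rule integral_completion[symmetric]) measurable
  also have "\<dots> \<le> norm (-v) * measure \<mu> UNIV"
    using grad_measure_shift_le[OF \<mu> gi, of \<phi> UNIV "-v"] \<phi>1 by (auto simp: abs_le_iff)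
  finally show ?thesis by simp
qed

section \<open>The jump set is Borel\<close>

lemma ball_in_sets_borel [measurable]: "ball (x::'a::metric_space) r \<in> sets borel"
  by simp

lemma lborel_integral_affine:
  fixes f :: "'a::euclidean_space \<Rightarrow> real"
  assumes f: "f \<in> borel_measurable borel" and c: "0 < c"
  shows "(\<integral>x. f x \<partial>lborel) = c ^ DIM('a) * (\<integral>x. f (t + c *\<^sub>R x) \<partial>lborel)"
proof -
  have "(\<integral>x. f x \<partial>lborel) = (\<integral>x. f x \<partial>density (distr lborel borel (\<lambda>x. t + c *\<^sub>R x)) (\<lambda>_. \<bar>c\<bar>^DIM('a)))"
    using lborel_affine[of c t] c by simp
  also have "\<dots> = (\<integral>x. \<bar>c\<bar>^DIM('a) *\<^sub>R f x \<partial>distr lborel borel (\<lambda>x. t + c *\<^sub>R x))"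
    by (rule integral_density) (use f in auto)
  also have "\<dots> = (\<integral>x. \<bar>c\<bar>^DIM('a) *\<^sub>R f (t + c *\<^sub>R x) \<partial>lborel)"
    by (rule integral_distr) (use f in auto)
  finally show ?thesis using c by simp
qed

text \<open>Monotonicity controls all radii between two consecutive dyadic ones, at the cost of a
  factor 2^d. It turns a limit over all radii into countably many conditions.\<close>

lemma tendsto_at_right_dyadic:
  fixes h :: "real \<Rightarrow> real"
  assumes mono: "\<And>r s. 0 < r \<Longrightarrow> r \<le> s \<Longrightarrow> h r \<le> h s" and nn: "\<And>r. 0 \<le> h r"
  shows "((\<lambda>\<rho>. h \<rho> / \<rho> ^ d) \<longlongrightarrow> 0) (at_right 0) \<longleftrightarrow> (\<lambda>i. h ((1/2)^i) / ((1/2)^i) ^ d) \<longlonglongrightarrow> 0"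
proof
  assume "((\<lambda>\<rho>. h \<rho> / \<rho> ^ d) \<longlongrightarrow> 0) (at_right 0)"
  moreover have "filterlim (\<lambda>i. (1/2::real)^i) (at_right 0) sequentially"
    unfolding filterlim_at by (auto intro!: LIMSEQ_realpow_zero)
  ultimately show "(\<lambda>i. h ((1/2)^i) / ((1/2)^i) ^ d) \<longlonglongrightarrow> 0"
    by (rule filterlim_compose)
next
  assume L: "(\<lambda>i. h ((1/2)^i) / ((1/2)^i) ^ d) \<longlonglongrightarrow> 0"
  show "((\<lambda>\<rho>. h \<rho> / \<rho> ^ d) \<longlongrightarrow> 0) (at_right 0)"
  proof (rule tendstoI)
    fix e :: real assume e: "0 < e"
    have "eventually (\<lambda>i. h ((1/2)^i) / ((1/2)^i) ^ d < e / 2 ^ d) sequentially"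
      by (rule order_tendstoD(2)[OF L]) (use e in simp)
    then obtain N where N: "\<And>i. N \<le> i \<Longrightarrow> h ((1/2)^i) / ((1/2)^i) ^ d < e / 2 ^ d"
      by (auto simp: eventually_sequentially)
    have "h \<rho> / \<rho> ^ d < e" if \<rho>: "0 < \<rho>" "\<rho> < (1/2)^N" for \<rho>
    proof -
      \<comment> \<open>The least such \<open>k\<close> brackets the radius: \<rho> exceeds (1/2)^k
        and is at most twice that number.\<close>
      define k where "k = (LEAST k. (1/2)^k < \<rho>)"
      have "\<exists>k. (1/2)^k < \<rho>" using real_arch_pow_inv[of \<rho> "1/2"] \<rho> by auto
      then have k: "(1/2)^k < \<rho>" unfolding k_def by (rule LeastI_ex)
      have "N < k"
      proof (rule ccontr)
        assume "\<not> N < k"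
        then have "(1/2::real)^N \<le> (1/2)^k" by (intro power_decreasing) auto
        with k \<rho> show False by linarith
      qed
      then obtain i where i: "k = Suc i" "N \<le> i" by (cases k) auto
      then have le: "\<rho> \<le> (1/2)^i" using not_less_Least[of i "\<lambda>k. (1/2)^k < \<rho>"] by (auto simp: k_def not_less)
      have "h \<rho> \<le> h ((1/2)^i)" by (rule mono[OF \<rho>(1) le])
      also have "\<dots> < e / 2 ^ d * ((1/2)^i) ^ d" using N[OF i(2)] by (simp add: pos_divide_less_eq)
      also have "\<dots> = e * ((1/2)^k) ^ d" using i by (simp add: power_divide power_mult_distrib field_simps)
      also have "\<dots> \<le> e * \<rho> ^ d" using k e by (intro mult_left_mono power_mono) auto
      finally show ?thesis using \<rho> by (simp add: pos_divide_less_eq)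
    qed
    then show "\<forall>\<^sub>F \<rho> in at_right 0. dist (h \<rho> / \<rho> ^ d) 0 < e"
      unfolding eventually_at_right_field using nn
      by (intro exI[of _ "(1/2)^N"]) (auto simp: abs_of_nonneg)
  qed
qed

lemma half_dev_mono:
  fixes x \<nu> :: "real^'d" and g :: "real^'d \<Rightarrow> real"
  assumes "integrable lborel g" "r \<le> s"
  shows "half_dev g x \<nu> a r \<le> half_dev g x \<nu> a s"
  unfolding half_dev_def
  by (rule integral_mono[OF half_dev_integrable half_dev_integrable])
    (use assms half_ball_mono[OF assms(2)] in \<open>auto split: split_indicator\<close>)

lemma half_dev_measurable:
  fixes g :: "real^'d \<Rightarrow> real"
  assumes [measurable]: "g \<in> borel_measurable borel"
  shows "(\<lambda>x. half_dev g x \<nu> a r) \<in> borel_measurable borel"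
proof -
  have "half_dev g x \<nu> a r = (\<integral>y. (if dist x y < r \<and> (y - x) \<bullet> \<nu> > 0 then \<bar>g y - a\<bar> else 0) \<partial>lborel)" for x
    unfolding half_dev_def by (intro Bochner_Integration.integral_cong) (auto simp: half_ball_def indicator_def)
  moreover have "(\<lambda>x. \<integral>y. (if dist x y < r \<and> (y - x) \<bullet> \<nu> > 0 then \<bar>g y - a\<bar> else 0) \<partial>lborel) \<in> borel_measurable borel"
    by (rule lborel.borel_measurable_lebesgue_integral) measurable
  ultimately show ?thesis by simp
qed

text \<open>The blow-up profile of a jump. Its data form one tuple so that they range over a
  separable metric space, where density and compactness arguments apply.\<close>

definition two_valued :: "real \<times> real \<times> 'a::euclidean_space \<Rightarrow> 'a \<Rightarrow> real" where
  "two_valued p z = (case p of (a, b, \<nu>) \<Rightarrow> if z \<bullet> \<nu> > 0 then a else if z \<bullet> \<nu> < 0 then b else 0)"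

definition jump_dev :: "(real^'d \<Rightarrow> real) \<Rightarrow> real^'d \<Rightarrow> real \<times> real \<times> (real^'d) \<Rightarrow> real \<Rightarrow> real" where
  "jump_dev g x p r = (case p of (a, b, \<nu>) \<Rightarrow> half_dev g x \<nu> a r + half_dev g x (-\<nu>) b r)"

text \<open>The L^1 distance of two profiles on the unit ball.\<close>

definition two_valued_dist :: "real \<times> real \<times> 'a::euclidean_space \<Rightarrow> real \<times> real \<times> 'a \<Rightarrow> real" where
  "two_valued_dist p q = (\<integral>z. \<bar>two_valued p z - two_valued q z\<bar> * indicator (ball 0 1) z \<partial>lborel)"

lemma two_valued_measurable [measurable]: "two_valued p \<in> borel_measurable borel"
  unfolding two_valued_def[abs_def] by (cases p) simp

lemma two_valued_bound: "\<bar>two_valued (a, b, \<nu>) z\<bar> \<le> \<bar>a\<bar> + \<bar>b\<bar>"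
  by (simp add: two_valued_def)

lemma two_valued_scale: "0 < r \<Longrightarrow> two_valued p (r *\<^sub>R z) = two_valued p z"
  by (cases p) (simp add: two_valued_def zero_less_mult_iff mult_less_0_iff)

lemma AE_hyperplane:
  fixes \<nu> :: "'a::euclidean_space"
  assumes "\<nu> \<noteq> 0" shows "AE y in lborel. (y - x) \<bullet> \<nu> \<noteq> 0"
proof -
  have "negligible {y. \<nu> \<bullet> y = \<nu> \<bullet> x}" using assms by (intro negligible_hyperplane) auto
  then have "{y. \<nu> \<bullet> y = \<nu> \<bullet> x} \<in> null_sets (completion lborel)" by (simp add: negligible_iff_null_sets)
  then have "{y. \<nu> \<bullet> y = \<nu> \<bullet> x} \<in> null_sets lborel"
    by (subst (asm) null_sets_completion_iff) (auto intro!: closed_Collect_eq borel_closed continuous_intros)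
  from AE_not_in[OF this] have "AE y in lborel. \<nu> \<bullet> y \<noteq> \<nu> \<bullet> x" by simp
  then show ?thesis by eventually_elim (auto simp: inner_diff_left inner_diff_right inner_commute)
qed

text \<open>The two half balls fill the ball up to a null hyperplane. Written as one L^1 distance
  between \<open>g\<close> and the profile, the deviation obeys a triangle inequality.\<close>

lemma jump_dev_eq:
  fixes g :: "real^'d \<Rightarrow> real"
  assumes g: "g \<in> borel_measurable borel" "integrable lborel g" and \<nu>: "\<nu> \<noteq> 0"
  shows "jump_dev g x (a, b, \<nu>) r = (\<integral>y. \<bar>g y - two_valued (a, b, \<nu>) (y - x)\<bar> * indicator (ball x r) y \<partial>lborel)"
    and "integrable lborel (\<lambda>y. \<bar>g y - two_valued (a, b, \<nu>) (y - x)\<bar> * indicator (ball x r) y)"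
proof -
  note [measurable] = g(1)
  let ?f = "\<lambda>y. \<bar>g y - a\<bar> * indicator (half_ball x \<nu> r) y + \<bar>g y - b\<bar> * indicator (half_ball x (-\<nu>) r) y"
  let ?h = "\<lambda>y. \<bar>g y - two_valued (a, b, \<nu>) (y - x)\<bar> * indicator (ball x r) y"
  have int: "integrable lborel ?f"
    by (intro Bochner_Integration.integrable_add half_dev_integrable g)
  have ae: "AE y in lborel. ?f y = ?h y"
    using AE_hyperplane[OF \<nu>, of x] by eventually_elim (auto simp: two_valued_def half_ball_def indicator_def)
  have "jump_dev g x (a, b, \<nu>) r = (\<integral>y. ?f y \<partial>lborel)"
    unfolding jump_dev_def half_dev_def using half_dev_integrable[OF g(2)] by simp
  also have "\<dots> = (\<integral>y. ?h y \<partial>lborel)" by (rule integral_cong_AE[OF _ _ ae]) measurable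
  finally show "jump_dev g x (a, b, \<nu>) r = (\<integral>y. ?h y \<partial>lborel)" .
  have "integrable lborel ?f \<longleftrightarrow> integrable lborel ?h" by (rule integrable_cong_AE[OF _ _ ae]) measurable
  then show "integrable lborel ?h" using int by simp
qed

lemma two_valued_dist_integrable:
  fixes p :: "real \<times> real \<times> 'a::euclidean_space"
  shows "integrable lborel (\<lambda>y. \<bar>two_valued p (y - x) - two_valued q (y - x)\<bar> * indicator (ball x r) y)"
proof -
  obtain a b \<nu> a' b' \<nu>' where pq: "p = (a, b, \<nu>)" "q = (a', b', \<nu>')" by (metis prod_cases3)
  let ?B = "\<bar>a\<bar> + \<bar>b\<bar> + (\<bar>a'\<bar> + \<bar>b'\<bar>)"
  show ?thesis
  proof (rule Bochner_Integration.integrable_bound)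
    show "integrable lborel (\<lambda>y. ?B * indicator (ball x r) y)"
      using emeasure_lborel_ball_finite[of x r] by (intro integrable_mult_right) auto
    have "\<bar>two_valued p z - two_valued q z\<bar> \<le> ?B" for z
      using two_valued_bound[of a b \<nu> z] two_valued_bound[of a' b' \<nu>' z] unfolding pq by linarith
    moreover have "0 \<le> ?B" by simp
    ultimately show "AE y in lborel. norm (\<bar>two_valued p (y - x) - two_valued q (y - x)\<bar> * indicator (ball x r) y)
       \<le> norm (?B * indicator (ball x r) y)"
      by (auto simp: indicator_def)
  qed measurable
qed

lemma two_valued_dist_scale:
  fixes p :: "real \<times> real \<times> 'a::euclidean_space"
  assumes "0 < r"
  shows "(\<integral>y. \<bar>two_valued p (y - x) - two_valued q (y - x)\<bar> * indicator (ball x r) y \<partial>lborel) = r ^ DIM('a) * two_valued_dist p q"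
proof -
  have i: "indicator (ball x r) (x + r *\<^sub>R z) = (indicator (ball 0 1) z :: real)" for z
    using assms by (simp add: indicator_def dist_norm)
  show ?thesis unfolding two_valued_dist_def
    by (subst lborel_integral_affine[where c = r and t = x]) (use assms in \<open>auto simp: i two_valued_scale\<close>)
qed

text \<open>Profiles are invariant under dilation, so after division by r^d the error of replacing
  one profile by another depends neither on \<open>x\<close> nor on \<open>r\<close>.\<close>

lemma jump_dev_triangle:
  fixes g :: "real^'d \<Rightarrow> real"
  assumes g: "g \<in> borel_measurable borel" "integrable lborel g"
    and p: "snd (snd p) \<noteq> 0" and q: "snd (snd q) \<noteq> 0" and r: "0 < r"
  shows "jump_dev g x p r / r ^ CARD('d) \<le> jump_dev g x q r / r ^ CARD('d) + two_valued_dist q p"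
proof -
  obtain a b \<nu> a' b' \<nu>' where pq: "p = (a, b, \<nu>)" "q = (a', b', \<nu>')" by (metis prod_cases3)
  note P = jump_dev_eq[OF g, where x = x and \<nu> = \<nu> and a = a and b = b and r = r]
    and Q = jump_dev_eq[OF g, where x = x and \<nu> = \<nu>' and a = a' and b = b' and r = r]
  have "jump_dev g x p r \<le> (\<integral>y. \<bar>g y - two_valued q (y - x)\<bar> * indicator (ball x r) y +
      \<bar>two_valued q (y - x) - two_valued p (y - x)\<bar> * indicator (ball x r) y \<partial>lborel)"
    using p q unfolding pq P(1)[OF p[unfolded pq snd_conv]]
    by (intro integral_mono Bochner_Integration.integrable_add P(2) Q(2) two_valued_dist_integrable)
      (auto simp: indicator_def)
  also have "\<dots> = jump_dev g x q r + r ^ CARD('d) * two_valued_dist q p"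
    using p q r unfolding pq using Q two_valued_dist_integrable[of "(a', b', \<nu>')" x "(a, b, \<nu>)" r]
      two_valued_dist_scale[OF r, of "(a', b', \<nu>')" x "(a, b, \<nu>)"]
    by (subst Bochner_Integration.integral_add) auto
  finally show ?thesis using r by (simp add: field_simps)
qed

text \<open>Off the limit hyperplane the side on which \<open>z\<close> lies is eventually constant,
  so the profiles converge almost everywhere and boundedly.\<close>

lemma two_valued_dist_tendsto:
  fixes p :: "real \<times> real \<times> 'a::euclidean_space"
  assumes lim: "q \<longlonglongrightarrow> p" and p: "snd (snd p) \<noteq> 0"
  shows "(\<lambda>k. two_valued_dist (q k) p) \<longlonglongrightarrow> 0"
proof -
  obtain a b \<nu> where pe: "p = (a, b, \<nu>)" by (metis prod_cases3)
  define A where "A k = fst (q k)" for k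
  define B where "B k = fst (snd (q k))" for k
  define V where "V k = snd (snd (q k))" for k
  have qe: "q k = (A k, B k, V k)" for k by (simp add: A_def B_def V_def)
  have lims: "A \<longlonglongrightarrow> a" "B \<longlonglongrightarrow> b" "V \<longlonglongrightarrow> \<nu>"
    using tendsto_fst[OF lim] tendsto_fst[OF tendsto_snd[OF lim]] tendsto_snd[OF tendsto_snd[OF lim]]
    unfolding A_def[abs_def] B_def[abs_def] V_def[abs_def] pe by auto
  obtain M where M: "\<And>k. \<bar>A k\<bar> \<le> M" using convergent_imp_Bseq[OF convergentI[OF lims(1)]] unfolding Bseq_def by auto
  obtain N where N: "\<And>k. \<bar>B k\<bar> \<le> N" using convergent_imp_Bseq[OF convergentI[OF lims(2)]] unfolding Bseq_def by auto
  let ?C = "M + N + (\<bar>a\<bar> + \<bar>b\<bar>)"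
  have "(\<lambda>k. two_valued_dist (q k) p) \<longlonglongrightarrow> (\<integral>z. (0::real) \<partial>(lborel :: 'a measure))"
    unfolding two_valued_dist_def
  proof (rule integral_dominated_convergence[where w = "\<lambda>z. ?C * indicator (ball 0 1) z"])
    show "integrable lborel (\<lambda>z::'a. ?C * indicator (ball 0 1) z)"
      using emeasure_lborel_ball_finite[of "0::'a" 1] by (intro integrable_mult_right) auto
    have bd: "\<bar>two_valued (q k) z - two_valued p z\<bar> \<le> ?C" for k z
      using two_valued_bound[of "A k" "B k" "V k" z] two_valued_bound[of a b \<nu> z] M[of k] N[of k] unfolding qe pe by linarith
    show "AE z in lborel. norm (\<bar>two_valued (q k) z - two_valued p z\<bar> * indicator (ball 0 1) z) \<le> ?C * indicator (ball 0 1) z" for k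
      using bd[of k] by (auto split: split_indicator simp del: max.bounded_iff)
    have nz: "\<nu> \<noteq> 0" using p pe by simp
    show "AE z in lborel. (\<lambda>k. \<bar>two_valued (q k) z - two_valued p z\<bar> * indicator (ball 0 1) z) \<longlonglongrightarrow> 0"
      using AE_hyperplane[OF nz, of 0]
    proof eventually_elim
      case (elim z)
      have l: "(\<lambda>k. z \<bullet> V k) \<longlonglongrightarrow> z \<bullet> \<nu>" by (intro tendsto_intros lims)
      have "(\<lambda>k. two_valued (q k) z) \<longlonglongrightarrow> two_valued p z"
      proof (cases "z \<bullet> \<nu> > 0")
        case True
        have "eventually (\<lambda>k. z \<bullet> V k > 0) sequentially" by (rule order_tendstoD(1)[OF l True])
        then have "eventually (\<lambda>k. A k = two_valued (q k) z) sequentially"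
          by eventually_elim (simp add: two_valued_def qe)
        then show ?thesis using Lim_transform_eventually[OF lims(1)] True by (simp add: two_valued_def pe)
      next
        case False
        with elim have neg: "z \<bullet> \<nu> < 0" by simp
        have "eventually (\<lambda>k. z \<bullet> V k < 0) sequentially" by (rule order_tendstoD(2)[OF l neg])
        then have "eventually (\<lambda>k. B k = two_valued (q k) z) sequentially"
          by eventually_elim (simp add: two_valued_def qe)
        then show ?thesis using Lim_transform_eventually[OF lims(2)] neg by (simp add: two_valued_def pe)
      qed
      then have "(\<lambda>k. \<bar>two_valued (q k) z - two_valued p z\<bar> * indicator (ball 0 1) z) \<longlonglongrightarrow> \<bar>two_valued p z - two_valued p z\<bar> * indicator (ball 0 1) z"
        by (intro tendsto_intros)
      then show ?case by simp
    qed
  qed measurable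
  then show ?thesis by simp
qed

text \<open>Being a jump point asserts the existence of some (a, b, \<nu>), an uncountable union. It
  is made countable by asking, for every \<open>k\<close>, for a parameter in a countable dense set
  whose deviation is eventually at most 1/(k+1). Density gives one direction; compactness of the
  parameter sets and the triangle inequality, uniform in the radius, give the other.\<close>

lemma jump_set_borel:
  fixes g :: "real^'d \<Rightarrow> real"
  assumes g: "g \<in> borel_measurable borel" "integrable lborel g"
  shows "jump_set g \<in> sets borel"
proof -
  let ?d = "CARD('d)"
  \<comment> \<open>The lower bound on the gap survives limits, unlike \<open>a \<noteq> b\<close>,
    and so keeps \<open>P m\<close> compact. For \<open>m = 0\<close> the bound degenerates, since
    division by zero gives 0; hence the restriction to \<open>m \<ge> 1\<close> below.\<close>
  define P where "P m = {p :: real \<times> real \<times> (real^'d). \<bar>fst p\<bar> \<le> real m \<and> \<bar>fst (snd p)\<bar> \<le> real m \<and>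
      1 / real m \<le> \<bar>fst p - fst (snd p)\<bar> \<and> norm (snd (snd p)) = 1}" for m :: nat
  have Pnz: "snd (snd p) \<noteq> 0" if "p \<in> P m" for p m using that by (auto simp: P_def)
  have "compact (P m)" for m
  proof -
    have "closed (P m)" unfolding P_def
      by (intro closed_Collect_conj closed_Collect_le closed_Collect_eq continuous_intros)
    moreover have "P m \<subseteq> cball 0 (real m) \<times> cball 0 (real m) \<times> cball 0 1"
      by (auto simp: P_def)
    then have "bounded (P m)" by (rule bounded_subset[rotated]) (intro bounded_Times bounded_cball)
    ultimately show ?thesis by (simp add: compact_eq_bounded_closed)
  qed
  note compactP = this
  have "\<exists>Q. countable Q \<and> Q \<subseteq> P m \<and> P m \<subseteq> closure Q" for m using separable[of "P m"] by metis
  then obtain Q where Q: "\<And>m. countable (Q m)" "\<And>m. Q m \<subseteq> P m" "\<And>m. P m \<subseteq> closure (Q m)" by metis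
  define E where "E x p i = jump_dev g x p ((1/2)^i) / ((1/2)^i) ^ ?d" for x p and i :: nat
  have tri: "E x p i \<le> E x q i + two_valued_dist q p" if "p \<in> P m" "q \<in> P m" for x p q i m
    unfolding E_def by (rule jump_dev_triangle[OF g Pnz[OF that(1)] Pnz[OF that(2)]]) simp
  have E0: "0 \<le> E x p i" for x p i
    unfolding E_def jump_dev_def by (auto simp: half_dev_nonneg split: prod.split)
  have Jiff: "x \<in> jump_set g \<longleftrightarrow> (\<exists>m\<ge>1. \<exists>p\<in>P m. (\<lambda>i. E x p i) \<longlonglongrightarrow> 0)" for x
  proof -
    have dy: "((\<lambda>\<rho>. (half_dev g x \<nu> a \<rho> + half_dev g x (-\<nu>) b \<rho>) / \<rho> ^ ?d) \<longlongrightarrow> 0) (at_right 0)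
        \<longleftrightarrow> (\<lambda>i. E x (a, b, \<nu>) i) \<longlonglongrightarrow> 0" for a b \<nu>
      unfolding E_def jump_dev_def prod.case
      by (rule tendsto_at_right_dyadic) (auto intro!: add_mono half_dev_mono g add_nonneg_nonneg half_dev_nonneg)
    show ?thesis
    proof
      assume "x \<in> jump_set g"
      then obtain a b \<nu> where ab: "a \<noteq> b" "norm \<nu> = 1" "(\<lambda>i. E x (a, b, \<nu>) i) \<longlonglongrightarrow> 0"
        using jump_set_iff[OF g(1)] dy by blast
      define m where "m = nat \<lceil>max 1 (max (max \<bar>a\<bar> \<bar>b\<bar>) (1 / \<bar>a - b\<bar>))\<rceil>"
      have m: "max 1 (max (max \<bar>a\<bar> \<bar>b\<bar>) (1 / \<bar>a - b\<bar>)) \<le> real m" unfolding m_def by (rule real_nat_ceiling_ge)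
      then have m': "1 \<le> real m" "\<bar>a\<bar> \<le> real m" "\<bar>b\<bar> \<le> real m" "1 / \<bar>a - b\<bar> \<le> real m" by auto
      have "1 / real m \<le> \<bar>a - b\<bar>" using m'(1,4) ab by (simp add: field_simps)
      with m' ab have "(a, b, \<nu>) \<in> P m" by (auto simp: P_def)
      with ab(3) m'(1) show "\<exists>m\<ge>1. \<exists>p\<in>P m. (\<lambda>i. E x p i) \<longlonglongrightarrow> 0" by auto
    next
      assume "\<exists>m\<ge>1. \<exists>p\<in>P m. (\<lambda>i. E x p i) \<longlonglongrightarrow> 0"
      then obtain m p where mp: "m \<ge> 1" "p \<in> P m" "(\<lambda>i. E x p i) \<longlonglongrightarrow> 0" by blast
      obtain a b \<nu> where p: "p = (a, b, \<nu>)" by (metis prod_cases3)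
      have "0 < 1 / real m" using mp(1) by simp
      then have "a \<noteq> b" "norm \<nu> = 1" using mp(2) by (auto simp: P_def p)
      then show "x \<in> jump_set g" using jump_set_iff[OF g(1)] dy mp(3) p by blast
    qed
  qed
  have Eiff: "(\<exists>p\<in>P m. (\<lambda>i. E x p i) \<longlonglongrightarrow> 0) \<longleftrightarrow> (\<forall>k. \<exists>q\<in>Q m. \<exists>N. \<forall>i\<ge>N. E x q i \<le> 1 / real (Suc k))" for x m
  proof
    assume "\<exists>p\<in>P m. (\<lambda>i. E x p i) \<longlonglongrightarrow> 0"
    then obtain p where p: "p \<in> P m" "(\<lambda>i. E x p i) \<longlonglongrightarrow> 0" by blast
    show "\<forall>k. \<exists>q\<in>Q m. \<exists>N. \<forall>i\<ge>N. E x q i \<le> 1 / real (Suc k)"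
    proof
      fix k :: nat
      obtain q where q: "\<And>j. q j \<in> Q m" "q \<longlonglongrightarrow> p"
        using p(1) Q(3)[of m] closure_sequential[of p "Q m"] by blast
      have "(\<lambda>j. two_valued_dist (q j) p) \<longlonglongrightarrow> 0" by (rule two_valued_dist_tendsto[OF q(2) Pnz[OF p(1)]])
      then have "eventually (\<lambda>j. two_valued_dist (q j) p < 1 / (2 * real (Suc k))) sequentially"
        by (rule order_tendstoD(2)) simp
      then obtain j where "two_valued_dist (q j) p < 1 / (2 * real (Suc k))"
        using eventually_happens' sequentially_bot by blast
      moreover have "two_valued_dist p (q j) = two_valued_dist (q j) p"
        by (simp add: two_valued_dist_def abs_minus_commute)
      ultimately have w: "two_valued_dist p (q j) < 1 / (2 * real (Suc k))" by simp
      have "eventually (\<lambda>i. E x p i < 1 / (2 * real (Suc k))) sequentially"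
        by (rule order_tendstoD(2)[OF p(2)]) simp
      then obtain N where N: "\<And>i. N \<le> i \<Longrightarrow> E x p i < 1 / (2 * real (Suc k))"
        by (auto simp: eventually_sequentially)
      have "E x (q j) i \<le> 1 / real (Suc k)" if "N \<le> i" for i
      proof -
        have "q j \<in> P m" using q(1) Q(2) by blast
        from tri[OF this p(1), of x i] have "E x (q j) i \<le> E x p i + two_valued_dist p (q j)" .
        also have "\<dots> \<le> 1 / (2 * real (Suc k)) + 1 / (2 * real (Suc k))" using N[OF that] w by linarith
        also have "\<dots> = 1 / real (Suc k)" by (simp add: field_simps)
        finally show ?thesis .
      qed
      then show "\<exists>q\<in>Q m. \<exists>N. \<forall>i\<ge>N. E x q i \<le> 1 / real (Suc k)" using q(1) by blast
    qed
  next
    assume "\<forall>k. \<exists>q\<in>Q m. \<exists>N. \<forall>i\<ge>N. E x q i \<le> 1 / real (Suc k)"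
    then obtain q N where q: "\<And>k. q k \<in> Q m" "\<And>k i. i \<ge> N k \<Longrightarrow> E x (q k) i \<le> 1 / real (Suc k)" by metis
    have qP: "q k \<in> P m" for k using q(1) Q(2) by blast
    \<comment> \<open>Approximate parameters accumulate at an exact one: the deviation from the
      limit exceeds that from \<open>q (r k)\<close> by a profile distance tending to 0.\<close>
    obtain p r where p: "p \<in> P m" "strict_mono r" "(q \<circ> r) \<longlonglongrightarrow> p"
      using compactP[of m] qP unfolding compact_def by meson
    have W: "(\<lambda>k. two_valued_dist (q (r k)) p) \<longlonglongrightarrow> 0"
      using two_valued_dist_tendsto[OF p(3) Pnz[OF p(1)]] by simp
    have "(\<lambda>k. 1 / real (Suc (r k))) \<longlonglongrightarrow> 0"
      using LIMSEQ_subseq_LIMSEQ[OF LIMSEQ_inverse_real_of_nat p(2)] by (simp add: o_def inverse_eq_divide)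
    from tendsto_add[OF this W] have S: "(\<lambda>k. 1 / real (Suc (r k)) + two_valued_dist (q (r k)) p) \<longlonglongrightarrow> 0" by simp
    have "(\<lambda>i. E x p i) \<longlonglongrightarrow> 0"
    proof (rule tendstoI)
      fix e :: real assume "0 < e"
      then have "eventually (\<lambda>k. 1 / real (Suc (r k)) + two_valued_dist (q (r k)) p < e) sequentially"
        by (rule order_tendstoD(2)[OF S])
      then obtain k where k: "1 / real (Suc (r k)) + two_valued_dist (q (r k)) p < e"
        using eventually_happens' sequentially_bot by blast
      have "E x p i < e" if "N (r k) \<le> i" for i
        using tri[OF p(1) qP[of "r k"], of x i] q(2)[OF that] k by linarith
      then show "\<forall>\<^sub>F i in sequentially. dist (E x p i) 0 < e"
        unfolding eventually_sequentially using E0 by (intro exI[of _ "N (r k)"]) (auto simp: abs_of_nonneg)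
    qed
    with p(1) show "\<exists>p\<in>P m. (\<lambda>i. E x p i) \<longlonglongrightarrow> 0" by blast
  qed
  have Em: "(\<lambda>x. E x p i) \<in> borel_measurable borel" for p i
  proof -
    obtain a b \<nu> where p: "p = (a, b, \<nu>)" by (metis prod_cases3)
    have [measurable]: "(\<lambda>x. half_dev g x n c r) \<in> borel_measurable borel" for n c r
      by (rule half_dev_measurable[OF g(1)])
    show ?thesis unfolding E_def jump_dev_def p prod.case by measurable
  qed
  have "jump_set g = (\<Union>m\<in>{1..}. \<Inter>k. \<Union>q\<in>Q m. \<Union>N. \<Inter>i\<in>{N..}. {x. E x q i \<le> 1 / real (Suc k)})"
    unfolding set_eq_iff Jiff Eiff
    unfolding UN_iff INT_iff mem_Collect_eq atLeast_iff Ball_def Bex_def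
    by (simp del: split_paired_Ex)
  also have "\<dots> \<in> sets borel"
  proof -
    have "{x. E x q i \<le> c} \<in> sets borel" for q i c
      using borel_measurable_le[OF Em borel_measurable_const, of q i c] by simp
    then have "(\<Inter>i\<in>{N..}. {x. E x q i \<le> c}) \<in> sets borel" for N :: nat and q c
      by (intro sets.countable_INT'') auto
    then have "(\<Union>N. \<Inter>i\<in>{N..}. {x. E x q i \<le> c}) \<in> sets borel" for q c
      by (intro sets.countable_UN image_subsetI) blast
    then have "(\<Union>q\<in>Q m. \<Union>N. \<Inter>i\<in>{N..}. {x. E x q i \<le> c}) \<in> sets borel" for m c
      by (intro sets.countable_UN' Q) auto
    then have "(\<Inter>k. \<Union>q\<in>Q m. \<Union>N. \<Inter>i\<in>{N..}. {x. E x q i \<le> 1 / real (Suc k)}) \<in> sets borel" for m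
      by (intro sets.countable_INT'') auto
    then show ?thesis by (intro sets.countable_UN') auto
  qed
  finally show ?thesis .
qed

text \<open>Exhaustion: a countable union of nearly maximal Lebesgue null sets attains the supremum
  of \<mu> over all of them, and a null set with mass outside it would exceed the supremum.\<close>

lemma singular_carrier_exists:
  fixes \<mu> :: "(real^'d) measure"
  assumes "finite_measure \<mu>" and s: "sets \<mu> = sets borel"
  shows "\<exists>S. singular_carrier \<mu> S"
proof -
  interpret finite_measure \<mu> by fact
  define \<N> :: "(real^'d) set set" where "\<N> = {A \<in> sets borel. emeasure lborel A = 0}"
  have e: "{} \<in> \<N>" by (simp add: \<N>_def)
  define s where "s = (SUP A\<in>\<N>. measure \<mu> A)"
  have bdd: "bdd_above (measure \<mu> ` \<N>)" by (rule bdd_aboveI2[where M = "measure \<mu> (space \<mu>)"]) (rule bounded_measure)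
  have le: "measure \<mu> A \<le> s" if "A \<in> \<N>" for A unfolding s_def by (rule cSUP_upper[OF that bdd])
  have "\<exists>A\<in>\<N>. s - 1 / real (Suc n) < measure \<mu> A" for n
    using less_cSUP_iff[OF _ bdd, of "s - 1 / real (Suc n)"] e by (auto simp: s_def[symmetric])
  then obtain A where A: "\<And>n. A n \<in> \<N>" "\<And>n. s - 1 / real (Suc n) < measure \<mu> (A n)" by metis
  define S where "S = (\<Union>n. A n)"
  have Ab: "A n \<in> sets borel" for n using A(1) by (simp add: \<N>_def)
  have "A n \<in> null_sets lborel" for n using A(1)[of n] by (auto simp: \<N>_def null_sets_def)
  then have S0: "S \<in> null_sets lborel" unfolding S_def by (rule null_sets_UN)
  then have SN: "S \<in> \<N>" by (auto simp: \<N>_def null_sets_def)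
  have "s \<le> measure \<mu> S"
  proof (rule field_le_epsilon)
    fix \<epsilon> :: real assume "0 < \<epsilon>"
    then obtain n where n: "1 / real (Suc n) < \<epsilon>" using nat_approx_posE by blast
    have "measure \<mu> (A n) \<le> measure \<mu> S"
      using SN s Ab by (intro finite_measure_mono) (auto simp: S_def \<N>_def)
    then show "s \<le> measure \<mu> S + \<epsilon>" using A(2)[of n] n by linarith
  qed
  have "emeasure \<mu> (B - S) = 0" if B: "B \<in> sets borel" "emeasure lborel B = 0" for B
  proof -
    have "B \<in> null_sets lborel" using B by auto
    then have "B \<union> S \<in> null_sets lborel" using S0 by (rule null_sets.Un)
    then have "B \<union> S \<in> \<N>" by (auto simp: \<N>_def null_sets_def)
    from le[OF this] have "measure \<mu> (S \<union> (B - S)) \<le> measure \<mu> S"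
      using \<open>s \<le> measure \<mu> S\<close> by (simp add: Un_commute)
    moreover have "measure \<mu> (S \<union> (B - S)) = measure \<mu> S + measure \<mu> (B - S)"
      using SN s B by (intro finite_measure_Union) (auto simp: \<N>_def)
    ultimately have "measure \<mu> (B - S) = 0" using measure_nonneg[of \<mu> "B - S"] by linarith
    then show ?thesis by (simp add: emeasure_eq_measure)
  qed
  then have "singular_carrier \<mu> S" using SN by (auto simp: singular_carrier_def \<N>_def)
  then show ?thesis ..
qed

text \<open>The measure is unique and two carriers differ by a \<mu>-null set, so the description
  denotes the mass of the jump set inside any carrier; dropping the carrier gives the bound.\<close>

lemma jump_variation_le:
  fixes u :: "real^'d \<Rightarrow> real"
  assumes u: "grad_measure u \<mu> \<sigma>" "integrable lebesgue u"
  shows "jump_variation u \<le> emeasure \<mu> (jump_set u)" and "jump_set u \<in> sets borel"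
proof -
  obtain g where g: "g \<in> borel_measurable borel" "integrable lborel g" "jump_set g = jump_set u"
    using BV_borel_version[OF u(2)] by blast
  show J: "jump_set u \<in> sets borel" using jump_set_borel[OF g(1,2)] g(3) by simp
  note p = grad_measure_polar[OF u(1)]
  have s: "sets \<mu> = sets borel" by (rule polar_sets[OF p])
  obtain S where S: "singular_carrier \<mu> S"
    using singular_carrier_exists[OF polar_finite[OF p] s] by blast
  have le: "emeasure \<mu> (jump_set u \<inter> S) \<le> emeasure \<mu> (jump_set u \<inter> T)"
    if "singular_carrier \<mu> S" "singular_carrier \<mu> T" for S T
  proof -
    have b: "S \<in> sets borel" "T \<in> sets borel" using that by (auto simp: singular_carrier_def)
    have z: "emeasure \<mu> (S - T) = 0" using that by (simp add: singular_carrier_def)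
    have "emeasure \<mu> (jump_set u \<inter> S) \<le> emeasure \<mu> ((jump_set u \<inter> T) \<union> (S - T))"
      by (rule emeasure_mono) (use J b s in auto)
    also have "\<dots> \<le> emeasure \<mu> (jump_set u \<inter> T) + emeasure \<mu> (S - T)"
      by (rule emeasure_subadditive) (use J b s in auto)
    finally show ?thesis using z by simp
  qed
  have "jump_variation u = emeasure \<mu> (jump_set u \<inter> S)"
    unfolding jump_variation_def
  proof (rule the_equality)
    show "\<exists>\<mu>' \<sigma> S'. grad_measure u \<mu>' \<sigma> \<and> singular_carrier \<mu>' S' \<and> emeasure \<mu> (jump_set u \<inter> S) = emeasure \<mu>' (jump_set u \<inter> S')"
      using u S by blast
    fix t assume "\<exists>\<mu>' \<sigma> S'. grad_measure u \<mu>' \<sigma> \<and> singular_carrier \<mu>' S' \<and> t = emeasure \<mu>' (jump_set u \<inter> S')"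
    then obtain \<mu>' \<sigma>' S' where h: "grad_measure u \<mu>' \<sigma>'" "singular_carrier \<mu>' S'" "t = emeasure \<mu>' (jump_set u \<inter> S')" by blast
    have "\<mu>' = \<mu>" by (rule grad_measure_unique(1)[OF h(1) u])
    then show "t = emeasure \<mu> (jump_set u \<inter> S)" using h le[OF S] le[of S' S] S by (auto intro: antisym)
  qed
  then show "jump_variation u \<le> emeasure \<mu> (jump_set u)"
    using emeasure_mono[of "jump_set u \<inter> S" "jump_set u" \<mu>] J s by auto
qed

section \<open>Weakly null sequences of vector measures\<close>

lemma polar_integral_add:
  assumes "polar \<mu> \<sigma>" "bounded_borel \<Phi>" "bounded_borel \<Psi>"
  shows "(\<integral>x. (\<Phi> x + \<Psi> x) \<bullet> \<sigma> x \<partial>\<mu>) = (\<integral>x. \<Phi> x \<bullet> \<sigma> x \<partial>\<mu>) + (\<integral>x. \<Psi> x \<bullet> \<sigma> x \<partial>\<mu>)"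
  using polar_integrable[OF assms(1,2)] polar_integrable[OF assms(1,3)] by (simp add: inner_add_left)

lemma polar_integral_self:
  assumes "polar \<mu> \<sigma>"
  shows "(\<integral>x. (c *\<^sub>R \<sigma> x) \<bullet> \<sigma> x \<partial>\<mu>) = c * measure \<mu> UNIV"
proof -
  have "(c *\<^sub>R \<sigma> x) \<bullet> \<sigma> x = c" for x using polar_norm[OF assms, of x] by (simp add: norm_eq_sqrt_inner)
  then have "(\<integral>x. (c *\<^sub>R \<sigma> x) \<bullet> \<sigma> x \<partial>\<mu>) = (\<integral>x. c \<partial>\<mu>)" by (simp only:)
  then show ?thesis using polar_space[OF assms] by simp
qed

lemma unbounded_frequently:
  fixes m :: "nat \<Rightarrow> real"
  assumes "\<And>M. \<exists>n. M < m n" shows "\<exists>n\<ge>N. M < m n"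
proof -
  obtain n where n: "max M (Max (m ` {..N})) < m n" using assms by blast
  have "N \<le> n"
  proof (rule ccontr)
    assume "\<not> N \<le> n"
    then have "m n \<le> Max (m ` {..N})" by (intro Max_ge) auto
    with n show False by linarith
  qed
  with n show ?thesis by auto
qed

text \<open>A uniform boundedness principle proved by a gliding hump. The test field is the sum of
  \<open>(1/3) ^ k *\<^sub>R \<sigma> (n k)\<close>. Against the gradient of index
  \<open>n k\<close>, the part already built contributes at most 1 by weak convergence, the
  \<open>k\<close>-th term more than \<open>k\<close>, and the tail at most half of the
  \<open>k\<close>-th term because the powers after \<open>k\<close> sum to half of the
  \<open>k\<close>-th one.\<close>

lemma polar_seq_bounded:
  fixes \<mu> :: "nat \<Rightarrow> ('a::euclidean_space) measure"
  assumes p: "\<And>n. polar (\<mu> n) (\<sigma> n)"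
    and lim: "\<And>\<Psi>. bounded_borel \<Psi> \<Longrightarrow> (\<lambda>n. \<integral>x. \<Psi> x \<bullet> \<sigma> n x \<partial>\<mu> n) \<longlonglongrightarrow> 0"
  shows "\<exists>M. \<forall>n. measure (\<mu> n) UNIV \<le> M"
proof (rule ccontr)
  assume "\<nexists>M. \<forall>n. measure (\<mu> n) UNIV \<le> M"
  then have unb: "\<exists>n. M < measure (\<mu> n) UNIV" for M by (meson not_le)
  define T where "T n \<Psi> = (\<integral>x. \<Psi> x \<bullet> \<sigma> n x \<partial>\<mu> n)" for n \<Psi>
  have "\<exists>\<Psi>. \<forall>k. bounded_borel (\<Psi> k) \<and>
    (\<exists>n. \<bar>T n (\<Psi> k)\<bar> \<le> 1 \<and> 3 ^ k * real k < measure (\<mu> n) UNIV \<and> \<Psi> (Suc k) = (\<lambda>x. \<Psi> k x + (1/3) ^ k *\<^sub>R \<sigma> n x))"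
  proof (rule dependent_nat_choice)
    show "\<exists>\<Psi> :: 'a \<Rightarrow> 'a. bounded_borel \<Psi>" using bounded_borel_const by blast
    fix \<Psi> :: "'a \<Rightarrow> 'a" and k :: nat assume \<Psi>: "bounded_borel \<Psi>"
    have "eventually (\<lambda>n. \<bar>T n \<Psi>\<bar> < 1) sequentially"
      using tendstoD[OF lim[OF \<Psi>], of 1] by (simp add: T_def)
    then obtain N where N: "\<And>n. N \<le> n \<Longrightarrow> \<bar>T n \<Psi>\<bar> < 1" by (auto simp: eventually_sequentially)
    obtain n where n: "N \<le> n" "3 ^ k * real k < measure (\<mu> n) UNIV" using unbounded_frequently[OF unb] by blast
    have "bounded_borel (\<lambda>x. \<Psi> x + (1/3) ^ k *\<^sub>R \<sigma> n x)"
      by (intro bounded_borel_add bounded_borel_scaleR bounded_borel_const \<Psi> polar_bounded_borel[OF p])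
    then show "\<exists>\<Psi>'. bounded_borel \<Psi>' \<and> (\<exists>n. \<bar>T n \<Psi>\<bar> \<le> 1 \<and> 3 ^ k * real k < measure (\<mu> n) UNIV \<and> \<Psi>' = (\<lambda>x. \<Psi> x + (1/3) ^ k *\<^sub>R \<sigma> n x))"
      using N[OF n(1)] n(2) by (auto intro!: exI[of _ n])
  qed
  then obtain \<Psi> where \<Psi>: "\<forall>k. bounded_borel (\<Psi> k) \<and> (\<exists>n. \<bar>T n (\<Psi> k)\<bar> \<le> 1 \<and>
      3 ^ k * real k < measure (\<mu> n) UNIV \<and> \<Psi> (Suc k) = (\<lambda>x. \<Psi> k x + (1/3) ^ k *\<^sub>R \<sigma> n x))"
    by (elim exE)
  then have b': "\<forall>k. bounded_borel (\<Psi> k)" and st: "\<forall>k. \<exists>n. \<bar>T n (\<Psi> k)\<bar> \<le> 1 \<and>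
      3 ^ k * real k < measure (\<mu> n) UNIV \<and> \<Psi> (Suc k) = (\<lambda>x. \<Psi> k x + (1/3) ^ k *\<^sub>R \<sigma> n x)"
    by blast+
  from choice[OF st] obtain n where b: "\<And>k. bounded_borel (\<Psi> k)" and T1: "\<And>k. \<bar>T (n k) (\<Psi> k)\<bar> \<le> 1"
    and big: "\<And>k. 3 ^ k * real k < measure (\<mu> (n k)) UNIV"
    and step: "\<And>k. \<Psi> (Suc k) = (\<lambda>x. \<Psi> k x + (1/3) ^ k *\<^sub>R \<sigma> (n k) x)" using b' by blast
  define f where "f x j = (1/3::real) ^ j *\<^sub>R \<sigma> (n j) x" for x j
  have nf: "norm (f x j) = (1/3) ^ j" for x j using polar_norm[OF p] by (simp add: f_def)
  have geo: "summable (\<lambda>j. (1/3::real) ^ j)" by (intro summable_geometric) simp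
  have sf: "summable (f x)" for x by (rule summable_norm_cancel) (simp add: nf geo)
  have part: "\<Psi> k x = \<Psi> 0 x + (\<Sum>j<k. f x j)" for k x
    by (induction k) (simp_all add: step f_def)
  \<comment> \<open>The tail from index \<open>k\<close>, estimated by the geometric series.\<close>
  define R where "R k x = (\<Sum>j. f x (j + k))" for k x
  have R_le: "norm (R k x) \<le> 3/2 * (1/3) ^ k" for k x
  proof -
    have s: "summable (\<lambda>j. (1/3::real) ^ (j + k))" by (subst summable_iff_shift) (rule geo)
    have "norm (R k x) \<le> (\<Sum>j. norm (f x (j + k)))"
      unfolding R_def by (rule summable_norm) (simp add: nf s)
    also have "\<dots> = (\<Sum>j. (1/3) ^ j * (1/3) ^ k)" by (simp add: nf power_add)
    also have "\<dots> = 3/2 * (1/3) ^ k"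
      using suminf_mult2[OF geo, of "(1/3) ^ k"] suminf_geometric[of "1/3::real"] by simp
    finally show ?thesis .
  qed
  have R_meas: "R k \<in> borel_measurable borel" for k
  proof -
    have "(\<lambda>x. f x j) \<in> borel_measurable borel" for j
      unfolding f_def using bounded_borel_measurable[OF polar_bounded_borel[OF p]] by simp
    then have *: "(\<lambda>x. \<Sum>j<m. f x (j + k)) \<in> borel_measurable borel" for m by (intro borel_measurable_sum)
    have "(\<lambda>m. \<Sum>j<m. f x (j + k)) \<longlonglongrightarrow> R k x" for x
      unfolding R_def by (rule summable_LIMSEQ) (simp add: summable_iff_shift sf)
    then show ?thesis by (intro borel_measurable_LIMSEQ_metric[OF *]) auto
  qed
  have bR: "bounded_borel (R k)" for k by (rule bounded_borelI[OF R_meas R_le])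
  define \<Phi> where "\<Phi> x = \<Psi> 0 x + R 0 x" for x
  have \<Phi>_eq: "\<Phi> x = \<Psi> k x + ((1/3) ^ k *\<^sub>R \<sigma> (n k) x + R (Suc k) x)" for k x
  proof -
    have "R 0 x = R (Suc k) x + (\<Sum>j<Suc k. f x j)"
      unfolding R_def using suminf_split_initial_segment[OF sf, of x "Suc k"] by simp
    then have "R 0 x = R (Suc k) x + ((\<Sum>j<k. f x j) + f x k)" by simp
    then have "\<Phi> x = \<Psi> 0 x + (R (Suc k) x + ((\<Sum>j<k. f x j) + f x k))" by (simp only: \<Phi>_def)
    also have "\<dots> = \<Psi> k x + (f x k + R (Suc k) x)" by (simp add: part[of k x])
    finally show ?thesis by (simp only: f_def)
  qed
  have b\<Phi>: "bounded_borel \<Phi>" unfolding \<Phi>_def[abs_def] by (intro bounded_borel_add b bR)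
  have "real k / 2 - 1 \<le> T (n k) \<Phi>" for k
  proof -
    note pk = p[of "n k"]
    let ?m = "measure (\<mu> (n k)) UNIV"
    have "T (n k) \<Phi> = T (n k) (\<Psi> k) + ((1/3) ^ k * ?m + T (n k) (R (Suc k)))"
      unfolding T_def \<Phi>_eq[of _ k]
      by (simp add: polar_integral_add[OF pk] polar_integral_self[OF pk] b bR bounded_borel_add bounded_borel_scaleR
          bounded_borel_const polar_bounded_borel[OF pk] polar_integral_self[OF pk, of 1, simplified])
    moreover have "\<bar>T (n k) (R (Suc k))\<bar> \<le> 1/2 * ((1/3) ^ k * ?m)"
    proof -
      have "\<bar>T (n k) (R (Suc k))\<bar> \<le> 3/2 * (1/3) ^ Suc k * ?m"
        unfolding T_def by (rule polar_integral_le[OF pk bR]) (use R_le[of "Suc k"] in auto)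
      then show ?thesis by simp
    qed
    moreover have "real k < (1/3) ^ k * ?m"
      using big[of k] by (simp add: power_divide field_simps)
    ultimately show ?thesis using T1[of k] by linarith
  qed
  moreover have "Bseq (\<lambda>n. T n \<Phi>)"
    using lim[OF b\<Phi>] unfolding T_def by (intro convergent_imp_Bseq convergentI)
  then obtain K where K: "\<And>n. \<bar>T n \<Phi>\<bar> \<le> K" unfolding Bseq_def by auto
  obtain k :: nat where "2 * (K + 1) < real k" using reals_Archimedean2 by blast
  ultimately show False using K[of "n k"] by (smt (verit, best) field_sum_of_halves)
qed

text \<open>A gliding hump: the test field is assembled from the polar fields on disjoint differences of the sets \<open>B k\<close>.\<close>
lemma polar_seq_uniform_decseq:
  fixes \<mu> :: "nat \<Rightarrow> ('a::euclidean_space) measure"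
  assumes p: "\<And>n. polar (\<mu> n) (\<sigma> n)"
    and lim: "\<And>\<Psi>. bounded_borel \<Psi> \<Longrightarrow> (\<lambda>n. \<integral>x. \<Psi> x \<bullet> \<sigma> n x \<partial>\<mu> n) \<longlonglongrightarrow> 0"
    and B: "\<And>k. B k \<in> sets borel" "decseq B" "\<And>n. (\<lambda>k. measure (\<mu> n) (B k)) \<longlonglongrightarrow> 0"
    and \<epsilon>: "0 < \<epsilon>"
  shows "\<exists>k. \<forall>n. measure (\<mu> n) (B k) \<le> \<epsilon>"
proof (rule ccontr)
  assume "\<nexists>k. \<forall>n. measure (\<mu> n) (B k) \<le> \<epsilon>"
  then have ex: "\<exists>n. \<epsilon> < measure (\<mu> n) (B k)" for k by (meson not_le)
  have fin: "finite_measure (\<mu> n)" for n by (rule polar_finite[OF p])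
  have mono: "measure (\<mu> n) (B l) \<le> measure (\<mu> n) (B k)" if "k \<le> l" for n k l
    using decseqD[OF B(2) that] B(1) polar_sets[OF p] by (intro finite_measure.finite_measure_mono[OF fin]) auto
  \<comment> \<open>Each of the finitely many measures below \<open>N\<close> is small on late sets
    \<open>B l\<close>, so an index with large mass there lies beyond \<open>N\<close>; by
    monotonicity its mass on \<open>B k\<close> is large too.\<close>
  have ex': "\<exists>n\<ge>N. \<epsilon> < measure (\<mu> n) (B k)" for k N
  proof -
    have "eventually (\<lambda>l. \<forall>n\<in>{..<N}. measure (\<mu> n) (B l) < \<epsilon>) sequentially"
      by (intro eventually_ball_finite ballI order_tendstoD(2)[OF B(3) \<epsilon>]) simp
    then obtain l where l: "k \<le> l" "\<And>n. n < N \<Longrightarrow> measure (\<mu> n) (B l) < \<epsilon>"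
      unfolding eventually_sequentially by (metis lessThan_iff nle_le)
    obtain n where n: "\<epsilon> < measure (\<mu> n) (B l)" using ex by blast
    then have "N \<le> n" using l(2) by (metis less_asym not_le)
    moreover have "\<epsilon> < measure (\<mu> n) (B k)" using n mono[OF l(1)] by (meson less_le_trans)
    ultimately show ?thesis by blast
  qed
  define T where "T n \<Psi> = (\<integral>x. \<Psi> x \<bullet> \<sigma> n x \<partial>\<mu> n)" for n \<Psi>
  \<comment> \<open>A state is an index and a field vanishing on the corresponding set. A step fills
    in the polar field of a late \<open>n\<close> on the part of that set outside a much later
    \<open>B k\<close>. Later steps leave the field outside the current set unchanged, so the fields
    converge pointwise.\<close>
  define good where "good s \<longleftrightarrow> snd s \<in> borel_measurable borel \<and> (\<forall>x. norm (snd s x) \<le> 1) \<and> (\<forall>x\<in>B (fst s). snd s x = 0)"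
    for s :: "nat \<times> ('a \<Rightarrow> 'a)"
  define step where "step j n s t \<longleftrightarrow> j \<le> n \<and> \<bar>T n (snd s)\<bar> < \<epsilon>/8 \<and> \<epsilon> < measure (\<mu> n) (B (fst s)) \<and>
      fst s \<le> fst t \<and> measure (\<mu> n) (B (fst t)) < \<epsilon>/8 \<and>
      snd t = (\<lambda>x. if x \<in> B (fst s) then if x \<in> B (fst t) then 0 else \<sigma> n x else snd s x)"
    for j n and s t :: "nat \<times> ('a \<Rightarrow> 'a)"
  have bb: "bounded_borel (snd s)" if "good s" for s
    using that unfolding good_def by (auto intro: bounded_borelI)
  have "\<exists>s. \<forall>j. good (s j) \<and> (\<exists>n. step j n (s j) (s (Suc j)))"
  proof (rule dependent_nat_choice)
    show "\<exists>s. good s" by (rule exI[of _ "(0, \<lambda>x. 0)"]) (simp add: good_def)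
    fix s j assume s: "good s"
    have "eventually (\<lambda>n. \<bar>T n (snd s)\<bar> < \<epsilon>/8) sequentially"
      using tendstoD[OF lim[OF bb[OF s]], of "\<epsilon>/8"] \<epsilon> by (simp add: T_def)
    then obtain N where N: "\<And>n. N \<le> n \<Longrightarrow> \<bar>T n (snd s)\<bar> < \<epsilon>/8" by (auto simp: eventually_sequentially)
    obtain n where n: "max N j \<le> n" "\<epsilon> < measure (\<mu> n) (B (fst s))" using ex' by blast
    have "eventually (\<lambda>k. measure (\<mu> n) (B k) < \<epsilon>/8) sequentially"
      using order_tendstoD(2)[OF B(3), of "\<epsilon>/8"] \<epsilon> by simp
    then obtain k where k: "fst s \<le> k" "measure (\<mu> n) (B k) < \<epsilon>/8"
      unfolding eventually_sequentially by (meson nle_le)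
    define t where "t = (k, \<lambda>x. if x \<in> B (fst s) then if x \<in> B k then 0 else \<sigma> n x else snd s x)"
    have [measurable]: "snd s \<in> borel_measurable borel" "\<sigma> n \<in> borel_measurable borel"
      "B (fst s) \<in> sets borel" "B k \<in> sets borel"
      using s p[of n] B(1) by (auto simp: good_def polar_def)
    have sub: "B k \<subseteq> B (fst s)" by (rule decseqD[OF B(2) k(1)])
    have "good t" unfolding good_def
    proof (intro conjI)
      show "snd t \<in> borel_measurable borel" unfolding t_def snd_conv by measurable
      show "\<forall>x. norm (snd t x) \<le> 1" using s polar_norm[OF p] by (auto simp: t_def good_def)
      show "\<forall>x\<in>B (fst t). snd t x = 0" using sub by (auto simp: t_def)
    qed
    moreover have "step j n s t" using n k N by (auto simp: step_def t_def)
    ultimately show "\<exists>t. good t \<and> (\<exists>n. step j n s t)" by blast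
  qed
  then obtain s n where s: "\<And>j. good (s j)" "\<And>j. step j (n j) (s j) (s (Suc j))" by metis
  define K where "K j = fst (s j)" for j
  define \<Psi> where "\<Psi> j = snd (s j)" for j
  have \<Psi>: "\<Psi> j \<in> borel_measurable borel" "norm (\<Psi> j x) \<le> 1" "x \<in> B (K j) \<Longrightarrow> \<Psi> j x = 0" for j x
    using s(1)[of j] by (auto simp: good_def \<Psi>_def K_def)
  have st: "j \<le> n j" "\<bar>T (n j) (\<Psi> j)\<bar> < \<epsilon>/8" "\<epsilon> < measure (\<mu> (n j)) (B (K j))" "K j \<le> K (Suc j)"
    "measure (\<mu> (n j)) (B (K (Suc j))) < \<epsilon>/8"
    "\<Psi> (Suc j) x = (if x \<in> B (K j) then if x \<in> B (K (Suc j)) then 0 else \<sigma> (n j) x else \<Psi> j x)" for j x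
    using s(2)[of j] by (auto simp: step_def \<Psi>_def K_def)
  have Bsub: "B (K (Suc j)) \<subseteq> B (K j)" for j by (rule decseqD[OF B(2) st(4)])
  have outside: "x \<notin> B (K (j + i)) \<and> \<Psi> (j + i) x = \<Psi> j x" if "x \<notin> B (K j)" for x i j
    using that by (induction i) (use Bsub st(6) in auto)
  define \<Phi> where "\<Phi> x = lim (\<lambda>j. \<Psi> j x)" for x
  have out_lim: "(\<lambda>i. \<Psi> i x) \<longlonglongrightarrow> \<Psi> j x" if "x \<notin> B (K j)" for x j
  proof (rule tendsto_eventually)
    show "\<forall>\<^sub>F i in sequentially. \<Psi> i x = \<Psi> j x"
      using eventually_ge_at_top[of j]
    proof eventually_elim
      case (elim i) then show ?case using outside[OF that, of "i - j"] by simp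
    qed
  qed
  have \<Phi>_lim: "(\<lambda>j. \<Psi> j x) \<longlonglongrightarrow> \<Phi> x" for x
  proof (cases "\<forall>j. x \<in> B (K j)")
    case True
    then have "(\<lambda>j. \<Psi> j x) = (\<lambda>j. 0)" using \<Psi>(3) by auto
    then show ?thesis by (simp add: \<Phi>_def)
  next
    case False
    then obtain j where "x \<notin> B (K j)" by blast
    from out_lim[OF this] show ?thesis unfolding \<Phi>_def by (simp add: limI)
  qed
  have \<Phi>_out: "\<Phi> x = \<Psi> j x" if "x \<notin> B (K j)" for x j
    using LIMSEQ_unique[OF \<Phi>_lim out_lim[OF that]] .
  have \<Phi>m: "\<Phi> \<in> borel_measurable borel"
    by (rule borel_measurable_LIMSEQ_metric[OF \<Psi>(1)]) (use \<Phi>_lim in auto)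
  have \<Phi>1: "norm (\<Phi> x) \<le> 1" for x
    by (rule Lim_bounded[OF tendsto_norm[OF \<Phi>_lim]]) (use \<Psi>(2) in auto)
  have b\<Phi>: "bounded_borel \<Phi>" by (rule bounded_borelI[OF \<Phi>m \<Phi>1])
  \<comment> \<open>The hump contributes more than \<epsilon> minus \<epsilon>/8, while the part
    built before and the part still to come lose at most \<epsilon>/8 each.\<close>
  have low: "\<epsilon>/2 \<le> T (n j) \<Phi>" for j
  proof -
    note pj = p[of "n j"]
    interpret finite_measure "\<mu> (n j)" by (rule fin)
    let ?C = "B (K j) - B (K (Suc j))" and ?D = "B (K (Suc j))"
    have dec: "\<Phi> x = \<Psi> j x + (indicator ?C x *\<^sub>R \<sigma> (n j) x + indicator ?D x *\<^sub>R \<Phi> x)" for x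
      using \<Phi>_out[of x j] \<Phi>_out[of x "Suc j"] st(6)[where j = j and x = x] \<Psi>(3)[of x j] Bsub[of j]
      by (cases "x \<in> B (K j)"; cases "x \<in> ?D") auto
    have bs: "bounded_borel (\<Psi> j)" "bounded_borel (\<lambda>x. indicator ?C x *\<^sub>R \<sigma> (n j) x)" "bounded_borel (\<lambda>x. indicator ?D x *\<^sub>R \<Phi> x)"
      using \<Psi>(1,2) B(1) by (auto intro!: bounded_borelI[of "\<Psi> j" 1] bounded_borel_scaleR bounded_borel_indicator b\<Phi> polar_bounded_borel[OF pj])
    have "T (n j) \<Phi> = T (n j) (\<lambda>x. \<Psi> j x + (indicator ?C x *\<^sub>R \<sigma> (n j) x + indicator ?D x *\<^sub>R \<Phi> x))"
      using dec by (intro arg_cong[where f = "T (n j)"] ext)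
    also have "\<dots> = T (n j) (\<Psi> j) + (T (n j) (\<lambda>x. indicator ?C x *\<^sub>R \<sigma> (n j) x) + T (n j) (\<lambda>x. indicator ?D x *\<^sub>R \<Phi> x))"
      unfolding T_def by (simp only: polar_integral_add[OF pj] bs bounded_borel_add)
    also have "T (n j) (\<lambda>x. indicator ?C x *\<^sub>R \<sigma> (n j) x) = measure (\<mu> (n j)) ?C"
      unfolding T_def by (rule polar_measure_eq[OF pj, symmetric]) (use B(1) in auto)
    also have "measure (\<mu> (n j)) ?C = measure (\<mu> (n j)) (B (K j)) - measure (\<mu> (n j)) ?D"
      by (rule finite_measure_Diff) (use B(1) Bsub polar_sets[OF pj] in auto)
    finally have "T (n j) \<Phi> = T (n j) (\<Psi> j) + (measure (\<mu> (n j)) (B (K j)) - measure (\<mu> (n j)) ?D + T (n j) (\<lambda>x. indicator ?D x *\<^sub>R \<Phi> x))" .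
    moreover have "\<bar>T (n j) (\<lambda>x. indicator ?D x *\<^sub>R \<Phi> x)\<bar> \<le> 1 * measure (\<mu> (n j)) ?D"
      unfolding T_def by (rule polar_integral_le[OF pj bs(3) B(1)]) (use \<Phi>1 in \<open>auto simp: indicator_def\<close>)
    ultimately show ?thesis using st(2)[of j] st(3)[of j] st(5)[of j] by linarith
  qed
  have "eventually (\<lambda>m. T m \<Phi> < \<epsilon>/2) sequentially"
    using order_tendstoD(2)[OF lim[OF b\<Phi>], of "\<epsilon>/2"] \<epsilon> by (simp add: T_def)
  then obtain N where "\<And>m. N \<le> m \<Longrightarrow> T m \<Phi> < \<epsilon>/2" by (auto simp: eventually_sequentially)
  from this[OF st(1)] low[of N] show False by simp
qed

text \<open>The conclusion of Vitali, Hahn and Saks. If it failed there would be sets with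
  \<nu>-measures below (1/2)^k that are each heavy for some index; the unions of their tails
  decrease to a \<nu>-null set, so every fixed measure vanishes along them, against the uniform
  decay just proved.\<close>

lemma polar_seq_uniformly_absolutely_continuous:
  fixes \<mu> :: "nat \<Rightarrow> ('a::euclidean_space) measure"
  assumes p: "\<And>n. polar (\<mu> n) (\<sigma> n)"
    and lim: "\<And>\<Psi>. bounded_borel \<Psi> \<Longrightarrow> (\<lambda>n. \<integral>x. \<Psi> x \<bullet> \<sigma> n x \<partial>\<mu> n) \<longlonglongrightarrow> 0"
    and \<nu>: "finite_measure \<nu>" "sets \<nu> = sets borel"
    and ac: "\<And>n A. A \<in> sets borel \<Longrightarrow> measure \<nu> A = 0 \<Longrightarrow> measure (\<mu> n) A = 0" and \<epsilon>: "0 < \<epsilon>"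
  shows "\<exists>\<delta>>0. \<forall>A\<in>sets borel. measure \<nu> A < \<delta> \<longrightarrow> (\<forall>n. measure (\<mu> n) A \<le> \<epsilon>)"
proof (rule ccontr)
  assume "\<not> ?thesis"
  then have "\<exists>A. A \<in> sets borel \<and> measure \<nu> A < \<delta> \<and> (\<exists>n. \<epsilon> < measure (\<mu> n) A)" if "0 < \<delta>" for \<delta>
    using that by (meson not_le)
  then have "\<forall>k::nat. \<exists>A. A \<in> sets borel \<and> measure \<nu> A < (1/2) ^ k \<and> (\<exists>n. \<epsilon> < measure (\<mu> n) A)" by simp
  from choice[OF this] obtain A where A': "\<forall>k. A k \<in> sets borel \<and> measure \<nu> (A k) < (1/2) ^ k \<and> (\<exists>n. \<epsilon> < measure (\<mu> n) (A k))" ..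
  then have "\<forall>k. \<exists>n. \<epsilon> < measure (\<mu> n) (A k)" by blast
  from choice[OF this] obtain n where "\<forall>k. \<epsilon> < measure (\<mu> (n k)) (A k)" ..
  with A' have A: "\<And>k. A k \<in> sets borel" "\<And>k. measure \<nu> (A k) < (1/2) ^ k" "\<And>k. \<epsilon> < measure (\<mu> (n k)) (A k)" by blast+
  interpret \<nu>: finite_measure \<nu> by fact
  define B where "B k = (\<Union>j. A (j + k))" for k
  have Bb: "B k \<in> sets borel" for k unfolding B_def using A(1) by auto
  have dec: "decseq B"
    unfolding decseq_def B_def by (auto, metis add.assoc le_add_diff_inverse2)
  have geo: "summable (\<lambda>j. (1/2::real) ^ (j + k))" for k by (subst summable_iff_shift) (intro summable_geometric, simp)
  have Ble: "measure \<nu> (B k) \<le> 2 * (1/2) ^ k" for k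
  proof -
    have s: "summable (\<lambda>j. measure \<nu> (A (j + k)))"
      by (rule summable_comparison_test'[OF geo[of k], of 0]) (use A(2) in \<open>auto simp: less_imp_le\<close>)
    have "measure \<nu> (B k) \<le> (\<Sum>j. measure \<nu> (A (j + k)))"
      unfolding B_def by (rule \<nu>.finite_measure_subadditive_countably[OF _ s]) (use A(1) \<nu> in auto)
    also have "\<dots> \<le> (\<Sum>j. (1/2) ^ (j + k))"
      by (rule suminf_le[OF _ s geo]) (use A(2) in \<open>auto simp: less_imp_le\<close>)
    also have "\<dots> = (\<Sum>j. (1/2) ^ j * (1/2) ^ k)" by (simp add: power_add)
    also have "\<dots> = 2 * (1/2) ^ k"
      using suminf_mult2[OF summable_geometric, of "1/2::real" "(1/2) ^ k"] suminf_geometric[of "1/2::real"] by simp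
    finally show ?thesis .
  qed
  let ?Z = "\<Inter>k. B k"
  have Zb: "?Z \<in> sets borel" using Bb by auto
  have "measure \<nu> ?Z \<le> 0"
  proof (rule LIMSEQ_le_const)
    have "(\<lambda>k. 2 * (1/2::real) ^ k) \<longlonglongrightarrow> 2 * 0" by (intro tendsto_mult tendsto_const LIMSEQ_realpow_zero) auto
    then show "(\<lambda>k. 2 * (1/2::real) ^ k) \<longlonglongrightarrow> 0" by simp
    have "measure \<nu> ?Z \<le> 2 * (1/2) ^ k" for k
      by (rule order_trans[OF \<nu>.finite_measure_mono Ble]) (use Bb \<nu> in auto)
    then show "\<exists>N. \<forall>k\<ge>N. measure \<nu> ?Z \<le> 2 * (1/2) ^ k" by blast
  qed
  then have "measure \<nu> ?Z = 0" using measure_nonneg[of \<nu> ?Z] by linarith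
  then have Z0: "measure (\<mu> n) ?Z = 0" for n by (rule ac[OF Zb])
  have "(\<lambda>k. measure (\<mu> n) (B k)) \<longlonglongrightarrow> 0" for n
  proof -
    interpret finite_measure "\<mu> n" by (rule polar_finite[OF p])
    have "(\<lambda>k. measure (\<mu> n) (B k)) \<longlonglongrightarrow> measure (\<mu> n) ?Z"
      by (rule finite_Lim_measure_decseq[OF _ dec]) (use Bb polar_sets[OF p] in auto)
    then show ?thesis by (simp add: Z0)
  qed
  from polar_seq_uniform_decseq[OF p lim Bb dec this \<epsilon>]
  obtain k where k: "\<And>n. measure (\<mu> n) (B k) \<le> \<epsilon>" by blast
  have "A k \<subseteq> B k" unfolding B_def using UN_upper[of 0 UNIV "\<lambda>j. A (j + k)"] by simp
  then have "measure (\<mu> (n k)) (A k) \<le> measure (\<mu> (n k)) (B k)"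
    using Bb polar_sets[OF p] by (intro finite_measure.finite_measure_mono[OF polar_finite[OF p]]) auto
  with k[of "n k"] A(3)[of k] show False by linarith
qed

text \<open>The bound \<open>M\<close> makes the series with geometric weights finite. The
  inequality, stronger than absolute continuity, also transfers lower density bounds from each
  measure to \<nu>.\<close>

lemma dominating_measure_exists:
  fixes \<mu> :: "nat \<Rightarrow> ('a::euclidean_space) measure"
  assumes fin: "\<And>n. finite_measure (\<mu> n)" and s: "\<And>n. sets (\<mu> n) = sets borel" and M: "\<And>n. measure (\<mu> n) UNIV \<le> M"
  shows "\<exists>\<nu>. finite_measure \<nu> \<and> sets \<nu> = sets borel \<and> (\<forall>n. \<forall>A\<in>sets borel. (1/2) ^ n * measure (\<mu> n) A \<le> measure \<nu> A)"
proof -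
  define \<kappa> where "\<kappa> n = scale_measure (ennreal ((1/2) ^ n)) (\<mu> n)" for n
  define \<nu> where "\<nu> = sum_measure \<kappa>"
  have sk: "sets (\<kappa> n) = sets borel" for n by (simp add: \<kappa>_def s)
  have sn: "sets \<nu> = sets borel" by (simp add: \<nu>_def)
  have em: "emeasure (\<kappa> n) A = ennreal ((1/2) ^ n * measure (\<mu> n) A)" for n A
    using finite_measure.emeasure_eq_measure[OF fin] by (simp add: \<kappa>_def ennreal_mult)
  have eN: "emeasure \<nu> A = (\<Sum>n. ennreal ((1/2) ^ n * measure (\<mu> n) A))" if "A \<in> sets borel" for A
    unfolding \<nu>_def emeasure_sum_measure[OF sk that] em ..
  have M0: "0 \<le> M" using M[of 0] measure_nonneg order_trans by blast
  have geo: "summable (\<lambda>n. (1/2::real) ^ n * M)" by (intro summable_mult2 summable_geometric) simp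
  have "emeasure \<nu> UNIV \<le> (\<Sum>n. ennreal ((1/2) ^ n * M))"
    unfolding eN[OF sets.top[of borel, unfolded space_borel]] by (intro suminf_le summableI ennreal_leI mult_left_mono M) auto
  also have "\<dots> = ennreal (\<Sum>n. (1/2) ^ n * M)" by (rule suminf_ennreal2[OF _ geo]) (use M0 in simp)
  also have "\<dots> < \<infinity>" by simp
  finally have "emeasure \<nu> (space \<nu>) < \<infinity>" using sets_eq_imp_space_eq[OF sn] by simp
  then have fn: "finite_measure \<nu>" by (intro finite_measureI) auto
  have "(1/2) ^ n * measure (\<mu> n) A \<le> measure \<nu> A" if A: "A \<in> sets borel" for n A
  proof -
    have "ennreal ((1/2) ^ n * measure (\<mu> n) A) \<le> emeasure \<nu> A"
    proof -
      define h where "h m = ennreal ((1/2) ^ m * measure (\<mu> m) A)" for m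
      have "h n \<le> (\<Sum>m. h m)" using sum_le_suminf[of h "{n}"] by simp
      then show ?thesis unfolding eN[OF A] h_def .
    qed
    then show ?thesis by (simp only: finite_measure.emeasure_eq_measure[OF fn] ennreal_le_iff measure_nonneg)
  qed
  with fn sn show ?thesis by blast
qed

section \<open>Local convergence in the mean\<close>

text \<open>Averaging over balls of radius \<open>r\<close> moves \<open>g n\<close> by at most \<open>r M\<close> in the mean, and turns weak convergence
  into pointwise convergence.\<close>
lemma weak_null_local_L1:
  fixes g :: "nat \<Rightarrow> real^'d \<Rightarrow> real"
  assumes g: "\<And>n. g n \<in> borel_measurable borel" "\<And>n. integrable lborel (g n)"
    and \<mu>: "\<And>n. grad_measure (g n) (\<mu> n) (\<sigma> n)" "\<And>n. measure (\<mu> n) UNIV \<le> M"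
    and weak: "\<And>\<psi>. bounded_borel \<psi> \<Longrightarrow> (\<lambda>n. \<integral>x. g n x * \<psi> x \<partial>lborel) \<longlonglongrightarrow> 0"
  shows "(\<lambda>n. \<integral>x. \<bar>g n x\<bar> * indicator (ball 0 R) x \<partial>lborel) \<longlonglongrightarrow> 0"
proof -
  note [measurable] = g(1)
  have M0: "0 \<le> M" using \<mu>(2)[of 0] measure_nonneg order_trans by blast
  have trans: "(\<integral>x. \<bar>g n (x + v) - g n x\<bar> \<partial>lborel) \<le> norm v * M" for n v
    by (rule order_trans[OF grad_measure_translation_le[OF g \<mu>(1)]]) (intro mult_left_mono \<mu>(2) norm_ge_zero)
  have transi: "integrable lborel (\<lambda>x. \<bar>g n (x + v) - g n x\<bar>)" for n v
    by (intro integrable_abs Bochner_Integration.integrable_diff lborel_integrable_shift g(2))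
  define V where "V r = measure lborel (ball (0::real^'d) r)" for r
  define a where "a r n x = (\<integral>z. g n (x + z) * indicator (ball 0 r) z \<partial>lborel) / V r" for r n x
  have Vpos: "0 < V r" if "0 < r" for r unfolding V_def using that by (simp add: measure_ball_scale)
  have gint: "integrable lborel (\<lambda>z. g n (x + z) * indicator (ball 0 r) z)" for n x r
    using integrable_mult_indicator[of "ball 0 r" lborel "\<lambda>z. g n (z + x)"] lborel_integrable_shift[OF g(2)]
    by (simp add: mult.commute add.commute)
  have cint: "integrable lborel (\<lambda>z::real^'d. c * indicator (ball 0 r) z :: real)" for c r
    using emeasure_lborel_ball_finite[of "0::real^'d" r] by (intro integrable_mult_right) auto
  have am [measurable]: "a r n \<in> borel_measurable borel" for r n
  proof -
    have "(\<lambda>x. \<integral>z. g n (x + z) * indicator (ball 0 r) z \<partial>lborel) \<in> borel_measurable borel"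
      by (rule lborel.borel_measurable_lebesgue_integral) measurable
    then show ?thesis unfolding a_def[abs_def] by measurable
  qed
  have a_ball: "a r n x = (\<integral>y. g n y * indicator (ball x r) y \<partial>lborel) / V r" for r n x
  proof -
    have "(\<integral>y. g n y * indicator (ball x r) y \<partial>lborel) = (\<integral>z. g n (z + x) * indicator (ball x r) (z + x) \<partial>lborel)"
      by (rule lborel_integral_shift[symmetric]) measurable
    also have "\<dots> = (\<integral>z. g n (x + z) * indicator (ball 0 r) z \<partial>lborel)"
      by (intro Bochner_Integration.integral_cong) (auto simp: indicator_def dist_norm add.commute)
    finally show ?thesis by (simp add: a_def)
  qed
  have a_lim: "(\<lambda>n. a r n x) \<longlonglongrightarrow> 0" for r x
  proof -
    have "bounded_borel (indicator (ball x r) :: _ \<Rightarrow> real)" by (rule bounded_borel_indicator) simp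
    from tendsto_divide_zero[OF weak[OF this], of "V r"]
    show ?thesis by (simp add: a_ball)
  qed
  \<comment> \<open>Equicontinuity in \<open>n\<close>. Together with boundedness at the origin it
    gives a common bound on the ball \<open>ball 0 R\<close>, as required for dominated
    convergence.\<close>
  have a_lip: "\<bar>a r n x - a r n 0\<bar> \<le> norm x * M / V r" if "0 < r" for r n x
  proof -
    have "a r n x - a r n 0 = (\<integral>z. g n (x + z) * indicator (ball 0 r) z - g n (0 + z) * indicator (ball 0 r) z \<partial>lborel) / V r"
      unfolding a_def
      by (subst Bochner_Integration.integral_diff[OF gint[of n x r] gint[of n 0 r]]) (simp add: diff_divide_distrib)
    then have "\<bar>a r n x - a r n 0\<bar> = \<bar>\<integral>z. g n (x + z) * indicator (ball 0 r) z - g n (0 + z) * indicator (ball 0 r) z \<partial>lborel\<bar> / V r"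
      using Vpos[OF that] by simp
    also have "\<dots> \<le> (\<integral>z. \<bar>g n (x + z) * indicator (ball 0 r) z - g n (0 + z) * indicator (ball 0 r) z\<bar> \<partial>lborel) / V r"
      using Vpos[OF that] by (intro divide_right_mono integral_abs_bound) simp
    also have "\<dots> \<le> (\<integral>z. \<bar>g n (z + x) - g n z\<bar> \<partial>lborel) / V r"
    proof (intro divide_right_mono integral_mono transi)
      show "integrable lborel (\<lambda>z. \<bar>g n (x + z) * indicator (ball 0 r) z - g n (0 + z) * indicator (ball 0 r) z\<bar>)"
        by (intro integrable_abs Bochner_Integration.integrable_diff gint)
    qed (use Vpos[OF that] in \<open>auto simp: add.commute split: split_indicator\<close>)
    also have "\<dots> \<le> norm x * M / V r" using Vpos[OF that] by (intro divide_right_mono trans) simp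
    finally show ?thesis .
  qed
  have a_L1: "(\<lambda>n. \<integral>x. \<bar>a r n x\<bar> * indicator (ball 0 R) x \<partial>lborel) \<longlonglongrightarrow> 0" if r: "0 < r" for r
  proof -
    have "Bseq (\<lambda>n. a r n 0)" using a_lim by (intro convergent_imp_Bseq convergentI)
    then obtain K where K: "\<And>n. \<bar>a r n 0\<bar> \<le> K" unfolding Bseq_def by auto
    have bd: "\<bar>a r n x\<bar> \<le> K + R * M / V r" if "x \<in> ball 0 R" for n x
    proof -
      have "norm x * M / V r \<le> R * M / V r"
        using that M0 Vpos[OF r] by (intro divide_right_mono mult_right_mono) auto
      then show ?thesis using K[of n] a_lip[OF r, of n x] by linarith
    qed
    have "(\<lambda>n. \<integral>x. \<bar>a r n x\<bar> * indicator (ball 0 R) x \<partial>lborel) \<longlonglongrightarrow> (\<integral>x. 0 \<partial>(lborel :: (real^'d) measure))"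
    proof (rule integral_dominated_convergence[where w = "\<lambda>x. (K + R * M / V r) * indicator (ball 0 R) x"])
      show "AE x in lborel. (\<lambda>n. \<bar>a r n x\<bar> * indicator (ball 0 R) x) \<longlonglongrightarrow> 0"
      proof (rule AE_I2)
        fix x
        have "(\<lambda>n. \<bar>a r n x\<bar> * indicator (ball 0 R) x) \<longlonglongrightarrow> \<bar>0\<bar> * indicator (ball 0 R) x"
          by (intro tendsto_intros a_lim)
        then show "(\<lambda>n. \<bar>a r n x\<bar> * indicator (ball 0 R) x) \<longlonglongrightarrow> 0" by simp
      qed
    qed (use cint bd in \<open>auto split: split_indicator\<close>)
    then show ?thesis by simp
  qed
  \<comment> \<open>The ball mean averages translates by vectors shorter than \<open>r\<close>, and
    each of these moves \<open>g n\<close> by at most \<open>r * M\<close> in L^1. The estimate uses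
    nonnegative integrals because integrability of the difference is derived from it.\<close>
  have close: "(\<integral>\<^sup>+x. ennreal \<bar>g n x - a r n x\<bar> \<partial>lborel) \<le> ennreal (r * M)" if r: "0 < r" for r n
  proof -
    let ?I = "indicator (ball 0 r) :: real^'d \<Rightarrow> real"
    have pt: "ennreal \<bar>g n x - a r n x\<bar> \<le> ennreal (1 / V r) * (\<integral>\<^sup>+z. ennreal (\<bar>g n (x + z) - g n x\<bar> * ?I z) \<partial>lborel)" for x
    proof -
      have i: "integrable lborel (\<lambda>z. \<bar>g n (x + z) * ?I z - g n x * ?I z\<bar>)"
        by (intro integrable_abs Bochner_Integration.integrable_diff gint cint)
      have eq: "\<bar>g n (x + z) * ?I z - g n x * ?I z\<bar> = \<bar>g n (x + z) - g n x\<bar> * ?I z" for z by (simp add: indicator_def)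
      have "V r * (a r n x - g n x) = (\<integral>z. g n (x + z) * ?I z \<partial>lborel) - (\<integral>z. g n x * ?I z \<partial>lborel)"
        using Vpos[OF r] emeasure_lborel_ball_finite[of "0::real^'d" r] by (simp add: a_def right_diff_distrib V_def)
      also have "\<dots> = (\<integral>z. g n (x + z) * ?I z - g n x * ?I z \<partial>lborel)"
        by (rule Bochner_Integration.integral_diff[OF gint cint, symmetric])
      finally have "V r * \<bar>g n x - a r n x\<bar> = \<bar>\<integral>z. g n (x + z) * ?I z - g n x * ?I z \<partial>lborel\<bar>"
        using abs_mult[of "V r" "a r n x - g n x"] Vpos[OF r] by (simp add: abs_minus_commute)
      also have "\<dots> \<le> (\<integral>z. \<bar>g n (x + z) * ?I z - g n x * ?I z\<bar> \<partial>lborel)" by (rule integral_abs_bound)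
      finally have "V r * \<bar>g n x - a r n x\<bar> \<le> (\<integral>z. \<bar>g n (x + z) - g n x\<bar> * ?I z \<partial>lborel)" by (simp only: eq)
      then have "\<bar>g n x - a r n x\<bar> \<le> 1 / V r * (\<integral>z. \<bar>g n (x + z) - g n x\<bar> * ?I z \<partial>lborel)"
        using Vpos[OF r] by (simp add: field_simps)
      then have "ennreal \<bar>g n x - a r n x\<bar> \<le> ennreal (1 / V r * (\<integral>z. \<bar>g n (x + z) - g n x\<bar> * ?I z \<partial>lborel))"
        by (rule ennreal_leI)
      also have "\<dots> = ennreal (1 / V r) * ennreal (\<integral>z. \<bar>g n (x + z) - g n x\<bar> * ?I z \<partial>lborel)"
        using Vpos[OF r] by (intro ennreal_mult) (auto intro!: integral_nonneg_AE)
      also have "ennreal (\<integral>z. \<bar>g n (x + z) - g n x\<bar> * ?I z \<partial>lborel) = (\<integral>\<^sup>+z. ennreal (\<bar>g n (x + z) - g n x\<bar> * ?I z) \<partial>lborel)"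
        using i unfolding eq by (intro nn_integral_eq_integral[symmetric]) auto
      finally show ?thesis .
    qed
    have "(\<integral>\<^sup>+x. ennreal \<bar>g n x - a r n x\<bar> \<partial>lborel) \<le>
        (\<integral>\<^sup>+x. ennreal (1 / V r) * (\<integral>\<^sup>+z. ennreal (\<bar>g n (x + z) - g n x\<bar> * ?I z) \<partial>lborel) \<partial>lborel)"
      by (intro nn_integral_mono pt)
    also have "\<dots> = ennreal (1 / V r) * (\<integral>\<^sup>+x. \<integral>\<^sup>+z. ennreal (\<bar>g n (x + z) - g n x\<bar> * ?I z) \<partial>lborel \<partial>lborel)"
      by (rule nn_integral_cmult) measurable
    also have "(\<integral>\<^sup>+x. \<integral>\<^sup>+z. ennreal (\<bar>g n (x + z) - g n x\<bar> * ?I z) \<partial>lborel \<partial>lborel) =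
        (\<integral>\<^sup>+z. \<integral>\<^sup>+x. ennreal (\<bar>g n (x + z) - g n x\<bar> * ?I z) \<partial>lborel \<partial>lborel)"
      by (rule lborel_pair.Fubini') measurable
    also have "\<dots> \<le> (\<integral>\<^sup>+z. ennreal (r * M) * indicator (ball 0 r) (z :: real^'d) \<partial>lborel)"
    proof (rule nn_integral_mono)
      fix z :: "real^'d"
      show "(\<integral>\<^sup>+x. ennreal (\<bar>g n (x + z) - g n x\<bar> * ?I z) \<partial>lborel) \<le> ennreal (r * M) * indicator (ball 0 r) z"
      proof (cases "z \<in> ball 0 r")
        case True
        have "(\<integral>\<^sup>+x. ennreal (\<bar>g n (x + z) - g n x\<bar> * ?I z) \<partial>lborel) = ennreal (\<integral>x. \<bar>g n (x + z) - g n x\<bar> \<partial>lborel)"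
          using True transi[of n z] by (subst nn_integral_eq_integral) auto
        also have "\<dots> \<le> ennreal (norm z * M)" by (intro ennreal_leI trans)
        also have "\<dots> \<le> ennreal (r * M)" using True M0 by (intro ennreal_leI mult_right_mono) auto
        finally show ?thesis using True by simp
      qed simp
    qed
    also have "\<dots> = ennreal (r * M) * ennreal (V r)"
      using emeasure_lborel_ball_finite[of "0::real^'d" r]
      by (subst nn_integral_cmult_indicator) (auto simp: V_def emeasure_eq_ennreal_measure)
    also have "ennreal (1 / V r) * (ennreal (r * M) * ennreal (V r)) = ennreal (1 / V r * (r * M * V r))"
      using Vpos[OF r] M0 r by (simp add: ennreal_mult[symmetric])
    also have "\<dots> = ennreal (r * M)" using Vpos[OF r] by simp
    finally show ?thesis by (simp add: mult_left_mono)
  qed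
  show ?thesis
  proof (rule tendstoI)
    fix e :: real assume e: "0 < e"
    \<comment> \<open>This makes \<open>r * M\<close> smaller than e/2; adding 1 excludes division
      by zero.\<close>
    define r where "r = e / (2 * (M + 1))"
    have r: "0 < r" using e M0 by (simp add: r_def)
    have rM: "r * M < e / 2" using e M0 by (simp add: r_def field_simps)
    have "eventually (\<lambda>n. (\<integral>x. \<bar>a r n x\<bar> * indicator (ball 0 R) x \<partial>lborel) < e / 2) sequentially"
      using order_tendstoD(2)[OF a_L1[OF r], of "e/2"] e by simp
    then show "\<forall>\<^sub>F n in sequentially. dist (\<integral>x. \<bar>g n x\<bar> * indicator (ball 0 R) x \<partial>lborel) 0 < e"
    proof eventually_elim
      case (elim n)
      have i: "integrable lborel (\<lambda>x. \<bar>g n x - a r n x\<bar>)"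
        using close[OF r, of n] by (intro integrableI_bounded) (auto simp: order_le_less_trans)
      have le: "(\<integral>x. \<bar>g n x - a r n x\<bar> \<partial>lborel) \<le> r * M"
        using close[OF r, of n] r M0 unfolding nn_integral_eq_integral[OF i AE_I2[OF abs_ge_zero]] by simp
      have gi: "integrable lborel (\<lambda>x. \<bar>g n x\<bar> * indicator (ball 0 R) x)"
        using integrable_mult_indicator[of "ball 0 R" lborel "\<lambda>x. \<bar>g n x\<bar>"] g(2) by (simp add: mult.commute)
      have ii: "integrable lborel (\<lambda>x. \<bar>a r n x\<bar> * indicator (ball 0 R) x)"
      proof (rule Bochner_Integration.integrable_bound)
        show "integrable lborel (\<lambda>x. \<bar>g n x\<bar> + \<bar>g n x - a r n x\<bar>)" using g(2) i by auto
      qed (auto split: split_indicator)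
      have "(\<integral>x. \<bar>g n x\<bar> * indicator (ball 0 R) x \<partial>lborel) \<le> (\<integral>x. \<bar>a r n x\<bar> * indicator (ball 0 R) x + \<bar>g n x - a r n x\<bar> \<partial>lborel)"
        by (intro integral_mono gi Bochner_Integration.integrable_add ii i) (auto split: split_indicator)
      also have "\<dots> = (\<integral>x. \<bar>a r n x\<bar> * indicator (ball 0 R) x \<partial>lborel) + (\<integral>x. \<bar>g n x - a r n x\<bar> \<partial>lborel)"
        by (rule Bochner_Integration.integral_add[OF ii i])
      finally have "(\<integral>x. \<bar>g n x\<bar> * indicator (ball 0 R) x \<partial>lborel) < e" using elim le rM by linarith
      moreover have "0 \<le> (\<integral>x. \<bar>g n x\<bar> * indicator (ball 0 R) x \<partial>lborel)" by (rule integral_nonneg_AE) auto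
      ultimately show ?case by simp
    qed
  qed
qed

section \<open>Directional variation\<close>

text \<open>The total variation of the directional derivative of \<open>u\<close> along
  \<open>e\<close>, for (\<mu>, \<sigma>) the gradient of \<open>u\<close>.\<close>

definition dvar :: "'a::euclidean_space measure \<Rightarrow> ('a \<Rightarrow> 'a) \<Rightarrow> 'a \<Rightarrow> 'a measure" where
  "dvar \<mu> \<sigma> e = density \<mu> (\<lambda>x. ennreal \<bar>e \<bullet> \<sigma> x\<bar>)"

context
  fixes \<mu> :: "'a::euclidean_space measure" and \<sigma>
  assumes p: "polar \<mu> \<sigma>"
begin

lemma polar_borel_measurable_iff: "f \<in> borel_measurable \<mu> \<longleftrightarrow> f \<in> borel_measurable borel"
  using measurable_cong_sets[OF polar_sets[OF p] refl] by blast

lemma polar_component_measurable: "(\<lambda>x. e \<bullet> \<sigma> x) \<in> borel_measurable \<mu>"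
  unfolding polar_borel_measurable_iff
  by (intro borel_measurable_inner borel_measurable_const) (use p in \<open>simp add: polar_def\<close>)

lemma sets_dvar: "sets (dvar \<mu> \<sigma> e) = sets borel"
  by (simp add: dvar_def polar_sets[OF p])

lemma polar_component_le: "\<bar>e \<bullet> \<sigma> x\<bar> \<le> norm e"
  using Cauchy_Schwarz_ineq2[of e "\<sigma> x"] polar_norm[OF p, of x] by simp

lemma polar_component_integrable:
  assumes "A \<in> sets borel" shows "integrable \<mu> (\<lambda>x. indicator A x * \<bar>e \<bullet> \<sigma> x\<bar>)"
proof (rule integrable_bounded_borel_fm[OF polar_finite[OF p] polar_sets[OF p]])
  have "bounded_borel (\<lambda>x. \<bar>e \<bullet> \<sigma> x\<bar>)"
    by (rule bounded_borelI[of _ "norm e"]) (use polar_component_le p in \<open>auto simp: polar_def\<close>)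
  then show "bounded_borel (\<lambda>x. indicator A x * \<bar>e \<bullet> \<sigma> x\<bar>)"
    by (intro bounded_borel_mult bounded_borel_indicator assms)
qed

lemma emeasure_dvar:
  assumes A: "A \<in> sets borel"
  shows "emeasure (dvar \<mu> \<sigma> e) A = ennreal (\<integral>x. indicator A x * \<bar>e \<bullet> \<sigma> x\<bar> \<partial>\<mu>)"
proof -
  have "emeasure (dvar \<mu> \<sigma> e) A = (\<integral>\<^sup>+x. ennreal \<bar>e \<bullet> \<sigma> x\<bar> * indicator A x \<partial>\<mu>)"
    unfolding dvar_def by (rule emeasure_density) (use polar_component_measurable A polar_sets[OF p] in auto)
  also have "\<dots> = (\<integral>\<^sup>+x. ennreal (indicator A x * \<bar>e \<bullet> \<sigma> x\<bar>) \<partial>\<mu>)"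
    by (intro nn_integral_cong) (auto split: split_indicator)
  also have "\<dots> = ennreal (\<integral>x. indicator A x * \<bar>e \<bullet> \<sigma> x\<bar> \<partial>\<mu>)"
    by (rule nn_integral_eq_integral[OF polar_component_integrable[OF A]]) auto
  finally show ?thesis .
qed

lemma measure_dvar:
  assumes A: "A \<in> sets borel"
  shows "measure (dvar \<mu> \<sigma> e) A = (\<integral>x. indicator A x * \<bar>e \<bullet> \<sigma> x\<bar> \<partial>\<mu>)"
  unfolding measure_def emeasure_dvar[OF A] by (rule enn2real_ennreal) (auto intro: integral_nonneg_AE)

lemma finite_measure_dvar: "finite_measure (dvar \<mu> \<sigma> e)"
  by (rule finite_measureI) (use emeasure_dvar[of UNIV e] sets_eq_imp_space_eq[OF sets_dvar] in auto)

lemma dvar_le: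
  assumes A: "A \<in> sets borel" and e: "norm e = 1"
  shows "measure (dvar \<mu> \<sigma> e) A \<le> measure \<mu> A"
proof -
  interpret finite_measure \<mu> using polarD[OF p] by simp
  have "measure (dvar \<mu> \<sigma> e) A \<le> (\<integral>x. indicator A x \<partial>\<mu>)"
    unfolding measure_dvar[OF A]
  proof (rule integral_mono[OF polar_component_integrable[OF A]])
    show "integrable \<mu> (indicator A :: 'a \<Rightarrow> real)"
      by (rule integrable_bounded_borel_fm[OF polar_finite[OF p] polar_sets[OF p] bounded_borel_indicator[OF A]])
  qed (use polar_component_le[of e] e in \<open>auto split: split_indicator\<close>)
  then show ?thesis using A polarD[OF p] by simp
qed

text \<open>A unit vector has l^1 norm at least 1.\<close>

lemma measure_le_sum_dvar:
  assumes A: "A \<in> sets borel"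
  shows "measure \<mu> A \<le> (\<Sum>e\<in>Basis. measure (dvar \<mu> \<sigma> e) A)"
proof -
  interpret finite_measure \<mu> using polarD[OF p] by simp
  have "measure \<mu> A = (\<integral>x. indicator A x \<partial>\<mu>)" using A polarD[OF p] by simp
  also have "\<dots> \<le> (\<integral>x. (\<Sum>e\<in>Basis. indicator A x * \<bar>e \<bullet> \<sigma> x\<bar>) \<partial>\<mu>)"
  proof (rule integral_mono)
    show "integrable \<mu> (indicator A :: 'a \<Rightarrow> real)"
      by (rule integrable_bounded_borel_fm[OF polar_finite[OF p] polar_sets[OF p] bounded_borel_indicator[OF A]])
    fix x
    have "1 \<le> (\<Sum>e\<in>Basis. \<bar>e \<bullet> \<sigma> x\<bar>)"
      using norm_le_l1[of "\<sigma> x"] polar_norm[OF p, of x] by (simp add: inner_commute)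
    then show "indicator A x \<le> (\<Sum>e\<in>Basis. indicator A x * \<bar>e \<bullet> \<sigma> x\<bar>)"
      by (simp add: sum_distrib_left[symmetric] split: split_indicator)
  qed (intro Bochner_Integration.integrable_sum polar_component_integrable A)
  also have "\<dots> = (\<Sum>e\<in>Basis. measure (dvar \<mu> \<sigma> e) A)"
    unfolding measure_dvar[OF A] by (intro Bochner_Integration.integral_sum polar_component_integrable A)
  finally show ?thesis .
qed

end

section \<open>Null unions of parallel lines\<close>

lemma line_avg_tendsto:
  assumes \<phi>: "Cc1 \<phi>"
  shows "(\<lambda>k. line_avg \<phi> ((1 / real (Suc k)) *\<^sub>R e) x) \<longlonglongrightarrow> \<phi> x"
proof -
  note b = bounded_borel_Cc1[OF \<phi>]
  obtain B where B: "0 \<le> B" "\<And>x. \<bar>\<phi> x\<bar> \<le> B" using bounded_borel_bound[OF b] by auto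
  note [measurable] = bounded_borel_measurable[OF b]
  have "(\<lambda>k. line_avg \<phi> ((1 / real (Suc k)) *\<^sub>R e) x) \<longlonglongrightarrow> (\<integral>s. \<phi> x * indicator {0..1::real} s \<partial>lborel)"
    unfolding line_avg_def
  proof (rule integral_dominated_convergence[where w = "\<lambda>s. B * indicator {0..1} s"])
    show "AE s in lborel. (\<lambda>k. \<phi> (x + s *\<^sub>R (1 / real (Suc k)) *\<^sub>R e) * indicator {0..1} s) \<longlonglongrightarrow> \<phi> x * indicator {0..1} s"
    proof (rule AE_I2)
      fix s :: real
      have "(\<lambda>k. x + s *\<^sub>R (1 / real (Suc k)) *\<^sub>R e) \<longlonglongrightarrow> x + s *\<^sub>R 0 *\<^sub>R e"
        using LIMSEQ_inverse_real_of_nat by (intro tendsto_intros) (simp add: inverse_eq_divide)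
      then have "(\<lambda>k. x + s *\<^sub>R (1 / real (Suc k)) *\<^sub>R e) \<longlonglongrightarrow> x" by simp
      moreover have "isCont \<phi> x" using Cc1_continuous[OF \<phi>, of UNIV] by (simp add: continuous_on_eq_continuous_at)
      ultimately have "(\<lambda>k. \<phi> (x + s *\<^sub>R (1 / real (Suc k)) *\<^sub>R e)) \<longlonglongrightarrow> \<phi> x" by (rule isCont_tendsto_compose[rotated])
      then show "(\<lambda>k. \<phi> (x + s *\<^sub>R (1 / real (Suc k)) *\<^sub>R e) * indicator {0..1} s) \<longlonglongrightarrow> \<phi> x * indicator {0..1} s"
        by (intro tendsto_mult tendsto_const)
    qed
  qed (use B in \<open>auto split: split_indicator\<close>)
  then show ?thesis by simp
qed

text \<open>Apply the shift formula along \<open>e\<close> to the indicator of \<open>C\<close>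
  times \<phi>. The left side vanishes because \<open>C\<close> is Lebesgue null, and invariance of
  \<open>C\<close> pulls its indicator out of the line average. Letting the shift tend to 0 shows
  that the component along \<open>e\<close>, restricted to \<open>C\<close>, annihilates all test
  functions, hence all bounded Borel functions, in particular its own sign.\<close>

lemma dvar_null_cylinder:
  fixes u :: "real^'d \<Rightarrow> real"
  assumes u: "grad_measure u \<mu> \<sigma>" "integrable lebesgue u"
    and C: "C \<in> sets borel" "emeasure lborel C = 0" "\<And>x t. x + t *\<^sub>R e \<in> C \<longleftrightarrow> x \<in> C"
  shows "measure (dvar \<mu> \<sigma> e) C = 0"
proof -
  note p = grad_measure_polar[OF u(1)]
  have iC: "bounded_borel (indicator C :: real^'d \<Rightarrow> real)" by (rule bounded_borel_indicator[OF C(1)])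
  have w: "bounded_borel (\<lambda>x. indicator C x * (e \<bullet> \<sigma> x))"
    by (intro bounded_borel_mult iC bounded_borel_inner bounded_borel_const polar_bounded_borel[OF p])
  define T where "T \<phi> = (\<integral>x. \<phi> x * (indicator C x * (e \<bullet> \<sigma> x)) \<partial>\<mu>)" for \<phi>
  have T: "sigma_functional T" unfolding T_def
    by (rule sigma_functional_integral[OF measurable_ident_sets[OF polar_sets[OF p]]
          integrable_bounded_borel_fm[OF polar_finite[OF p] polar_sets[OF p] w]])
  have avg0: "T (line_avg \<phi> (h *\<^sub>R e)) = 0" if \<phi>: "bounded_borel \<phi>" and h: "h \<noteq> 0" for \<phi> h
  proof -
    have inv: "indicator C (x + t *\<^sub>R h *\<^sub>R e) = (indicator C x :: real)" for x t
      using C(3)[of x "t * h"] by (simp add: indicator_def)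
    have av: "line_avg (\<lambda>x. indicator C x * \<phi> x) (h *\<^sub>R e) x = indicator C x * line_avg \<phi> (h *\<^sub>R e) x" for x
      unfolding line_avg_def inv by (simp add: mult.assoc)
    have "AE x in lebesgue. x \<notin> C"
      using C(1,2) by (intro AE_completion AE_not_in) (auto simp: null_sets_def)
    then have "AE x in lebesgue. u x * (indicator C (x + h *\<^sub>R e) * \<phi> (x + h *\<^sub>R e) - indicator C x * \<phi> x) = 0"
      by eventually_elim (use inv[of _ 1] in \<open>simp add: indicator_def\<close>)
    then have "0 = (\<integral>x. u x * (indicator C (x + h *\<^sub>R e) * \<phi> (x + h *\<^sub>R e) - indicator C x * \<phi> x) \<partial>lebesgue)"
      by (simp add: integral_eq_zero_AE)
    also have "\<dots> = - (\<integral>x. (line_avg (\<lambda>x. indicator C x * \<phi> x) (h *\<^sub>R e) x *\<^sub>R h *\<^sub>R e) \<bullet> \<sigma> x \<partial>\<mu>)"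
      by (rule grad_measure_shift[OF u]) (intro bounded_borel_mult iC \<phi>)
    also have "(\<integral>x. (line_avg (\<lambda>x. indicator C x * \<phi> x) (h *\<^sub>R e) x *\<^sub>R h *\<^sub>R e) \<bullet> \<sigma> x \<partial>\<mu>) =
        (\<integral>x. h * (line_avg \<phi> (h *\<^sub>R e) x * (indicator C x * (e \<bullet> \<sigma> x))) \<partial>\<mu>)"
      unfolding av by (intro Bochner_Integration.integral_cong) auto
    also have "\<dots> = h * T (line_avg \<phi> (h *\<^sub>R e))" unfolding T_def by simp
    finally show ?thesis using h by simp
  qed
  have "T (\<lambda>x. sgn (e \<bullet> \<sigma> x)) = 0"
  proof (rule sigma_functional_eq_0[OF T])
    fix \<phi> :: "real^'d \<Rightarrow> real" assume \<phi>: "Cc1 \<phi>"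
    note b = bounded_borel_Cc1[OF \<phi>]
    obtain B where B: "\<And>x. \<bar>\<phi> x\<bar> \<le> B" using bounded_borel_bound[OF b] by auto
    have "(\<lambda>k. T (line_avg \<phi> ((1 / real (Suc k)) *\<^sub>R e))) \<longlonglongrightarrow> T \<phi>"
      by (rule sigma_functional_lim[OF T _ _ line_avg_tendsto[OF \<phi>]])
        (use bounded_borel_measurable[OF bounded_borel_line_avg[OF b]] line_avg_le[OF b] B in blast)+
    moreover have "T (line_avg \<phi> ((1 / real (Suc k)) *\<^sub>R e)) = 0" for k by (rule avg0[OF b]) simp
    ultimately show "T \<phi> = 0" by (simp add: LIMSEQ_const_iff)
  next
    have "(\<lambda>x. sgn (e \<bullet> \<sigma> x)) \<in> borel_measurable borel"
      using p by (auto simp: polar_def)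
    then show "bounded_borel (\<lambda>x. sgn (e \<bullet> \<sigma> x))" by (rule bounded_borelI[of _ 1]) (simp add: sgn_if)
  qed
  moreover have "T (\<lambda>x. sgn (e \<bullet> \<sigma> x)) = measure (dvar \<mu> \<sigma> e) C"
    unfolding T_def measure_dvar[OF p C(1)]
    by (intro Bochner_Integration.integral_cong) (auto simp: indicator_def sgn_if)
  ultimately show ?thesis by simp
qed

text \<open>Integrate the \<nu>-measure of \<open>ball x (2 * \<rho>)\<close> over \<open>x\<close>.
  By Fubini the result is the volume of a ball of radius \<open>2 * \<rho>\<close> times the total
  mass; on the neighbourhood of \<open>E\<close> the integrand is at least
  \<open>c * \<rho> ^ (d - 1)\<close>, since that ball contains a ball of radius \<rho> about a
  point of \<open>E\<close>. One power of \<rho> remains.\<close>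

lemma neighbourhood_volume:
  fixes \<nu> :: "('a::euclidean_space) measure"
  assumes \<nu>: "finite_measure \<nu>" "sets \<nu> = sets borel" and c: "0 < c" and \<rho>: "0 < \<rho>"
    and E: "\<And>x. x \<in> E \<Longrightarrow> c * \<rho> ^ (DIM('a) - 1) \<le> measure \<nu> (ball x \<rho>)"
  shows "emeasure lborel (\<Union>x\<in>E. ball x \<rho>) \<le> ennreal (\<rho> * (2 ^ DIM('a) * unit_ball_vol (DIM('a)) * measure \<nu> UNIV / c))"
proof -
  interpret \<nu>: finite_measure \<nu> by fact
  interpret pair_sigma_finite lborel \<nu> ..
  let ?d = "DIM('a)" and ?U = "\<Union>x\<in>E. ball x \<rho>"
  have U: "?U \<in> sets borel" by (intro borel_open open_UN) auto
  have q: "0 < c * \<rho> ^ (?d - 1)" using c \<rho> by simp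
  let ?k = "ennreal (1 / (c * \<rho> ^ (?d - 1)))"
  have id\<nu>: "(\<lambda>x. x) \<in> \<nu> \<rightarrow>\<^sub>M borel" by (rule measurable_ident_sets[OF \<nu>(2)])
  have [measurable]: "(\<lambda>(x, y). indicator (ball x (2 * \<rho>)) y :: ennreal) \<in> borel_measurable (lborel \<Otimes>\<^sub>M \<nu>)"
  proof -
    have "(\<lambda>z. (fst z, snd z)) \<in> lborel \<Otimes>\<^sub>M \<nu> \<rightarrow>\<^sub>M borel \<Otimes>\<^sub>M borel"
      using measurable_compose[OF measurable_snd id\<nu>] by measurable
    moreover have "(\<lambda>(x, y). indicator (ball x (2 * \<rho>)) y :: ennreal) \<in> borel_measurable (borel \<Otimes>\<^sub>M (borel :: 'a measure))"
    proof -
      have "(\<lambda>(x::'a, y). indicator (ball x (2 * \<rho>)) y :: ennreal) = (\<lambda>(x, y). if dist x y < 2 * \<rho> then 1 else 0)"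
        by (auto simp: indicator_def fun_eq_iff)
      then show ?thesis by (simp only:) measurable
    qed
    ultimately show ?thesis by (auto dest: measurable_compose)
  qed
  have pt: "indicator ?U x \<le> ?k * (\<integral>\<^sup>+y. indicator (ball x (2 * \<rho>)) y \<partial>\<nu>)" for x
  proof (cases "x \<in> ?U")
    case True
    then obtain z where z: "z \<in> E" "dist z x < \<rho>" by auto
    have "ball z \<rho> \<subseteq> ball x (2 * \<rho>)"
    proof
      fix y assume "y \<in> ball z \<rho>"
      then show "y \<in> ball x (2 * \<rho>)" using dist_triangle[of x y z] z by (simp add: dist_commute)
    qed
    then have "measure \<nu> (ball z \<rho>) \<le> measure \<nu> (ball x (2 * \<rho>))"
      by (rule \<nu>.finite_measure_mono) (simp add: \<nu>)
    then have "c * \<rho> ^ (?d - 1) \<le> measure \<nu> (ball x (2 * \<rho>))" using E[OF z(1)] by linarith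
    then have "1 \<le> 1 / (c * \<rho> ^ (?d - 1)) * measure \<nu> (ball x (2 * \<rho>))" using q by (simp add: field_simps)
    then have "1 \<le> ennreal (1 / (c * \<rho> ^ (?d - 1)) * measure \<nu> (ball x (2 * \<rho>)))" by (metis ennreal_1 ennreal_leI)
    also have "\<dots> = ?k * ennreal (measure \<nu> (ball x (2 * \<rho>)))"
      using q by (intro ennreal_mult) auto
    also have "ennreal (measure \<nu> (ball x (2 * \<rho>))) = (\<integral>\<^sup>+y. indicator (ball x (2 * \<rho>)) y \<partial>\<nu>)"
      using \<nu>(2) by (simp add: \<nu>.emeasure_eq_measure)
    finally show ?thesis by (simp add: indicator_def)
  qed simp
  have "emeasure lborel ?U = (\<integral>\<^sup>+x. indicator ?U x \<partial>lborel)" using U by simp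
  also have "\<dots> \<le> (\<integral>\<^sup>+x. ?k * (\<integral>\<^sup>+y. indicator (ball x (2 * \<rho>)) y \<partial>\<nu>) \<partial>lborel)"
    by (rule nn_integral_mono[OF pt])
  also have "\<dots> = ?k * (\<integral>\<^sup>+x. \<integral>\<^sup>+y. indicator (ball x (2 * \<rho>)) y \<partial>\<nu> \<partial>lborel)"
    by (rule nn_integral_cmult) measurable
  also have "(\<integral>\<^sup>+x. \<integral>\<^sup>+y. indicator (ball x (2 * \<rho>)) y \<partial>\<nu> \<partial>lborel) = (\<integral>\<^sup>+y. \<integral>\<^sup>+x. indicator (ball x (2 * \<rho>)) y \<partial>lborel \<partial>\<nu>)"
    by (rule Fubini'[symmetric]) measurable
  also have "\<dots> = (\<integral>\<^sup>+y. ennreal ((2 * \<rho>) ^ ?d * unit_ball_vol ?d) \<partial>\<nu>)"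
  proof (rule nn_integral_cong)
    fix y :: 'a
    have "(\<integral>\<^sup>+x. indicator (ball x (2 * \<rho>)) y \<partial>lborel) = (\<integral>\<^sup>+x. indicator (ball y (2 * \<rho>)) x \<partial>lborel)"
      by (intro nn_integral_cong) (auto simp: indicator_def dist_commute)
    also have "\<dots> = ennreal ((2 * \<rho>) ^ ?d * unit_ball_vol ?d)"
      using \<rho> emeasure_ball[of "2 * \<rho>" y] by (simp add: mult.commute)
    finally show "(\<integral>\<^sup>+x. indicator (ball x (2 * \<rho>)) y \<partial>lborel) = ennreal ((2 * \<rho>) ^ ?d * unit_ball_vol ?d)" .
  qed
  also have "\<dots> = ennreal ((2 * \<rho>) ^ ?d * unit_ball_vol ?d) * ennreal (measure \<nu> UNIV)"
    using sets_eq_imp_space_eq[OF \<nu>(2)] by (simp add: \<nu>.emeasure_eq_measure)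
  also have "?k * (ennreal ((2 * \<rho>) ^ ?d * unit_ball_vol ?d) * ennreal (measure \<nu> UNIV)) =
      ennreal (1 / (c * \<rho> ^ (?d - 1)) * ((2 * \<rho>) ^ ?d * unit_ball_vol ?d * measure \<nu> UNIV))"
  proof -
    have "ennreal a * (ennreal b * ennreal m) = ennreal (a * (b * m))" if "0 \<le> a" "0 \<le> b" "0 \<le> m" for a b m
      using that by (simp add: ennreal_mult)
    from this[of "1 / (c * \<rho> ^ (?d - 1))" "(2 * \<rho>) ^ ?d * unit_ball_vol ?d" "measure \<nu> UNIV"]
    show ?thesis using q \<rho> by (simp only: mult.assoc) simp
  qed
  also have "1 / (c * \<rho> ^ (?d - 1)) * ((2 * \<rho>) ^ ?d * unit_ball_vol ?d * measure \<nu> UNIV) =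
      \<rho> * (2 ^ ?d * unit_ball_vol ?d * measure \<nu> UNIV / c)"
  proof -
    have "\<rho> ^ ?d = \<rho> * \<rho> ^ (?d - 1)" by (metis DIM_positive Suc_diff_1 power_Suc)
    then show ?thesis using \<rho> c by (simp add: power_mult_distrib field_simps)
  qed
  finally show ?thesis .
qed

section \<open>Lines meeting a set of small content\<close>

lemma compact_approximation:
  fixes \<nu> :: "('a::euclidean_space) measure"
  assumes \<nu>: "finite_measure \<nu>" "sets \<nu> = sets borel" and B: "B \<in> sets borel" and \<delta>: "0 < \<delta>"
  shows "\<exists>K\<subseteq>B. compact K \<and> measure \<nu> (B - K) < \<delta>"
proof -
  interpret finite_measure \<nu> by fact
  have sup: "emeasure \<nu> B = (SUP K\<in>{K. K \<subseteq> B \<and> compact K}. emeasure \<nu> K)"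
    by (rule inner_regular[OF \<nu>(2) _ B]) (use emeasure_finite in simp)
  show ?thesis
  proof (cases "measure \<nu> B < \<delta>")
    case True then show ?thesis by (intro exI[of _ "{}"]) simp
  next
    case False
    have "ennreal (measure \<nu> B - \<delta>) < emeasure \<nu> B"
      using False \<delta> by (simp add: emeasure_eq_measure ennreal_less_iff)
    then obtain K where K: "K \<subseteq> B" "compact K" "ennreal (measure \<nu> B - \<delta>) < emeasure \<nu> K"
      using sup by (auto simp: less_SUP_iff)
    have "measure \<nu> B - \<delta> < measure \<nu> K"
      using K(3) False by (simp add: emeasure_eq_measure ennreal_less_iff)
    moreover have "measure \<nu> (B - K) = measure \<nu> B - measure \<nu> K"
      by (rule finite_measure_Diff) (use B K \<nu> in \<open>auto intro: borel_compact\<close>)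
    ultimately show ?thesis using K by auto
  qed
qed

text \<open>A set of whole lines, not of points of \<open>E\<close>: the parameter \<open>s\<close>
  frees \<open>x\<close> to be anywhere on its line. This is the invariance demanded by
  \<open>dvar_null_cylinder\<close>.\<close>

definition near_pairs :: "'a::euclidean_space set \<Rightarrow> 'a \<Rightarrow> nat \<Rightarrow> 'a set" where
  "near_pairs E e m = {x. \<exists>s t. 0 < \<bar>t\<bar> \<and> \<bar>t\<bar> \<le> 1 / real (Suc m) \<and> x + s *\<^sub>R e \<in> E \<and> x + (s + t) *\<^sub>R e \<in> E}"

text \<open>A projection of a Borel set need not be Borel. Bounding |t| away from 0 and bounding |s|
  writes this one as a countable union of continuous images of compact sets.\<close>

lemma near_pairs_borel:
  assumes E: "compact E" shows "near_pairs E e m \<in> sets borel"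
proof -
  define W where "W k N = {z \<in> E \<times> ({t. 1 / real (Suc k) \<le> \<bar>t\<bar> \<and> \<bar>t\<bar> \<le> 1 / real (Suc m)} \<times> {- real N..real N}).
     fst z + fst (snd z) *\<^sub>R e \<in> E}" for k N :: nat
  define f where "f z = fst z - snd (snd z) *\<^sub>R e" for z :: "'a \<times> real \<times> real"
  have "compact (W k N)" for k N
  proof -
    have c: "closed {t::real. 1 / real (Suc k) \<le> \<bar>t\<bar> \<and> \<bar>t\<bar> \<le> 1 / real (Suc m)}"
      by (intro closed_Collect_conj closed_Collect_le continuous_intros)
    have "bounded {t::real. 1 / real (Suc k) \<le> \<bar>t\<bar> \<and> \<bar>t\<bar> \<le> 1 / real (Suc m)}"
      by (rule boundedI[of _ "1 / real (Suc m)"]) auto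
    with c have "compact {t::real. 1 / real (Suc k) \<le> \<bar>t\<bar> \<and> \<bar>t\<bar> \<le> 1 / real (Suc m)}"
      by (simp add: compact_eq_bounded_closed)
    then have 1: "compact (E \<times> ({t. 1 / real (Suc k) \<le> \<bar>t\<bar> \<and> \<bar>t\<bar> \<le> 1 / real (Suc m)} \<times> {- real N..real N}))"
      using E by (intro compact_Times compact_Icc)
    have "closed ((\<lambda>z::'a \<times> real \<times> real. fst z + fst (snd z) *\<^sub>R e) -` E)"
      by (intro closed_vimage compact_imp_closed E continuous_intros)
    from compact_Int_closed[OF 1 this] show ?thesis
      by (rule back_subst[of compact]) (auto simp: W_def)
  qed
  then have "compact (f ` W k N)" for k N
    by (intro compact_continuous_image) (auto simp: f_def intro!: continuous_intros)
  then have "f ` W k N \<in> sets borel" for k N by (rule borel_compact)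
  then have "(\<Union>k. \<Union>N. f ` W k N) \<in> sets borel" by auto
  moreover have "near_pairs E e m = (\<Union>k. \<Union>N. f ` W k N)"
  proof (intro equalityI subsetI)
    fix x assume "x \<in> near_pairs E e m"
    then obtain s t where st: "0 < \<bar>t\<bar>" "\<bar>t\<bar> \<le> 1 / real (Suc m)" "x + s *\<^sub>R e \<in> E" "x + (s + t) *\<^sub>R e \<in> E"
      by (auto simp: near_pairs_def)
    obtain k where k: "1 / real (Suc k) < \<bar>t\<bar>" using nat_approx_posE[OF st(1)] by blast
    obtain N where N: "\<bar>s\<bar> \<le> real N" using real_arch_simple by blast
    have "(x + s *\<^sub>R e, t, s) \<in> W k N"
      using st k N by (auto simp: W_def scaleR_add_left add.assoc abs_le_iff)
    moreover have "x = f (x + s *\<^sub>R e, t, s)" by (simp add: f_def)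
    ultimately show "x \<in> (\<Union>k. \<Union>N. f ` W k N)" by blast
  next
    fix x assume "x \<in> (\<Union>k. \<Union>N. f ` W k N)"
    then obtain k N q t s where z: "(q, t, s) \<in> W k N" "x = q - s *\<^sub>R e" by (auto simp: f_def)
    have "0 < 1 / real (Suc k)" by simp
    moreover have "1 / real (Suc k) \<le> \<bar>t\<bar>" "\<bar>t\<bar> \<le> 1 / real (Suc m)" "q \<in> E" "q + t *\<^sub>R e \<in> E"
      using z(1) by (auto simp: W_def)
    ultimately have "0 < \<bar>t\<bar>" by linarith
    moreover have "x + s *\<^sub>R e = q" "x + (s + t) *\<^sub>R e = q + t *\<^sub>R e"
      using z(2) by (auto simp: scaleR_add_left)
    ultimately show "x \<in> near_pairs E e m"
      unfolding near_pairs_def using \<open>\<bar>t\<bar> \<le> 1 / real (Suc m)\<close> \<open>q \<in> E\<close> \<open>q + t *\<^sub>R e \<in> E\<close>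
      by (intro CollectI exI[of _ s] exI[of _ t]) simp
  qed
  ultimately show ?thesis by simp
qed

lemma near_pairs_shift: "x + r *\<^sub>R e \<in> near_pairs E e m \<longleftrightarrow> x \<in> near_pairs E e m"
proof -
  have sh: "x + r *\<^sub>R e \<in> near_pairs E e m" if x: "x \<in> near_pairs E e m" for x r
  proof -
    obtain s t where st: "0 < \<bar>t\<bar>" "\<bar>t\<bar> \<le> 1 / real (Suc m)" "x + s *\<^sub>R e \<in> E" "x + (s + t) *\<^sub>R e \<in> E"
      using x by (auto simp: near_pairs_def)
    have eqs: "x + r *\<^sub>R e + (s - r) *\<^sub>R e = x + s *\<^sub>R e" "x + r *\<^sub>R e + ((s - r) + t) *\<^sub>R e = x + (s + t) *\<^sub>R e"
      by (auto simp: algebra_simps)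
    show ?thesis unfolding near_pairs_def mem_Collect_eq
      by (rule exI[of _ "s - r"], rule exI[of _ t], intro conjI) (simp_all only: eqs st)
  qed
  show ?thesis using sh[of x r] sh[of "x + r *\<^sub>R e" "- r"] by auto
qed

lemma near_pairs_antimono: "m \<le> n \<Longrightarrow> near_pairs E e n \<subseteq> near_pairs E e m"
proof -
  assume "m \<le> n"
  then have "1 / real (Suc n) \<le> 1 / real (Suc m)" by (simp add: field_simps)
  then show ?thesis unfolding near_pairs_def by (blast intro: order_trans)
qed

lemma finite_set_separation:
  fixes F :: "real set"
  assumes "finite F" shows "\<exists>d>0. \<forall>s\<in>F. \<forall>t\<in>F. s \<noteq> t \<longrightarrow> d \<le> \<bar>s - t\<bar>"
proof -
  define D where "D = (\<lambda>(s, t). \<bar>s - t\<bar>) ` {z \<in> F \<times> F. fst z \<noteq> snd z}"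
  have fD: "finite D" unfolding D_def using assms by (intro finite_imageI) (auto intro: finite_subset[of _ "F \<times> F"])
  have "\<exists>d>0. \<forall>z\<in>D. d \<le> z"
  proof (cases "D = {}")
    case False
    then have "Min D \<in> D" using fD by simp
    then have "0 < Min D" by (auto simp: D_def)
    then show ?thesis using fD by (intro exI[of _ "Min D"]) auto
  qed (auto intro: exI[of _ 1])
  then obtain d where "0 < d" "\<And>z. z \<in> D \<Longrightarrow> d \<le> z" by blast
  then show ?thesis unfolding D_def by (intro exI[of _ d]) force
qed

lemma infinite_fibre:
  fixes x :: "'a::euclidean_space"
  assumes "\<And>m. x \<in> near_pairs E e m" shows "infinite {s. x + s *\<^sub>R e \<in> E}"
proof
  assume "finite {s. x + s *\<^sub>R e \<in> E}"
  then obtain d where d: "0 < d"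
    "\<And>s t. x + s *\<^sub>R e \<in> E \<Longrightarrow> x + t *\<^sub>R e \<in> E \<Longrightarrow> s \<noteq> t \<Longrightarrow> d \<le> \<bar>s - t\<bar>"
    using finite_set_separation by (metis mem_Collect_eq)
  obtain m where m: "1 / real (Suc m) < d" using nat_approx_posE[OF d(1)] by blast
  obtain s t where st: "0 < \<bar>t\<bar>" "\<bar>t\<bar> \<le> 1 / real (Suc m)" "x + s *\<^sub>R e \<in> E" "x + (s + t) *\<^sub>R e \<in> E"
    using assms[of m] by (auto simp: near_pairs_def)
  from d(2)[OF st(4,3)] st m show False by simp
qed

text \<open>A line meeting \<open>E\<close> in infinitely many points meets the \<open>\<rho>\<close>-neighbourhood of \<open>E\<close> in length at least \<open>2 M \<rho>\<close>
  for every \<open>M\<close> and small \<open>\<rho>\<close>; since the neighbourhood has volume \<open>O(\<rho>)\<close>, Fatou's lemma shows that there are few such lines.\<close>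
lemma near_pairs_null:
  fixes E :: "'a::euclidean_space set"
  assumes E: "compact E" and e: "norm e = 1" and A0: "0 \<le> A"
    and vol: "\<And>j. j0 \<le> j \<Longrightarrow> emeasure lborel (\<Union>x\<in>E. ball x ((1/2)^j)) \<le> ennreal ((1/2)^j * A)"
  shows "emeasure lborel (\<Inter>m. near_pairs E e m) = 0"
proof -
  let ?C = "\<Inter>m. near_pairs E e m"
  have C: "?C \<in> sets borel" using near_pairs_borel[OF E] by auto
  obtain R where R: "0 \<le> R" "\<And>x. x \<in> E \<Longrightarrow> norm x \<le> R"
    using compact_imp_bounded[OF E] by (meson bounded_pos less_imp_le)
  define U where "U j = (\<Union>x\<in>E. ball x ((1/2::real)^j))" for j
  have U [measurable]: "U j \<in> sets borel" for j unfolding U_def by (intro borel_open open_UN) auto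
  have null: "AE x in lborel. x \<notin> ?C \<inter> ball 0 (real N)" for N :: nat
  proof -
    \<comment> \<open>A line parameter at which a point of \<open>ball 0 (real N)\<close> reaches
      \<open>E\<close> is at most \<open>R + real N\<close> in absolute value; the extra 1
      accommodates the radius of the neighbourhood.\<close>
    define T where "T = R + real N + 1"
    define \<psi> where "\<psi> j x = (\<integral>\<^sup>+t. indicator {-T..T} t * indicator (U j) (x + t *\<^sub>R e) \<partial>lborel)" for j x
    have \<psi>m: "\<psi> j \<in> borel_measurable borel" for j
      unfolding \<psi>_def[abs_def] by (rule lborel.borel_measurable_nn_integral) measurable
    have T0: "0 \<le> T" using R by (simp add: T_def)
    have \<psi>int: "(\<integral>\<^sup>+x. \<psi> j x \<partial>lborel) \<le> ennreal (2 * T * ((1/2)^j * A))" if "j0 \<le> j" for j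
    proof -
      have "(\<integral>\<^sup>+x. \<psi> j x \<partial>lborel) = (\<integral>\<^sup>+t. \<integral>\<^sup>+x. indicator {-T..T} t * indicator (U j) (x + t *\<^sub>R e) \<partial>lborel \<partial>lborel)"
        unfolding \<psi>_def by (rule lborel_pair.Fubini') measurable
      also have "\<dots> = (\<integral>\<^sup>+t. emeasure lborel (U j) * indicator {-T..T} t \<partial>lborel)"
      proof (rule nn_integral_cong)
        fix t :: real
        have "(\<integral>\<^sup>+x. indicator (U j) (t *\<^sub>R e + x) \<partial>lborel) = (\<integral>\<^sup>+x. indicator (U j) x \<partial>distr lborel borel ((+) (t *\<^sub>R e)))"
          by (rule nn_integral_distr[symmetric]) measurable
        also have "\<dots> = emeasure lborel (U j)" by (simp add: lborel_distr_plus)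
        finally have "(\<integral>\<^sup>+x. indicator (U j) (x + t *\<^sub>R e) \<partial>lborel) = emeasure lborel (U j)" by (simp add: add.commute)
        then show "(\<integral>\<^sup>+x. indicator {-T..T} t * indicator (U j) (x + t *\<^sub>R e) \<partial>lborel) = emeasure lborel (U j) * indicator {-T..T} t"
          by (subst nn_integral_cmult) (auto simp: mult.commute)
      qed
      also have "\<dots> = emeasure lborel (U j) * ennreal (2 * T)"
        using T0 by (subst nn_integral_cmult_indicator) auto
      also have "\<dots> \<le> ennreal ((1/2)^j * A) * ennreal (2 * T)"
        unfolding U_def by (intro mult_right_mono vol that) simp
      also have "\<dots> = ennreal (2 * T * ((1/2)^j * A))"
        using A0 T0 by (subst ennreal_mult[symmetric]) (auto simp: mult.commute)
      finally show ?thesis .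
    qed
    \<comment> \<open>\<open>\<psi> j x\<close> is a length of the line through \<open>x\<close>
      inside the neighbourhood of radius (1/2)^j. Dividing by this radius keeps the integrals
      bounded, while the values will tend to infinity on the lines in question.\<close>
    define v where "v j x = ennreal (2^j) * \<psi> j x" for j x
    have vm [measurable]: "v j \<in> borel_measurable lborel" for j
      unfolding v_def[abs_def] using \<psi>m by simp
    have vint: "(\<integral>\<^sup>+x. v j x \<partial>lborel) \<le> ennreal (2 * T * A)" if "j0 \<le> j" for j
    proof -
      have "(\<integral>\<^sup>+x. v j x \<partial>lborel) = ennreal (2^j) * (\<integral>\<^sup>+x. \<psi> j x \<partial>lborel)"
        unfolding v_def using \<psi>m by (intro nn_integral_cmult) simp
      also have "\<dots> \<le> ennreal (2^j) * ennreal (2 * T * ((1/2)^j * A))" by (intro mult_left_mono \<psi>int that) simp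
      also have "\<dots> = ennreal (2^j * (2 * T * ((1/2)^j * A)))" using T0 A0 by (intro ennreal_mult[symmetric]) auto
      also have "2^j * (2 * T * ((1/2)^j * A)) = 2 * T * A" by (simp add: power_divide field_simps)
      finally show ?thesis .
    qed
    have "(\<integral>\<^sup>+x. liminf (\<lambda>j. v j x) \<partial>lborel) \<le> liminf (\<lambda>j. \<integral>\<^sup>+x. v j x \<partial>lborel)"
      by (rule nn_integral_liminf) measurable
    also have "\<dots> \<le> limsup (\<lambda>j. \<integral>\<^sup>+x. v j x \<partial>lborel)" by (rule Liminf_le_Limsup) simp
    also have "\<dots> \<le> ennreal (2 * T * A)"
      by (intro Limsup_bounded eventually_mono[OF eventually_ge_at_top[of j0]] vint)
    also have "\<dots> < \<infinity>" by simp
    finally have "AE x in lborel. liminf (\<lambda>j. v j x) \<noteq> \<infinity>"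
      by (intro nn_integral_noteq_infinite) auto
    moreover have "liminf (\<lambda>j. v j x) = \<infinity>" if x: "x \<in> ?C \<inter> ball 0 (real N)" for x
    proof (rule ccontr)
      assume "liminf (\<lambda>j. v j x) \<noteq> \<infinity>"
      then obtain M :: nat where M: "liminf (\<lambda>j. v j x) < of_nat M"
        using ennreal_Ex_less_of_nat by (auto simp: less_top)
      have "infinite {s. x + s *\<^sub>R e \<in> E}" by (rule infinite_fibre) (use x in auto)
      then obtain F where F: "F \<subseteq> {s. x + s *\<^sub>R e \<in> E}" "card F = M" "finite F"
        using infinite_arbitrarily_large by blast
      obtain d where d: "0 < d" "\<And>s t. s \<in> F \<Longrightarrow> t \<in> F \<Longrightarrow> s \<noteq> t \<Longrightarrow> d \<le> \<bar>s - t\<bar>"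
        using finite_set_separation[OF F(3)] by blast
      \<comment> \<open>Radii below half the minimal gap \<open>d\<close> make the intervals about
        the \<open>M\<close> chosen parameters disjoint, each of length twice the radius.\<close>
      obtain j1 where j1: "(1/2::real)^j1 < d/2" using real_arch_pow_inv[of "d/2" "1/2"] d by auto
      have "of_nat M \<le> v j x" if "j1 \<le> j" for j
      proof -
        let ?\<rho> = "(1/2::real)^j"
        have \<rho>: "0 < ?\<rho>" "?\<rho> < d/2" "?\<rho> \<le> 1"
          using order_le_less_trans[OF power_decreasing[OF that, of "1/2::real"] j1] by (auto simp: power_le_one)
        let ?I = "\<lambda>s. {s - ?\<rho> <..< s + ?\<rho>}"
        have sub: "(\<Union>s\<in>F. ?I s) \<subseteq> {t \<in> {-T..T}. x + t *\<^sub>R e \<in> U j}"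
        proof
          fix t assume "t \<in> (\<Union>s\<in>F. ?I s)"
          then obtain s where s: "s \<in> F" "\<bar>t - s\<bar> < ?\<rho>" by auto
          have sE: "x + s *\<^sub>R e \<in> E" using s F by auto
          have "\<bar>s\<bar> = norm (s *\<^sub>R e)" using e by simp
          also have "\<dots> = norm ((x + s *\<^sub>R e) - x)" by simp
          also have "\<dots> \<le> norm (x + s *\<^sub>R e) + norm x" by (rule norm_triangle_ineq4)
          also have "\<dots> \<le> R + real N" using R(2)[OF sE] x by simp
          finally have tT: "\<bar>t\<bar> \<le> T" using s(2) \<rho>(3) unfolding T_def by linarith
          have "dist (x + s *\<^sub>R e) (x + t *\<^sub>R e) = norm ((s - t) *\<^sub>R e)"
            by (simp add: dist_norm algebra_simps)
          then have "dist (x + s *\<^sub>R e) (x + t *\<^sub>R e) < ?\<rho>" using s(2) e by (simp add: abs_minus_commute)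
          then have "x + t *\<^sub>R e \<in> ball (x + s *\<^sub>R e) ?\<rho>" by (simp only: mem_ball)
          with sE have "x + t *\<^sub>R e \<in> U j" unfolding U_def by blast
          then show "t \<in> {t \<in> {-T..T}. x + t *\<^sub>R e \<in> U j}" using tT by (auto simp: abs_le_iff)
        qed
        have disj: "disjoint_family_on ?I F"
          unfolding disjoint_family_on_def
        proof (intro ballI impI)
          fix s t assume "s \<in> F" "t \<in> F" "s \<noteq> t"
          from d(2)[OF this] \<rho>(2) show "?I s \<inter> ?I t = {}" by (auto simp: abs_if split: if_splits)
        qed
        have mt [measurable]: "{t \<in> {-T..T}. x + t *\<^sub>R e \<in> U j} \<in> sets borel" by measurable
        have "ennreal (real M * (2 * ?\<rho>)) = (\<Sum>s\<in>F. emeasure lborel (?I s))"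
          using \<rho> F by (simp add: ennreal_of_nat_eq_real_of_nat ennreal_mult)
        also have "\<dots> = emeasure lborel (\<Union>s\<in>F. ?I s)"
          by (rule sum_emeasure[OF _ disj F(3)]) auto
        also have "\<dots> \<le> emeasure lborel {t \<in> {-T..T}. x + t *\<^sub>R e \<in> U j}"
          by (rule emeasure_mono[OF sub]) simp
        also have "\<dots> = (\<integral>\<^sup>+t. indicator {t \<in> {-T..T}. x + t *\<^sub>R e \<in> U j} t \<partial>lborel)" by simp
        also have "\<dots> = \<psi> j x" unfolding \<psi>_def by (intro nn_integral_cong) (auto simp: indicator_def)
        finally have "ennreal (2^j) * ennreal (real M * (2 * ?\<rho>)) \<le> v j x"
          unfolding v_def by (rule mult_left_mono) simp
        moreover have "ennreal (2^j) * ennreal (real M * (2 * ?\<rho>)) = ennreal (2 * real M)"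
          by (subst ennreal_mult[symmetric]) (auto simp: power_divide field_simps)
        ultimately have "ennreal (2 * real M) \<le> v j x" by simp
        moreover have "of_nat M \<le> ennreal (2 * real M)" by (simp add: ennreal_of_nat_eq_real_of_nat)
        ultimately show ?thesis by (rule order_trans[rotated])
      qed
      then have "of_nat M \<le> liminf (\<lambda>j. v j x)"
        by (intro Liminf_bounded eventually_mono[OF eventually_ge_at_top[of j1]])
      with M show False by simp
    qed
    ultimately show ?thesis by (auto elim!: eventually_mono)
  qed
  then have "AE x in lborel. \<forall>N. x \<notin> ?C \<inter> ball 0 (real N)" unfolding AE_all_countable by blast
  then have "AE x in lborel. x \<notin> ?C"
  proof eventually_elim
    case (elim x)
    obtain N where "norm x < real N" using reals_Archimedean2 by blast
    then show ?case using elim by auto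
  qed
  then show ?thesis using C AE_iff_measurable[of ?C lborel "\<lambda>x. x \<notin> ?C"] by auto
qed

section \<open>The trace inequality\<close>

text \<open>The shift formula is tested with the function that is \<open>1\<close> on \<open>K1 + [0, h] e\<close> and \<open>-1\<close> on \<open>K2 + [0, h] e\<close>.\<close>
lemma dvar_separated_le_aux:
  fixes u :: "real^'d \<Rightarrow> real"
  assumes u: "grad_measure u \<mu> \<sigma>" "u \<in> borel_measurable borel" "integrable lborel u"
    and h: "0 < h" and K1: "compact K1" "\<And>x. x \<in> K1 \<Longrightarrow> 0 \<le> e \<bullet> \<sigma> x"
    and K2: "compact K2" "\<And>x. x \<in> K2 \<Longrightarrow> e \<bullet> \<sigma> x \<le> 0" and disj: "K1 \<inter> K2 = {}"
    and sep: "\<And>x t. x \<in> K1 \<union> K2 \<Longrightarrow> x + t *\<^sub>R e \<in> K1 \<union> K2 \<Longrightarrow> \<bar>t\<bar> \<le> h \<Longrightarrow> t = 0"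
    and N: "N \<in> sets borel" "\<And>x t. x \<in> K1 \<union> K2 \<Longrightarrow> \<bar>t\<bar> \<le> h \<Longrightarrow> x + t *\<^sub>R e \<in> N" "N \<subseteq> ball 0 R"
  shows "measure (dvar \<mu> \<sigma> e) (K1 \<union> K2) \<le> 2 / h * (\<integral>x. \<bar>u x\<bar> * indicator (ball 0 R) x \<partial>lborel) +
    measure (dvar \<mu> \<sigma> e) (N - (K1 \<union> K2))"
proof -
  note p = grad_measure_polar[OF u(1)]
  note [measurable] = u(2)
  let ?K = "K1 \<union> K2"
  define sweep where "sweep K = (\<lambda>(x, t). x + t *\<^sub>R e) ` (K \<times> {0..h})" for K
  have sweepI: "x + t *\<^sub>R e \<in> sweep K" if "x \<in> K" "0 \<le> t" "t \<le> h" for x t K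
    unfolding sweep_def using that by (intro image_eqI[of _ _ "(x, t)"]) auto
  have sweepE: "\<exists>p t. p \<in> K \<and> 0 \<le> t \<and> t \<le> h \<and> y = p + t *\<^sub>R e" if "y \<in> sweep K" for y K
    using that unfolding sweep_def by fastforce
  have sw: "sweep K \<in> sets borel" if "compact K" for K
    unfolding sweep_def using that
    by (intro borel_compact compact_continuous_image compact_Times compact_Icc)
      (auto simp: split_beta intro!: continuous_intros)
  define \<phi> where "\<phi> x = indicator (sweep K1) x - (indicator (sweep K2) x :: real)" for x
  have [measurable]: "\<phi> \<in> borel_measurable borel"
    unfolding \<phi>_def[abs_def] using sw[OF K1(1)] sw[OF K2(1)] by measurable
  have \<phi>1: "\<bar>\<phi> x\<bar> \<le> 1" for x by (simp add: \<phi>_def indicator_def)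
  have b\<phi>: "bounded_borel \<phi>" by (rule bounded_borelI[of _ 1]) (use \<phi>1 in auto)
  let ?a = "line_avg \<phi> (h *\<^sub>R e)"
  have \<phi>0: "\<exists>p\<in>?K. \<exists>t. 0 \<le> t \<and> t \<le> h \<and> y = p + t *\<^sub>R e" if "\<phi> y \<noteq> 0" for y
  proof -
    have "y \<in> sweep K1 \<or> y \<in> sweep K2" using that by (auto simp: \<phi>_def indicator_def)
    then show ?thesis using sweepE[of y K1] sweepE[of y K2] by blast
  qed
  \<comment> \<open>A point at most \<open>h\<close> ahead of \<open>x\<close> that is also at most
    \<open>h\<close> ahead of \<open>p\<close> puts \<open>p\<close> within \<open>h\<close> of
    \<open>x\<close> on the same line, so separation forces \<open>p = x\<close>. Hence the two
    swept sets do not interfere over \<open>K1 \<union> K2\<close>.\<close>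
  have same: "p = x" if "x \<in> ?K" "p \<in> ?K" "0 \<le> s" "s \<le> 1" "0 \<le> t" "t \<le> h" "x + s *\<^sub>R h *\<^sub>R e = p + t *\<^sub>R e" for x p s t
  proof -
    have eq: "p = x + (s * h - t) *\<^sub>R e" using that(7) by (simp add: algebra_simps)
    have "0 \<le> s * h" "s * h \<le> h" using that h mult_right_mono[of s 1 h] by auto
    then have "\<bar>s * h - t\<bar> \<le> h" using that by linarith
    from sep[OF that(1) _ this] have "s * h - t = 0" using that(2) eq by simp
    with eq show ?thesis by simp
  qed
  have shx: "x + s *\<^sub>R h *\<^sub>R e \<in> sweep K" if "x \<in> K" "0 \<le> s" "s \<le> 1" for x s K
    using sweepI[OF that(1), of "s * h"] that(2,3) h mult_right_mono[of s 1 h] by simp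
  have a1: "?a x = 1" if x: "x \<in> K1" for x
  proof (rule line_avg_const)
    fix s :: real assume s: "0 \<le> s" "s \<le> 1"
    have "x + s *\<^sub>R h *\<^sub>R e \<notin> sweep K2"
    proof
      assume "x + s *\<^sub>R h *\<^sub>R e \<in> sweep K2"
      from sweepE[OF this] obtain q t where "q \<in> K2" "0 \<le> t" "t \<le> h" "x + s *\<^sub>R h *\<^sub>R e = q + t *\<^sub>R e" by blast
      with same[of x q s t] x s disj show False by auto
    qed
    then show "\<phi> (x + s *\<^sub>R h *\<^sub>R e) = 1" using shx[OF x s] by (simp add: \<phi>_def)
  qed
  have a2: "?a x = - 1" if x: "x \<in> K2" for x
  proof (rule line_avg_const)
    fix s :: real assume s: "0 \<le> s" "s \<le> 1"
    have "x + s *\<^sub>R h *\<^sub>R e \<notin> sweep K1"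
    proof
      assume "x + s *\<^sub>R h *\<^sub>R e \<in> sweep K1"
      from sweepE[OF this] obtain q t where "q \<in> K1" "0 \<le> t" "t \<le> h" "x + s *\<^sub>R h *\<^sub>R e = q + t *\<^sub>R e" by blast
      with same[of x q s t] x s disj show False by auto
    qed
    then show "\<phi> (x + s *\<^sub>R h *\<^sub>R e) = - 1" using shx[OF x s] by (simp add: \<phi>_def)
  qed
  have aN: "?a x = 0" if x: "x \<notin> N" for x
  proof (rule line_avg_const, rule ccontr)
    fix s :: real assume s: "0 \<le> s" "s \<le> 1" and "\<phi> (x + s *\<^sub>R h *\<^sub>R e) \<noteq> 0"
    from \<phi>0[OF this(3)] obtain q t where q: "q \<in> ?K" "0 \<le> t" "t \<le> h" "x + s *\<^sub>R h *\<^sub>R e = q + t *\<^sub>R e" by blast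
    have "0 \<le> s * h" "s * h \<le> h" using s h mult_right_mono[of s 1 h] by auto
    then have "\<bar>t - s * h\<bar> \<le> h" using q by linarith
    moreover have "x = q + (t - s * h) *\<^sub>R e" using q(4) by (simp add: algebra_simps)
    ultimately show False using N(2)[OF q(1), of "t - s * h"] x by simp
  qed
  have a_le: "\<bar>?a x\<bar> \<le> 1" for x by (rule line_avg_le[OF b\<phi> \<phi>1])
  have Kb: "?K \<in> sets borel" using K1 K2 by (auto intro: borel_compact)
  have lu: "integrable lebesgue u" using integrable_completion[of u lborel] u by simp
  let ?w = "\<lambda>x. ?a x * (e \<bullet> \<sigma> x)"
  have wb: "bounded_borel ?w"
    by (intro bounded_borel_mult bounded_borel_line_avg b\<phi> bounded_borel_inner bounded_borel_const polar_bounded_borel[OF p])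
  have wi: "integrable \<mu> ?w" by (rule integrable_bounded_borel_fm[OF polar_finite[OF p] polar_sets[OF p] wb])
  \<comment> \<open>On the compact sets the line average is the sign matching
    \<open>e \<bullet> \<sigma> x\<close>; off \<open>N\<close> it is 0. In between it is only
    bounded by 1, which produces the error term.\<close>
  have pt: "indicator ?K x * \<bar>e \<bullet> \<sigma> x\<bar> \<le> ?w x + indicator (N - ?K) x * \<bar>e \<bullet> \<sigma> x\<bar>" for x
  proof -
    consider "x \<in> K1" | "x \<in> K2" | "x \<notin> ?K" "x \<in> N" | "x \<notin> ?K" "x \<notin> N" by blast
    then show ?thesis
    proof cases
      case 1 then show ?thesis using a1 K1(2) by simp
    next
      case 2 then show ?thesis using a2 K2(2) by simp
    next
      case 3
      have "\<bar>?w x\<bar> \<le> 1 * \<bar>e \<bullet> \<sigma> x\<bar>" unfolding abs_mult by (intro mult_right_mono a_le) simp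
      then have "0 \<le> ?w x + \<bar>e \<bullet> \<sigma> x\<bar>" by linarith
      then show ?thesis using 3 by simp
    next
      case 4 then show ?thesis using aN by simp
    qed
  qed
  have "measure (dvar \<mu> \<sigma> e) ?K \<le> (\<integral>x. ?w x + indicator (N - ?K) x * \<bar>e \<bullet> \<sigma> x\<bar> \<partial>\<mu>)"
    unfolding measure_dvar[OF p Kb]
    by (intro integral_mono Bochner_Integration.integrable_add wi polar_component_integrable[OF p] pt Kb sets.Diff N)
  also have "\<dots> = (\<integral>x. ?w x \<partial>\<mu>) + measure (dvar \<mu> \<sigma> e) (N - ?K)"
    unfolding measure_dvar[OF p sets.Diff[OF N(1) Kb]]
    by (intro Bochner_Integration.integral_add wi polar_component_integrable[OF p] Kb sets.Diff N)
  finally have le: "measure (dvar \<mu> \<sigma> e) ?K \<le> (\<integral>x. ?w x \<partial>\<mu>) + measure (dvar \<mu> \<sigma> e) (N - ?K)" .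
  have "(\<integral>x. u x * (\<phi> (x + h *\<^sub>R e) - \<phi> x) \<partial>lebesgue) = - (\<integral>x. (?a x *\<^sub>R h *\<^sub>R e) \<bullet> \<sigma> x \<partial>\<mu>)"
    by (rule grad_measure_shift[OF u(1) lu b\<phi>])
  also have "(\<integral>x. (?a x *\<^sub>R h *\<^sub>R e) \<bullet> \<sigma> x \<partial>\<mu>) = (\<integral>x. h * ?w x \<partial>\<mu>)"
    by (intro Bochner_Integration.integral_cong) auto
  also have "\<dots> = h * (\<integral>x. ?w x \<partial>\<mu>)" by simp
  finally have "h * (\<integral>x. ?w x \<partial>\<mu>) = - (\<integral>x. u x * (\<phi> (x + h *\<^sub>R e) - \<phi> x) \<partial>lebesgue)" by simp
  also have "\<dots> = - (\<integral>x. u x * (\<phi> (x + h *\<^sub>R e) - \<phi> x) \<partial>lborel)"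
    by (subst integral_completion) auto
  also have "\<dots> \<le> (\<integral>x. \<bar>u x * (\<phi> (x + h *\<^sub>R e) - \<phi> x)\<bar> \<partial>lborel)"
    using integral_abs_bound[of lborel "\<lambda>x. u x * (\<phi> (x + h *\<^sub>R e) - \<phi> x)"] by (simp add: abs_le_iff)
  also have "\<dots> \<le> (\<integral>x. 2 * (\<bar>u x\<bar> * indicator (ball 0 R) x) \<partial>lborel)"
  proof (rule integral_mono_AE)
    \<comment> \<open>Both the test function and its translate vanish off \<open>N\<close>, hence
      off the ball, and their values differ by at most 2.\<close>
    have bd: "\<bar>u x * (\<phi> (x + h *\<^sub>R e) - \<phi> x)\<bar> \<le> 2 * (\<bar>u x\<bar> * indicator (ball 0 R) x)" for x
    proof (cases "x \<in> ball 0 R")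
      case True
      have "\<bar>\<phi> (x + h *\<^sub>R e) - \<phi> x\<bar> \<le> 2" using \<phi>1[of x] \<phi>1[of "x + h *\<^sub>R e"] by linarith
      then have "\<bar>u x\<bar> * \<bar>\<phi> (x + h *\<^sub>R e) - \<phi> x\<bar> \<le> \<bar>u x\<bar> * 2" by (intro mult_left_mono) auto
      then show ?thesis using True by (simp add: abs_mult)
    next
      case False
      have "\<phi> x = 0"
      proof (rule ccontr)
        assume "\<phi> x \<noteq> 0"
        from \<phi>0[OF this] obtain q t where "q \<in> ?K" "0 \<le> t" "t \<le> h" "x = q + t *\<^sub>R e" by blast
        with N(2)[of q t] N(3) False show False by auto
      qed
      moreover have "\<phi> (x + h *\<^sub>R e) = 0"
      proof (rule ccontr)
        assume "\<phi> (x + h *\<^sub>R e) \<noteq> 0"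
        from \<phi>0[OF this] obtain q t where q: "q \<in> ?K" "0 \<le> t" "t \<le> h" "x + h *\<^sub>R e = q + t *\<^sub>R e" by blast
        then have "x = q + (t - h) *\<^sub>R e" by (simp add: algebra_simps)
        with N(2)[OF q(1), of "t - h"] q N(3) False show False by auto
      qed
      ultimately show ?thesis by simp
    qed
    then show "AE x in lborel. \<bar>u x * (\<phi> (x + h *\<^sub>R e) - \<phi> x)\<bar> \<le> 2 * (\<bar>u x\<bar> * indicator (ball 0 R) x)" by simp
    have i: "integrable lborel (\<lambda>x. 2 * \<bar>u x\<bar> * indicator (ball 0 R) x)"
      using integrable_mult_indicator[of "ball 0 R" lborel "\<lambda>x. 2 * \<bar>u x\<bar>"] u(3) by (simp add: mult.commute)
    then show i': "integrable lborel (\<lambda>x. 2 * (\<bar>u x\<bar> * indicator (ball 0 R) x))" by (simp add: mult.assoc)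
    show "integrable lborel (\<lambda>x. \<bar>u x * (\<phi> (x + h *\<^sub>R e) - \<phi> x)\<bar>)"
    proof (rule Bochner_Integration.integrable_bound[OF i'])
      show "AE x in lborel. norm \<bar>u x * (\<phi> (x + h *\<^sub>R e) - \<phi> x)\<bar> \<le> norm (2 * (\<bar>u x\<bar> * indicator (ball 0 R) x))"
        using bd by simp
    qed measurable
  qed
  also have "\<dots> = 2 * (\<integral>x. \<bar>u x\<bar> * indicator (ball 0 R) x \<partial>lborel)" by simp
  finally have "(\<integral>x. ?w x \<partial>\<mu>) \<le> 2 / h * (\<integral>x. \<bar>u x\<bar> * indicator (ball 0 R) x \<partial>lborel)"
    using h by (simp add: field_simps)
  with le show ?thesis by linarith
qed

text \<open>The sets where \<open>e \<bullet> \<sigma> x\<close> is nonnegative or negative are only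
  Borel, while sweeping needs compact pieces. Each half of \<open>K\<close> is approximated from
  inside; the two defects of \<eta>/2 come from enlarging the left side to \<open>K\<close> and from
  shrinking \<open>N - (K1 \<union> K2)\<close> to \<open>N - K\<close>.\<close>

lemma dvar_separated_le:
  fixes u :: "real^'d \<Rightarrow> real"
  assumes u: "grad_measure u \<mu> \<sigma>" "u \<in> borel_measurable borel" "integrable lborel u"
    and h: "0 < h" and K: "K \<in> sets borel"
    and sep: "\<And>x t. x \<in> K \<Longrightarrow> x + t *\<^sub>R e \<in> K \<Longrightarrow> \<bar>t\<bar> \<le> h \<Longrightarrow> t = 0"
    and N: "N \<in> sets borel" "\<And>x t. x \<in> K \<Longrightarrow> \<bar>t\<bar> \<le> h \<Longrightarrow> x + t *\<^sub>R e \<in> N" "N \<subseteq> ball 0 R"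
  shows "measure (dvar \<mu> \<sigma> e) K \<le> 2 / h * (\<integral>x. \<bar>u x\<bar> * indicator (ball 0 R) x \<partial>lborel) +
    measure (dvar \<mu> \<sigma> e) (N - K)"
proof (rule field_le_epsilon)
  note p = grad_measure_polar[OF u(1)]
  let ?D = "dvar \<mu> \<sigma> e"
  interpret D: finite_measure ?D by (rule finite_measure_dvar[OF p])
  note sD = sets_dvar[OF p, of e]
  fix \<eta> :: real assume \<eta>: "0 < \<eta>"
  have \<sigma>m: "(\<lambda>x. e \<bullet> \<sigma> x) \<in> borel_measurable borel" using p by (auto simp: polar_def)
  define Q where "Q = {x. 0 \<le> e \<bullet> \<sigma> x}"
  have b1: "Q \<in> sets borel" unfolding Q_def using borel_measurable_le[OF borel_measurable_const \<sigma>m] by simp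
  let ?P = "K \<inter> Q" and ?M = "K - Q"
  obtain K1 where K1: "K1 \<subseteq> ?P" "compact K1" "measure ?D (?P - K1) < \<eta> / 4"
    using compact_approximation[OF D.finite_measure_axioms sD, of ?P "\<eta>/4"] K b1 \<eta> by auto
  obtain K2 where K2: "K2 \<subseteq> ?M" "compact K2" "measure ?D (?M - K2) < \<eta> / 4"
    using compact_approximation[OF D.finite_measure_axioms sD, of ?M "\<eta>/4"] K b1 \<eta> by auto
  have kb [simp]: "K1 \<in> sets borel" "K2 \<in> sets borel" using K1 K2 by (auto intro: borel_compact)
  have diff: "measure ?D (K - (K1 \<union> K2)) \<le> \<eta> / 2"
  proof -
    have "measure ?D (K - (K1 \<union> K2)) \<le> measure ?D ((?P - K1) \<union> (?M - K2))"
      by (rule D.finite_measure_mono, blast, simp only: sD, intro sets.Un sets.Diff sets.Int K b1 kb N(1))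
    also have "\<dots> \<le> measure ?D (?P - K1) + measure ?D (?M - K2)"
      by (rule measure_Un_le; simp only: sD; intro sets.Un sets.Diff sets.Int K b1 kb N(1))
    finally show ?thesis using K1 K2 by linarith
  qed
  have main: "measure ?D (K1 \<union> K2) \<le> 2 / h * (\<integral>x. \<bar>u x\<bar> * indicator (ball 0 R) x \<partial>lborel) + measure ?D (N - (K1 \<union> K2))"
  proof (rule dvar_separated_le_aux[OF u h K1(2) _ K2(2) _ _ _ N(1) _ N(3)])
    fix x t assume "x \<in> K1 \<union> K2" "x + t *\<^sub>R e \<in> K1 \<union> K2" "\<bar>t\<bar> \<le> h"
    then show "t = 0" using sep[of x t] K1 K2 by blast
  next
    fix x t assume "x \<in> K1 \<union> K2" "\<bar>t\<bar> \<le> h"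
    then show "x + t *\<^sub>R e \<in> N" using N(2)[of x t] K1 K2 by blast
  qed (use K1 K2 in \<open>auto simp: Q_def\<close>)
  have "measure ?D K \<le> measure ?D ((K1 \<union> K2) \<union> (K - (K1 \<union> K2)))"
    by (rule D.finite_measure_mono, blast, simp only: sD, intro sets.Un sets.Diff sets.Int K b1 kb N(1))
  also have "\<dots> \<le> measure ?D (K1 \<union> K2) + measure ?D (K - (K1 \<union> K2))"
    by (rule measure_Un_le; simp only: sD; intro sets.Un sets.Diff sets.Int K b1 kb N(1))
  finally have 1: "measure ?D K \<le> measure ?D (K1 \<union> K2) + \<eta> / 2" using diff by linarith
  have "measure ?D (N - (K1 \<union> K2)) \<le> measure ?D ((N - K) \<union> (K - (K1 \<union> K2)))"
    by (rule D.finite_measure_mono, blast, simp only: sD, intro sets.Un sets.Diff sets.Int K b1 kb N(1))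
  also have "\<dots> \<le> measure ?D (N - K) + measure ?D (K - (K1 \<union> K2))"
    by (rule measure_Un_le; simp only: sD; intro sets.Un sets.Diff sets.Int K b1 kb N(1))
  finally have 2: "measure ?D (N - (K1 \<union> K2)) \<le> measure ?D (N - K) + \<eta> / 2" using diff by linarith
  show "measure ?D K \<le> 2 / h * (\<integral>x. \<bar>u x\<bar> * indicator (ball 0 R) x \<partial>lborel) + measure ?D (N - K) + \<eta>"
    using main 1 2 by linarith
qed

text \<open>\<open>dense_points \<nu> k\<close> is tested only at the dyadic radii up to \<open>(1/2)^k\<close>, which keeps it Borel.\<close>
definition dense_points :: "'a::euclidean_space measure \<Rightarrow> nat \<Rightarrow> 'a set" where
  "dense_points \<nu> k = {x. norm x \<le> real k \<and>
     (\<forall>j\<ge>k. 1 / real (Suc k) * ((1/2)^j) ^ (DIM('a) - 1) \<le> measure \<nu> (ball x ((1/2)^j)))}"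

lemma dense_points_borel:
  fixes \<nu> :: "'a::euclidean_space measure"
  assumes \<nu>: "finite_measure \<nu>" "sets \<nu> = sets borel"
  shows "dense_points \<nu> k \<in> sets borel"
proof -
  interpret finite_measure \<nu> by fact
  have id\<nu>: "(\<lambda>x. x) \<in> \<nu> \<rightarrow>\<^sub>M borel" by (rule measurable_ident_sets[OF \<nu>(2)])
  have m: "(\<lambda>x. measure \<nu> (ball x r)) \<in> borel_measurable borel" for r
  proof -
    have "(\<lambda>x. \<integral>y. (if dist x y < r then 1 else 0) \<partial>\<nu> :: real) \<in> borel_measurable borel"
    proof (rule borel_measurable_lebesgue_integral)
      have f: "(\<lambda>z. (fst z, snd z)) \<in> borel \<Otimes>\<^sub>M \<nu> \<rightarrow>\<^sub>M borel \<Otimes>\<^sub>M borel"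
        using measurable_compose[OF measurable_snd id\<nu>] by measurable
      have g: "(\<lambda>(x::'a, y). if dist x y < r then 1 else 0 :: real) \<in> borel_measurable (borel \<Otimes>\<^sub>M borel)"
        by measurable
      show "(\<lambda>(x, y). if dist x y < r then 1 else 0 :: real) \<in> borel_measurable (borel \<Otimes>\<^sub>M \<nu>)"
        using measurable_compose[OF f g] by simp
    qed
    moreover have "(\<integral>y. (if dist x y < r then 1 else 0) \<partial>\<nu> :: real) = measure \<nu> (ball x r)" for x
    proof -
      have "(\<integral>y. (if dist x y < r then 1 else 0) \<partial>\<nu> :: real) = (\<integral>y. indicator (ball x r) y \<partial>\<nu>)"
        by (intro Bochner_Integration.integral_cong) (auto simp: indicator_def)
      then show ?thesis using \<nu> sets_eq_imp_space_eq[OF \<nu>(2)] by simp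
    qed
    ultimately show ?thesis by simp
  qed
  have "{x::'a. norm x \<le> real k} \<in> sets borel" by measurable
  moreover have "{x. c \<le> measure \<nu> (ball x r)} \<in> sets borel" for c r
    using borel_measurable_le[OF borel_measurable_const m, of c r] by simp
  then have "(\<Inter>j\<in>{k..}. {x. 1 / real (Suc k) * ((1/2)^j) ^ (DIM('a) - 1) \<le> measure \<nu> (ball x ((1/2)^j))}) \<in> sets borel"
    by (intro sets.countable_INT'') auto
  moreover have "dense_points \<nu> k = {x. norm x \<le> real k} \<inter>
      (\<Inter>j\<in>{k..}. {x. 1 / real (Suc k) * ((1/2)^j) ^ (DIM('a) - 1) \<le> measure \<nu> (ball x ((1/2)^j))})"
    by (auto simp: dense_points_def)
  ultimately show ?thesis by (simp only: sets.Int)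
qed

lemma dense_points_mono:
  assumes "k \<le> l" shows "dense_points \<nu> k \<subseteq> dense_points \<nu> l"
proof
  fix x :: 'a assume x: "x \<in> dense_points \<nu> k"
  have "1 / real (Suc l) \<le> 1 / real (Suc k)" using assms by (simp add: field_simps)
  then have "1 / real (Suc l) * ((1/2)^j) ^ (DIM('a) - 1) \<le> 1 / real (Suc k) * ((1/2)^j) ^ (DIM('a) - 1)" for j :: nat
    by (intro mult_right_mono) auto
  then show "x \<in> dense_points \<nu> l"
    using x assms unfolding dense_points_def by (auto intro: order_trans)
qed

text \<open>One large index absorbs the density constant, the admissible radii and the norm of the
  point.\<close>

lemma dense_points_exhaust:
  fixes x :: "'a::euclidean_space"
  assumes c: "0 < c" and r0: "0 < r0" and d: "\<And>r. 0 < r \<Longrightarrow> r < r0 \<Longrightarrow> c * r ^ (DIM('a) - 1) \<le> measure \<nu> (ball x r)"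
  shows "\<exists>k. x \<in> dense_points \<nu> k"
proof -
  obtain k1 where k1: "(1/2::real)^k1 < r0" using real_arch_pow_inv[of r0 "1/2"] r0 by auto
  obtain k2 where k2: "1 / real (Suc k2) < c" using nat_approx_posE[OF c] by blast
  obtain k3 where k3: "norm x \<le> real k3" using real_arch_simple by blast
  define k where "k = max k1 (max k2 k3)"
  have "1 / real (Suc k) \<le> 1 / real (Suc k2)" by (simp add: k_def field_simps)
  then have kc: "1 / real (Suc k) \<le> c" using k2 by linarith
  have "1 / real (Suc k) * ((1/2)^j) ^ (DIM('a) - 1) \<le> measure \<nu> (ball x ((1/2)^j))" if "k \<le> j" for j
  proof -
    have "(1/2::real)^j \<le> (1/2)^k1" using that by (intro power_decreasing) (auto simp: k_def)
    then have "c * ((1/2)^j) ^ (DIM('a) - 1) \<le> measure \<nu> (ball x ((1/2)^j))" using order_le_less_trans[OF _ k1] by (intro d) auto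
    moreover have "1 / real (Suc k) * ((1/2)^j) ^ (DIM('a) - 1) \<le> c * ((1/2)^j) ^ (DIM('a) - 1)"
      by (intro mult_right_mono kc) simp
    ultimately show ?thesis by linarith
  qed
  moreover have "norm x \<le> real k" using k3 by (simp add: k_def)
  ultimately show ?thesis unfolding dense_points_def by blast
qed

section \<open>Convergence of the jump parts\<close>

lemma measure_decseq_small:
  assumes "finite_measure \<nu>" "\<And>k. B k \<in> sets \<nu>" "decseq B" "(\<Inter>k. B k) = {}" "0 < \<delta>"
  shows "\<exists>k. measure \<nu> (B k) < \<delta>"
proof -
  interpret finite_measure \<nu> by fact
  have "(\<lambda>k. measure \<nu> (B k)) \<longlonglongrightarrow> measure \<nu> (\<Inter>k. B k)"
    by (rule finite_Lim_measure_decseq[OF _ assms(3)]) (use assms(2) in auto)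
  then have "(\<lambda>k. measure \<nu> (B k)) \<longlonglongrightarrow> 0" using assms(4) by simp
  from order_tendstoD(2)[OF this assms(5)] show ?thesis
    using eventually_happens' sequentially_bot by blast
qed

text \<open>Every set discarded from the union of the jump sets, and the collar around
  \<open>K\<close>, has \<nu>-measure below \<delta> and so costs at most \<epsilon> for all
  \<open>n\<close> simultaneously; the exceptional lines cost nothing. What remains is a multiple,
  fixed before \<open>n\<close>, of an L^1 norm on a ball.\<close>

lemma uniformly_small_remainder:
  fixes g :: "nat \<Rightarrow> real^'d \<Rightarrow> real"
  assumes g: "\<And>n. g n \<in> borel_measurable borel" "\<And>n. integrable lborel (g n)"
    and \<mu>: "\<And>n. grad_measure (g n) (\<mu> n) (\<sigma> n)"
    and weak: "\<And>\<psi>. bounded_borel \<psi> \<Longrightarrow> (\<lambda>n. \<integral>x. g n x * \<psi> x \<partial>lborel) \<longlonglongrightarrow> 0"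
    and lim: "\<And>\<Psi>. bounded_borel \<Psi> \<Longrightarrow> (\<lambda>n. \<integral>x. \<Psi> x \<bullet> \<sigma> n x \<partial>\<mu> n) \<longlonglongrightarrow> 0"
    and e: "norm e = 1"
  shows "(\<lambda>n. measure (dvar (\<mu> n) (\<sigma> n) e) (\<Union>n. jump_set (g n))) \<longlonglongrightarrow> 0"
proof (rule tendstoI)
  fix \<epsilon>0 :: real assume "0 < \<epsilon>0"
  \<comment> \<open>Three sets cost \<epsilon> each and the integral less than \<epsilon>; the
    divisor 6 leaves room.\<close>
  define \<epsilon> where "\<epsilon> = \<epsilon>0 / 6"
  have \<epsilon>: "0 < \<epsilon>" "5 * \<epsilon> < \<epsilon>0" using \<open>0 < \<epsilon>0\<close> by (auto simp: \<epsilon>_def)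
  have p: "polar (\<mu> n) (\<sigma> n)" for n by (rule grad_measure_polar[OF \<mu>])
  have fin: "finite_measure (\<mu> n)" for n by (rule polar_finite[OF p])
  have s\<mu>: "sets (\<mu> n) = sets borel" for n by (rule polar_sets[OF p])
  have lg: "integrable lebesgue (g n)" for n using integrable_completion[of "g n" lborel] g by simp
  obtain M where M: "\<And>n. measure (\<mu> n) UNIV \<le> M" using polar_seq_bounded[OF p lim] by blast
  obtain \<nu> where \<nu>: "finite_measure \<nu>" "sets \<nu> = sets borel"
    "\<And>n A. A \<in> sets borel \<Longrightarrow> (1/2) ^ n * measure (\<mu> n) A \<le> measure \<nu> A"
    using dominating_measure_exists[of \<mu>, OF fin s\<mu> M] by blast
  interpret \<nu>: finite_measure \<nu> by fact
  have ac: "measure (\<mu> n) A = 0" if "A \<in> sets borel" "measure \<nu> A = 0" for n A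
  proof -
    have "(1/2) ^ n * measure (\<mu> n) A \<le> 0" using \<nu>(3)[OF that(1), of n] that(2) by simp
    moreover have "0 < (1/2::real) ^ n" by simp
    ultimately show ?thesis using measure_nonneg[of "\<mu> n" A]
      by (meson antisym mult_le_0_iff not_le)
  qed
  obtain \<delta> where \<delta>: "0 < \<delta>" "\<And>A n. A \<in> sets borel \<Longrightarrow> measure \<nu> A < \<delta> \<Longrightarrow> measure (\<mu> n) A \<le> \<epsilon>"
    using polar_seq_uniformly_absolutely_continuous[OF p lim \<nu>(1,2) ac \<epsilon>(1)] by blast
  let ?D = "\<lambda>n. dvar (\<mu> n) (\<sigma> n) e"
  have sD: "sets (?D n) = sets borel" for n by (rule sets_dvar[OF p])
  have fD: "finite_measure (?D n)" for n by (rule finite_measure_dvar[OF p])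
  have D\<epsilon>: "measure (?D n) A \<le> \<epsilon>" if "A \<in> sets borel" "measure \<nu> A < \<delta>" for n A
    using order_trans[OF dvar_le[OF p that(1) e] \<delta>(2)[OF that]] .
  define E where "E = (\<Union>n. jump_set (g n))"
  have Eb: "E \<in> sets borel" unfolding E_def using jump_set_borel[OF g] by auto
  \<comment> \<open>The weight \<open>(1/2) ^ n\<close> depends on the jump set containing
    \<open>x\<close>, but the density constant depends on the point anyway and absorbs it.\<close>
  have Edense: "\<exists>k. x \<in> dense_points \<nu> k" if x: "x \<in> E" for x
  proof -
    obtain n where "x \<in> jump_set (g n)" using x by (auto simp: E_def)
    from jump_set_density[OF g \<mu> this] obtain c r0 where c: "0 < c" "0 < r0"
      "\<And>r. 0 < r \<Longrightarrow> r < r0 \<Longrightarrow> c * r ^ (CARD('d) - 1) \<le> measure (\<mu> n) (ball x r)" by blast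
    show ?thesis
    proof (rule dense_points_exhaust[of "(1/2) ^ n * c" r0])
      fix r :: real assume r: "0 < r" "r < r0"
      have "(1/2) ^ n * (c * r ^ (CARD('d) - 1)) \<le> (1/2) ^ n * measure (\<mu> n) (ball x r)"
        by (intro mult_left_mono c r) simp
      also have "\<dots> \<le> measure \<nu> (ball x r)" by (rule \<nu>(3)) simp
      finally show "(1/2) ^ n * c * r ^ (DIM(real^'d) - 1) \<le> measure \<nu> (ball x r)" by (simp add: mult.assoc)
    qed (use c in auto)
  qed
  obtain k where k: "measure \<nu> (E - dense_points \<nu> k) < \<delta>/2"
  proof -
    have "\<exists>k. measure \<nu> (E - dense_points \<nu> k) < \<delta>/2"
    proof (rule measure_decseq_small[OF \<nu>(1)])
      show "E - dense_points \<nu> k \<in> sets \<nu>" for k using Eb dense_points_borel[OF \<nu>(1,2)] \<nu>(2) by auto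
      show "decseq (\<lambda>k. E - dense_points \<nu> k)" unfolding decseq_def using dense_points_mono by blast
      show "(\<Inter>k. E - dense_points \<nu> k) = {}" using Edense by auto
    qed (use \<delta> in auto)
    then show ?thesis using that by blast
  qed
  have EDb: "E \<inter> dense_points \<nu> k \<in> sets borel" using Eb dense_points_borel[OF \<nu>(1,2)] by auto
  obtain E' where E': "E' \<subseteq> E \<inter> dense_points \<nu> k" "compact E'" "measure \<nu> (E \<inter> dense_points \<nu> k - E') < \<delta>/2"
    using compact_approximation[OF \<nu>(1,2) EDb, of "\<delta>/2"] \<delta> by auto
  have E'b: "E' \<in> sets borel" using E'(2) by (rule borel_compact)
  have rest1: "measure \<nu> (E - E') < \<delta>"
  proof -
    have "measure \<nu> (E - E') \<le> measure \<nu> ((E - dense_points \<nu> k) \<union> (E \<inter> dense_points \<nu> k - E'))"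
      by (rule \<nu>.finite_measure_mono, blast, simp only: \<nu>(2), intro sets.Un sets.Diff Eb E'b EDb dense_points_borel[OF \<nu>(1,2)])
    also have "\<dots> \<le> measure \<nu> (E - dense_points \<nu> k) + measure \<nu> (E \<inter> dense_points \<nu> k - E')"
      by (rule measure_Un_le; simp only: \<nu>(2); intro sets.Un sets.Diff Eb E'b EDb dense_points_borel[OF \<nu>(1,2)])
    finally show ?thesis using k E'(3) by linarith
  qed
  \<comment> \<open>The lines with pairs of distinct points of \<open>E'\<close> arbitrarily close
    together. The density built into \<open>dense_points \<nu> k\<close> makes \<open>C\<close>
    Lebesgue null, and it is invariant along \<open>e\<close>, so no component along
    \<open>e\<close> charges it.\<close>
  define C where "C = (\<Inter>m. near_pairs E' e m)"
  have Cb: "C \<in> sets borel" unfolding C_def using near_pairs_borel[OF E'(2)] by auto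
  have C0: "emeasure lborel C = 0" unfolding C_def
  proof (rule near_pairs_null[OF E'(2) e])
    fix j assume "k \<le> j"
    then show "emeasure lborel (\<Union>x\<in>E'. ball x ((1/2)^j)) \<le>
        ennreal ((1/2)^j * (2 ^ DIM(real^'d) * unit_ball_vol (DIM(real^'d)) * measure \<nu> UNIV / (1 / real (Suc k))))"
      using E'(1) by (intro neighbourhood_volume[OF \<nu>(1,2)]) (auto simp: dense_points_def)
  qed simp
  have Cs: "x + t *\<^sub>R e \<in> C \<longleftrightarrow> x \<in> C" for x t unfolding C_def by (simp add: near_pairs_shift)
  have DC: "measure (?D n) C = 0" for n by (rule dvar_null_cylinder[OF \<mu> lg Cb C0 Cs])
  \<comment> \<open>Removing the near pairs of scale \<open>1 / real (Suc m)\<close> leaves points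
    whose neighbours in \<open>E'\<close> on the same line are farther away than this scale. As
    \<open>m\<close> grows these sets exhaust \<open>E' - C\<close>.\<close>
  define G where "G m = E' - near_pairs E' e m" for m
  have Gb: "G m \<in> sets borel" for m unfolding G_def using E'b near_pairs_borel[OF E'(2)] by auto
  obtain m where m: "measure \<nu> ((E' - C) - G m) < \<delta>/2"
  proof -
    have "\<exists>m. measure \<nu> ((E' - C) - G m) < \<delta>/2"
    proof (rule measure_decseq_small[OF \<nu>(1)])
      show "(E' - C) - G m \<in> sets \<nu>" for m using E'b Cb Gb \<nu>(2) by auto
      show "decseq (\<lambda>m. (E' - C) - G m)" unfolding decseq_def G_def using near_pairs_antimono by blast
      show "(\<Inter>m. (E' - C) - G m) = {}" by (auto simp: G_def C_def)
    qed (use \<delta> in auto)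
    then show ?thesis using that by blast
  qed
  obtain K where K: "K \<subseteq> G m" "compact K" "measure \<nu> (G m - K) < \<delta>/2"
    using compact_approximation[OF \<nu>(1,2) Gb[of m], of "\<delta>/2"] \<delta> by auto
  have Kb: "K \<in> sets borel" using K(2) by (rule borel_compact)
  have rest2: "measure \<nu> ((E' - C) - K) < \<delta>"
  proof -
    have "measure \<nu> ((E' - C) - K) \<le> measure \<nu> (((E' - C) - G m) \<union> (G m - K))"
      by (rule \<nu>.finite_measure_mono, blast, simp only: \<nu>(2), intro sets.Un sets.Diff E'b Cb Gb Kb)
    also have "\<dots> \<le> measure \<nu> ((E' - C) - G m) + measure \<nu> (G m - K)"
      by (rule measure_Un_le; simp only: \<nu>(2); intro sets.Un sets.Diff E'b Cb Gb Kb)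
    finally show ?thesis using m K(3) by linarith
  qed
  have sep: "t = 0" if "x \<in> K" "x + t *\<^sub>R e \<in> K" "\<bar>t\<bar> \<le> 1 / real (Suc m)" for x t
  proof (rule ccontr)
    assume "t \<noteq> 0"
    then have "x \<in> near_pairs E' e m"
      using that K(1) unfolding near_pairs_def mem_Collect_eq G_def
      by (intro exI[of _ 0] exI[of _ t]) auto
    then show False using that(1) K(1) by (auto simp: G_def)
  qed
  \<comment> \<open>The radius is twice the later \<open>h\<close>, so that the closed segments of
    half-length \<open>h\<close> about points of \<open>K\<close> stay inside the open
    balls.\<close>
  define N where "N l = (\<Union>x\<in>K. ball x (2 / real (Suc l)))" for l
  have Nb: "N l \<in> sets borel" for l unfolding N_def by (intro borel_open open_UN) auto
  have Nmono: "N l' \<subseteq> N l" if "l \<le> l'" for l l'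
  proof -
    have "2 / real (Suc l') \<le> 2 / real (Suc l)" using that by (simp add: field_simps)
    then show ?thesis unfolding N_def by (intro UN_mono subset_ball) auto
  qed
  have "\<exists>l. measure \<nu> (N l - K) < \<delta>"
  proof (rule measure_decseq_small[OF \<nu>(1)])
    show "N l - K \<in> sets \<nu>" for l using Nb Kb \<nu>(2) by auto
    show "decseq (\<lambda>l. N l - K)" unfolding decseq_def using Nmono by blast
    have "x \<in> K" if x: "\<And>l. x \<in> N l" for x
    proof -
      have "x \<in> closure K" unfolding closure_approachable
      proof (intro allI impI)
        fix \<eta> :: real assume "0 < \<eta>"
        then obtain l where l: "1 / real (Suc l) < \<eta> / 2" using nat_approx_posE[of "\<eta>/2"] by auto
        obtain y where "y \<in> K" "dist y x < 2 / real (Suc l)" using x[of l] by (auto simp: N_def)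
        then show "\<exists>y\<in>K. dist y x < \<eta>" using l by (intro bexI[of _ y]) auto
      qed
      then show ?thesis using K(2) by (simp add: compact_imp_closed)
    qed
    then show "(\<Inter>l. N l - K) = {}" by blast
  qed (rule \<delta>(1))
  then obtain l0 where l0: "measure \<nu> (N l0 - K) < \<delta>" by blast
  \<comment> \<open>The maximum secures two things: the collar \<open>N l - K\<close> is small, and
    \<open>h\<close> does not exceed the separation scale of \<open>K\<close>.\<close>
  define l where "l = max l0 m"
  have "measure \<nu> (N l - K) \<le> measure \<nu> (N l0 - K)"
    by (rule \<nu>.finite_measure_mono) (use Nmono[of l0 l] Nb Kb \<nu>(2) in \<open>auto simp: l_def\<close>)
  then have l: "measure \<nu> (N l - K) < \<delta>" using l0 by linarith
  define h where "h = 1 / real (Suc l)"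
  have h: "0 < h" by (simp add: h_def)
  have hm: "h \<le> 1 / real (Suc m)" unfolding h_def l_def by (simp add: field_simps)
  obtain R0 where R0: "\<And>x. x \<in> K \<Longrightarrow> norm x \<le> R0" using compact_imp_bounded[OF K(2)] by (auto simp: bounded_iff)
  define R where "R = R0 + 3"
  have NR: "N l \<subseteq> ball 0 R"
  proof
    fix x assume "x \<in> N l"
    then obtain y where y: "y \<in> K" "dist y x < 2 / real (Suc l)" by (auto simp: N_def)
    have "2 / real (Suc l) \<le> 2" by (simp add: field_simps)
    moreover have "norm x \<le> norm y + dist y x" by (metis dist_norm norm_triangle_sub add.commute dist_commute)
    ultimately show "x \<in> ball 0 R" using y(2) R0[OF y(1)] by (simp add: R_def)
  qed
  \<comment> \<open>From here on \<open>n\<close> varies, with \<open>E\<close>, \<open>K\<close>,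
    \<open>h\<close> and \<open>R\<close> already fixed.\<close>
  have main: "measure (?D n) E \<le> 4 * \<epsilon> + 2 / h * (\<integral>x. \<bar>g n x\<bar> * indicator (ball 0 R) x \<partial>lborel)" for n
  proof -
    interpret D: finite_measure "?D n" by (rule fD)
    have K_le: "measure (?D n) K \<le> 2 / h * (\<integral>x. \<bar>g n x\<bar> * indicator (ball 0 R) x \<partial>lborel) + measure (?D n) (N l - K)"
    proof (rule dvar_separated_le[OF \<mu> g h Kb _ Nb _ NR])
      fix x t assume "x \<in> K" "x + t *\<^sub>R e \<in> K" "\<bar>t\<bar> \<le> h"
      then show "t = 0" using sep hm by (meson order_trans)
    next
      fix x t assume x: "x \<in> K" "\<bar>t\<bar> \<le> h"
      have "dist x (x + t *\<^sub>R e) < 2 / real (Suc l)"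
      proof -
        have "dist x (x + t *\<^sub>R e) = \<bar>t\<bar>" using e by (simp add: dist_norm)
        also have "\<dots> \<le> 1 / real (Suc l)" using x by (simp add: h_def)
        also have "\<dots> < 2 / real (Suc l)" by (simp add: divide_strict_right_mono)
        finally show ?thesis .
      qed
      with x(1) show "x + t *\<^sub>R e \<in> N l" unfolding N_def by (intro UN_I[of x]) (auto simp only: mem_ball)
    qed
    have "measure (?D n) E \<le> measure (?D n) ((E - E') \<union> (C \<union> (((E' - C) - K) \<union> K)))"
      by (rule D.finite_measure_mono, blast, simp only: sD, intro sets.Un sets.Diff Eb E'b Cb Kb Nb)
    also have "\<dots> \<le> measure (?D n) (E - E') + measure (?D n) (C \<union> (((E' - C) - K) \<union> K))"
      by (rule measure_Un_le; simp only: sD; intro sets.Un sets.Diff Eb E'b Cb Kb Nb)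
    also have "measure (?D n) (C \<union> (((E' - C) - K) \<union> K)) \<le> measure (?D n) C + measure (?D n) (((E' - C) - K) \<union> K)"
      by (rule measure_Un_le; simp only: sD; intro sets.Un sets.Diff Eb E'b Cb Kb Nb)
    also have "measure (?D n) (((E' - C) - K) \<union> K) \<le> measure (?D n) ((E' - C) - K) + measure (?D n) K"
      by (rule measure_Un_le; simp only: sD; intro sets.Un sets.Diff Eb E'b Cb Kb Nb)
    finally have "measure (?D n) E \<le> measure (?D n) (E - E') + (measure (?D n) C + (measure (?D n) ((E' - C) - K) + measure (?D n) K))"
      by simp
    moreover have "measure (?D n) (E - E') \<le> \<epsilon>" by (rule D\<epsilon>[OF _ rest1], intro sets.Un sets.Diff Eb E'b Cb Kb Nb)
    moreover have "measure (?D n) ((E' - C) - K) \<le> \<epsilon>" by (rule D\<epsilon>[OF _ rest2], intro sets.Un sets.Diff Eb E'b Cb Kb Nb)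
    moreover have "measure (?D n) (N l - K) \<le> \<epsilon>" by (rule D\<epsilon>[OF _ l], intro sets.Un sets.Diff Eb E'b Cb Kb Nb)
    ultimately show ?thesis using K_le DC[of n] \<epsilon>(1) by linarith
  qed
  have "(\<lambda>n. 2 / h * (\<integral>x. \<bar>g n x\<bar> * indicator (ball 0 R) x \<partial>lborel)) \<longlonglongrightarrow> 2 / h * 0"
    by (intro tendsto_mult tendsto_const weak_null_local_L1[OF g \<mu> M weak])
  then have "(\<lambda>n. 2 / h * (\<integral>x. \<bar>g n x\<bar> * indicator (ball 0 R) x \<partial>lborel)) \<longlonglongrightarrow> 0" by simp
  from order_tendstoD(2)[OF this \<epsilon>(1)]
  show "\<forall>\<^sub>F n in sequentially. dist (measure (?D n) (\<Union>n. jump_set (g n))) 0 < \<epsilon>0"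
    unfolding E_def[symmetric]
  proof eventually_elim
    case (elim n)
    then have "measure (?D n) E < \<epsilon>0" using main[of n] \<epsilon> by linarith
    then show ?case by simp
  qed
qed

theorem theorem1:
  fixes F :: "nat \<Rightarrow> real^'d \<Rightarrow> real" and f :: "real^'d \<Rightarrow> real"
  assumes "\<And>n. F n \<in> BV" and "f \<in> BV" and "bv_weak_conv F f"
  shows "(\<lambda>n. jump_variation (\<lambda>x. f x - F n x)) \<longlonglongrightarrow> 0"
proof -
  have u: "(\<lambda>x. f x - F n x) \<in> BV" for n
    using BV_lincomb[OF assms(2) assms(1)[of n], of 1 "-1"] by simp
  then have lu: "integrable lebesgue (\<lambda>x. f x - F n x)" for n by (auto simp: BV_def)
  have "\<forall>n. \<exists>z. grad_measure (\<lambda>x. f x - F n x) (fst z) (snd z)"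
    using u by (auto simp: BV_def)
  from choice[OF this] obtain z where z: "\<And>n. grad_measure (\<lambda>x. f x - F n x) (fst (z n)) (snd (z n))" by blast
  define \<mu> where "\<mu> n = fst (z n)" for n
  define \<sigma> where "\<sigma> n = snd (z n)" for n
  have \<mu>: "grad_measure (\<lambda>x. f x - F n x) (\<mu> n) (\<sigma> n)" for n using z by (simp add: \<mu>_def \<sigma>_def)
  note p = grad_measure_polar[OF \<mu>]
  have "\<forall>n. \<exists>g. g \<in> borel_measurable borel \<and> integrable lborel g \<and>
    (\<forall>\<mu> \<sigma>. grad_measure (\<lambda>x. f x - F n x) \<mu> \<sigma> \<longrightarrow> grad_measure g \<mu> \<sigma>) \<and> jump_set g = jump_set (\<lambda>x. f x - F n x) \<and>
    (\<forall>\<psi>\<in>borel_measurable borel. (\<integral>x. (f x - F n x) * \<psi> x \<partial>lebesgue) = (\<integral>x. g x * \<psi> x \<partial>lborel))"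
    using BV_borel_version[OF lu] by blast
  from choice[OF this] obtain g where g: "\<And>n. g n \<in> borel_measurable borel" "\<And>n. integrable lborel (g n)"
    "\<And>n. grad_measure (g n) (\<mu> n) (\<sigma> n)" "\<And>n. jump_set (g n) = jump_set (\<lambda>x. f x - F n x)"
    "\<And>n \<psi>. \<psi> \<in> borel_measurable borel \<Longrightarrow> (\<integral>x. (f x - F n x) * \<psi> x \<partial>lebesgue) = (\<integral>x. g n x * \<psi> x \<partial>lborel)"
    using \<mu> by blast
  \<comment> \<open>The jump set of each difference is enlarged to the union of all, the set for
    which the uniform estimate was proved.\<close>
  define J where "J = (\<Union>n. jump_set (g n))"
  have Jb: "J \<in> sets borel" unfolding J_def using jump_set_borel[OF g(1,2)] by auto
  have "(\<lambda>n. measure (dvar (\<mu> n) (\<sigma> n) e) J) \<longlonglongrightarrow> 0" if "e \<in> Basis" for e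
    unfolding J_def
  proof (rule uniformly_small_remainder[OF g(1-3)])
    show "(\<lambda>n. \<integral>x. g n x * \<psi> x \<partial>lborel) \<longlonglongrightarrow> 0" if "bounded_borel \<psi>" for \<psi>
      using weak_conv_integral[OF assms(3,1,2) that] g(5)[OF bounded_borel_measurable[OF that]] by simp
    show "(\<lambda>n. \<integral>x. \<Psi> x \<bullet> \<sigma> n x \<partial>\<mu> n) \<longlonglongrightarrow> 0" if "bounded_borel \<Psi>" for \<Psi>
      by (rule weak_conv_field[OF assms(3,1,2) \<mu> that])
  qed (use that in simp)
  then have "(\<lambda>n. \<Sum>e\<in>Basis. measure (dvar (\<mu> n) (\<sigma> n) e) J) \<longlonglongrightarrow> (\<Sum>e\<in>(Basis :: (real^'d) set). 0)"
    by (intro tendsto_sum)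
  then have sum0: "(\<lambda>n. ennreal (\<Sum>e\<in>Basis. measure (dvar (\<mu> n) (\<sigma> n) e) J)) \<longlonglongrightarrow> 0"
    using tendsto_ennrealI[of _ 0] by simp
  have le: "jump_variation (\<lambda>x. f x - F n x) \<le> ennreal (\<Sum>e\<in>Basis. measure (dvar (\<mu> n) (\<sigma> n) e) J)" for n
  proof -
    have "jump_variation (\<lambda>x. f x - F n x) \<le> emeasure (\<mu> n) (jump_set (\<lambda>x. f x - F n x))"
      by (rule jump_variation_le(1)[OF \<mu> lu])
    also have "\<dots> \<le> emeasure (\<mu> n) J"
      by (rule emeasure_mono) (use g(4)[of n] Jb polar_sets[OF p] in \<open>auto simp: J_def\<close>)
    also have "\<dots> = ennreal (measure (\<mu> n) J)"
      by (rule finite_measure.emeasure_eq_measure[OF polar_finite[OF p]])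
    also have "\<dots> \<le> ennreal (\<Sum>e\<in>Basis. measure (dvar (\<mu> n) (\<sigma> n) e) J)"
      by (intro ennreal_leI measure_le_sum_dvar[OF p Jb])
    finally show ?thesis .
  qed
  show ?thesis
    by (rule tendsto_sandwich[OF _ _ tendsto_const sum0]) (use le in auto)
qed

end
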